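(* Let $\lambda>1$, $\Delta_1=[-\lambda,-1]$, $\Delta_2=[1,\lambda]$, and let $\mathcal R$, $\pi$, $\psi^{(1)}$, $\psi^{(2)}$ be as in the context. Then the equation $a^8+(16\lambda^2-8)a^6+18a^4-27=0$ has a unique solution $a\in(0,1)$. With this $a$, put $$H(z)=z-\frac{(1-a^2)^2z}{(1+a^2)(1-z^2)},\qquad G(z)=\frac{H(z)}{H(a)}.$$ Then $G$ lifts to a conformal homeomorphism $g:\overline{\mathbb C}\to\mathcal R$ with $\pi\circ g=G$, and, writing $G^{-1}:=g^{-1}:\mathcal R\to\overline{\mathbb C}$, $$\psi^{(1)}=\frac{1+a^2}{2a^3}\,(G^{-1}+1),\qquad \psi^{(2)}=\frac{(1-a^2)^2}{8a^3}\,\frac{G^{-1}+1}{G^{-1}-1}.$$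
   Context: $\overline{\mathbb C}$ is the extended complex plane. Given $\Delta_1$ and $\Delta_2$, $\mathcal R$ is the compact three-sheeted Riemann surface formed by the sheets $\mathcal R_0=\overline{\mathbb C}\setminus\Delta_1$, $\mathcal R_1=\overline{\mathbb C}\setminus(\Delta_1\cup\Delta_2)$, $\mathcal R_2=\overline{\mathbb C}\setminus\Delta_2$, where $\mathcal R_0$ and $\mathcal R_1$ are glued crosswise along $\Delta_1$ (upper bank of one identified with lower bank of the other) and $\mathcal R_1$ and $\mathcal R_2$ are glued crosswise along $\Delta_2$. It is a branched cover of $\overline{\mathbb C}$ with projection $\pi$, of genus $0$. For $w\in\overline{\mathbb C}$, $w^{(k)}$ denotes the point of sheet $\mathcal R_k$ over $w$. For $l\in\{1,2\}$, $\psi^{(l)}$ denotes the conformal map of $\mathcal R$ onto $\overline{\mathbb C}$ with $\psi^{(l)}(w)=w+O(1)$ as $w\to\infty^{(l)}$ and $\psi^{(l)}(w)=C_1/w+O(1/w^2)$ as $w\to\infty^{(0)}$ for some constant $C_1$. *)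

theory Defs
  imports "HOL-Analysis.Analysis" "HOL-Library.Landau_Symbols"
begin

text \<open>The extended complex plane is modelled as complex option; None is the point at infinity.
  Its topology is generated by the open subsets of the plane and the punctured
  neighbourhoods of infinity.\<close>

definition sphere_top :: "complex option topology" where
  "sphere_top = topology_generated_by
     ({Some ` U | U. open U} \<union> {insert None (Some ` {w. r < norm w}) | r. True})"

definition sph_inv :: "complex option \<Rightarrow> complex option" where
  "sph_inv z = (case z of None \<Rightarrow> Some 0 | Some w \<Rightarrow> (if w = 0 then None else Some (inverse w)))"

text \<open>A sphere-valued function of a complex variable is holomorphic (i.e. meromorphic as a map
  into the sphere) near w, read in one of the two charts of the target.\<close>
definition sph_holo_at :: "(complex \<Rightarrow> complex option) \<Rightarrow> complex \<Rightarrow> bool" where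
  "sph_holo_at F w \<longleftrightarrow>
     (\<exists>M \<in> {id, sph_inv}. \<exists>e>0. (\<forall>u\<in>ball w e. M (F u) \<noteq> None) \<and>
        (\<lambda>u. the (M (F u))) holomorphic_on ball w e)"

definition Delta1 :: "real \<Rightarrow> complex set" where
  "Delta1 lam = complex_of_real ` {-lam..-1}"
definition Delta2 :: "real \<Rightarrow> complex set" where
  "Delta2 lam = complex_of_real ` {1..lam}"

definition cutset :: "real \<Rightarrow> nat \<Rightarrow> complex set" where
  "cutset lam k = (if k = 0 then Delta1 lam else if k = 1 then Delta1 lam \<union> Delta2 lam
                   else Delta2 lam)"

definition Dcut :: "real \<Rightarrow> nat \<Rightarrow> complex set" where
  "Dcut lam j = (if j = 1 then Delta1 lam else Delta2 lam)"

definition cut_int :: "real \<Rightarrow> nat \<Rightarrow> real set" where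
  "cut_int lam j = (if j = 1 then {-lam<..<-1} else {1<..<lam})"
definition cut_ends :: "real \<Rightarrow> nat \<Rightarrow> real set" where
  "cut_ends lam j = (if j = 1 then {-lam, -1} else {1, lam})"

text \<open>Points of R:
  Reg k w : the point of sheet k over w, w not on a cut of sheet k (w = None is infinity);
  Cut j b x : x in the interior of cut j, glued point joining sheets j-1 and j;
     b = True: upper bank of sheet j-1 identified with lower bank of sheet j,
     b = False: lower bank of sheet j-1 identified with upper bank of sheet j;
  Br x : branch point over an endpoint x of a cut.\<close>
datatype rpt = Reg nat "complex option" | Cut nat bool real | Br real

definition R_set :: "real \<Rightarrow> rpt set" where
  "R_set lam =
     {Reg k (Some w) | k w. k \<le> 2 \<and> w \<notin> cutset lam k} \<union> {Reg k None | k. k \<le> 2}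
     \<union> {Cut j b x | j b x. j \<in> {1,2} \<and> x \<in> cut_int lam j}
     \<union> {Br x | x j. j \<in> {1,2} \<and> x \<in> cut_ends lam j}"

fun proj :: "rpt \<Rightarrow> complex option" where
  "proj (Reg k w) = w"
| "proj (Cut j b x) = Some (complex_of_real x)"
| "proj (Br x) = Some (complex_of_real x)"

definition R_sub :: "real \<Rightarrow> rpt set set" where
  "R_sub lam =
     {{Reg k (Some w) | w. w \<in> U} | k U. k \<le> 2 \<and> open U \<and> U \<inter> cutset lam k = {}}
   \<union> {insert (Reg k None) {Reg k (Some w) | w. r < norm w} | k r. k \<le> 2 \<and> lam \<le> r}
   \<union> {{Cut j b y | y. \<bar>y - x\<bar> < r}
        \<union> {Reg (j - 1) (Some w) | w. dist w (complex_of_real x) < r \<and>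
              (if b then Im w > 0 else Im w < 0)}
        \<union> {Reg j (Some w) | w. dist w (complex_of_real x) < r \<and>
              (if b then Im w < 0 else Im w > 0)}
      | j b x r. j \<in> {1,2} \<and> 0 < r \<and> {y. \<bar>y - x\<bar> < r} \<subseteq> cut_int lam j}
   \<union> {{Br e} \<union> {Cut j b y | b y. y \<in> cut_int lam j \<and> \<bar>y - e\<bar> < r}
        \<union> {Reg k (Some w) | k w. k \<in> {j - 1, j} \<and> dist w (complex_of_real e) < r \<and>
              w \<notin> Dcut lam j}
      | j e r. j \<in> {1,2} \<and> e \<in> cut_ends lam j \<and> 0 < r \<and> r \<le> lam - 1 \<and> r \<le> 1}"

definition R_top :: "real \<Rightarrow> rpt topology" where
  "R_top lam = topology_generated_by (R_sub lam)"

text \<open>A conformal map of R onto the extended plane: a homeomorphism which is holomorphic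
  (as a sphere-valued map) in the natural coordinate on the interior of every sheet, including
  the coordinate 1/w at the point at infinity of each sheet.  (Holomorphy across the cuts and at
  the branch points then follows from continuity by removability.)\<close>
definition conformal_R :: "real \<Rightarrow> (rpt \<Rightarrow> complex option) \<Rightarrow> bool" where
  "conformal_R lam S \<longleftrightarrow>
     homeomorphic_map (R_top lam) sphere_top S \<and>
     (\<forall>k\<le>2. \<forall>w. w \<notin> cutset lam k \<longrightarrow> sph_holo_at (\<lambda>u. S (Reg k (Some u))) w) \<and>
     (\<forall>k\<le>2. sph_holo_at (\<lambda>u. S (Reg k (if u = 0 then None else Some (inverse u)))) 0)"

definition is_psi :: "real \<Rightarrow> nat \<Rightarrow> (rpt \<Rightarrow> complex option) \<Rightarrow> bool" where
  "is_psi lam l psi \<longleftrightarrow>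
     conformal_R lam psi \<and>
     (\<forall>\<^sub>F w in at_infinity. psi (Reg l (Some w)) \<noteq> None) \<and>
     (\<lambda>w. the (psi (Reg l (Some w))) - w) \<in> O[at_infinity](\<lambda>_. 1) \<and>
     (\<forall>\<^sub>F w in at_infinity. psi (Reg 0 (Some w)) \<noteq> None) \<and>
     (\<exists>C1. (\<lambda>w. the (psi (Reg 0 (Some w))) - C1 / w) \<in> O[at_infinity](\<lambda>w. 1 / w ^ 2))"

definition H :: "real \<Rightarrow> complex \<Rightarrow> complex" where
  "H a z = z - (1 - (complex_of_real a)\<^sup>2)\<^sup>2 * z / ((1 + (complex_of_real a)\<^sup>2) * (1 - z\<^sup>2))"

definition G_sph :: "real \<Rightarrow> complex option \<Rightarrow> complex option" where
  "G_sph a z = (case z of None \<Rightarrow> None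
      | Some u \<Rightarrow> (if u = 1 \<or> u = -1 then None else Some (H a u / H a (complex_of_real a))))"

text \<open>The Moebius maps with psi^(l) = psi_formula l a o G^(-1).\<close>
definition psi_formula :: "nat \<Rightarrow> real \<Rightarrow> complex option \<Rightarrow> complex option" where
  "psi_formula l a z =
     (if l = 1 then
        (case z of None \<Rightarrow> None
         | Some u \<Rightarrow> Some (complex_of_real ((1 + a\<^sup>2) / (2 * a ^ 3)) * (u + 1)))
      else
        (case z of None \<Rightarrow> Some (complex_of_real ((1 - a\<^sup>2)\<^sup>2 / (8 * a ^ 3)))
         | Some u \<Rightarrow> (if u = 1 then None
             else Some (complex_of_real ((1 - a\<^sup>2)\<^sup>2 / (8 * a ^ 3)) * ((u + 1) / (u - 1))))))"

end

theory Submission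
  imports Defs "HOL-Complex_Analysis.Complex_Analysis"
begin

text \<open>
  Put \<open>c = (1 - a^2)^2 / (1 + a^2)\<close> and \<open>h = H(a)\<close>, so that \<open>h G(z) = z + c z / (z^2 - 1)\<close>. Then
  \<open>h Im G(z)\<close> is a positive multiple of \<open>Im z (|z^2 - 1|^2 - c (1 + |z|^2))\<close>, so the non-real points
  with real image lie on the curve \<open>|z^2 - 1|^2 = c (1 + |z|^2)\<close>. It consists of two ovals around \<open>-1\<close>
  and \<open>1\<close>. On them \<open>(h G)^2\<close> is a strictly increasing function of \<open>|z|^2\<close>, which runs from \<open>a^2\<close> to
  \<open>b^2 = (3 - a^2) / (1 + a^2)\<close>, and the equation for \<open>a\<close> says exactly that \<open>G(b) = lam\<close>. Hence \<open>G\<close>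
  folds the two ovals onto the two cuts, identifying conjugate points.

  The three regions cut out by the ovals are the sheets: the image of each region is open, and
  closed away from its cuts by compactness, so it is the whole complement of its cuts; as \<open>G\<close> is a
  cubic, counting preimages gives bijectivity. Gluing defines a continuous bijection \<open>g\<close> from
  the compact sphere to a Hausdorff space, hence a homeomorphism.

  If \<open>psi\<close> is normalised as in the theorem then \<open>psi o g\<close> is holomorphic off the ovals, across them
  because \<open>G\<close> straightens them locally to the real axis, and at the remaining points because
  isolated singularities are removable. Its difference with the Moebius formula is a bounded entire
  function vanishing at \<open>-1\<close>, which is zero by Liouville's theorem.
\<close>

section \<open>The Riemann sphere and sphere-valued holomorphic functions\<close>

text \<open>The parameter encodes the branch values. The derivative of h G is ((z^2 - 1)^2 - c (1 +
  z^2)) / (z^2 - 1)^2, and c is the number that makes it vanish at a; b is the other positive zero.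
  Dividing by h puts the branch value G(a) at 1, and squaring G(b) = lam and clearing denominators
  gives the octic. On the real axis the same numerator is the function that cuts out the ovals,
  which therefore cross the axis exactly at the critical points a, -a, b, -b.

  The counting needs surjectivity as its input: a priori a region could meet its own cuts or cover a
  value twice. Since every region covers the complement of its cuts, the preimages in the other
  regions and on the ovals use up the degree three, which excludes both.

  \<open>conformal_R\<close> asks for holomorphy only inside the sheets, so on the ovals it has to
  be recovered from continuity. The normalisation on sheet l matches the principal part of psi o g
  with that of the Moebius map; the one on sheet 0 forces both to vanish at -1, which removes the
  additive constant.\<close>

lemma filterlim_at_infinityD:
  "filterlim f at_infinity net \<Longrightarrow> eventually (\<lambda>u. r < norm (f u)) net"
  by (metis filterlim_at_infinity_imp_norm_at_top filterlim_at_top_dense)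

text \<open>Induction over the generation of the topology. It reduces openness on the sphere to
  openness in the plane together with one condition on the exterior of a disc.\<close>

lemma openin_sphere_top:
  "openin sphere_top V \<longleftrightarrow>
     open (Some -` V) \<and> (None \<in> V \<longrightarrow> (\<exists>r. \<forall>z. r < norm z \<longrightarrow> Some z \<in> V))"
  (is "_ \<longleftrightarrow> ?R V")
proof
  assume "openin sphere_top V"
  then have "generate_topology_on ({Some ` U | U. open U} \<union> {insert None (Some ` {w. r < norm w}) | r. True}) V"
    unfolding sphere_top_def by (rule openin_topology_generated_by)
  then show "?R V"
  proof induct
    case (Int a b)
    then obtain r s where rs: "None \<in> a \<Longrightarrow> \<forall>z. r < norm z \<longrightarrow> Some z \<in> a"
      "None \<in> b \<Longrightarrow> \<forall>z. s < norm z \<longrightarrow> Some z \<in> b" by blast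
    then have "None \<in> a \<inter> b \<longrightarrow> (\<forall>z. max r s < norm z \<longrightarrow> Some z \<in> a \<inter> b)" by auto
    moreover have "open (Some -` (a \<inter> b))" unfolding vimage_Int using Int by (intro open_Int) auto
    ultimately show ?case by blast
  next
    case (UN K)
    have "open (\<Union>k\<in>K. Some -` k)" using UN by blast
    then show ?case using UN by (auto simp: vimage_Union) metis
  next
    case (Basis s)
    then consider U where "s = Some ` U" "open U" | r where "s = insert None (Some ` {w. r < norm w})"
      by auto
    then show ?case
    proof cases
      case 1
      then show ?thesis by (auto simp: inj_vimage_image_eq)
    next
      case (2 r)
      have "Some -` s = {w. r < norm w}" using 2 by auto
      moreover have "open {w::complex. r < norm w}" by (intro open_Collect_less continuous_intros)
      ultimately show ?thesis using 2 by auto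
    qed
  qed auto
next
  assume R: "?R V"
  have op: "openin sphere_top (Some ` U)" if "open U" for U
    unfolding sphere_top_def using that by (intro topology_generated_by_Basis) blast
  have opn: "openin sphere_top (insert None (Some ` {w. r < norm w}))" for r
    unfolding sphere_top_def by (intro topology_generated_by_Basis) blast
  show "openin sphere_top V"
  proof (cases "None \<in> V")
    case False
    then have "V = Some ` (Some -` V)" by (auto simp: image_iff) (metis option.exhaust)
    then show ?thesis using op R by metis
  next
    case True
    then obtain r where r: "\<forall>z. r < norm z \<longrightarrow> Some z \<in> V" using R by blast
    have "V = Some ` (Some -` V) \<union> insert None (Some ` {w. r < norm w})"
      using True r by (auto simp: image_iff)
    then show ?thesis using op R opn by (metis openin_Un)
  qed
qed

lemma topspace_sphere_top [simp]: "topspace sphere_top = UNIV"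
proof -
  have "openin sphere_top UNIV" by (simp add: openin_sphere_top)
  then show ?thesis using openin_subset by blast
qed

text \<open>By Heine-Borel the complement of a neighbourhood of infinity is compact exactly when it
  is closed and bounded. Compactness and the Hausdorff property of the sphere are inherited through
  this identification.\<close>

lemma sphere_top_eq_Alexandroff: "sphere_top = Alexandroff_compactification euclidean"
proof (rule topology_eq[THEN iffD2], intro allI)
  fix V :: "complex option set"
  show "openin sphere_top V \<longleftrightarrow> openin (Alexandroff_compactification euclidean) V"
  proof (cases "None \<in> V")
    case False
    then have "V = Some ` (Some -` V)" by (auto simp: image_iff) (metis option.exhaust)
    then have "openin (Alexandroff_compactification euclidean) V \<longleftrightarrow> open (Some -` V)"
      by (metis openin_Alexandroff_compactification_image_Some open_openin)
    then show ?thesis using False by (simp add: openin_sphere_top)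
  next
    case True
    have V: "V = insert None (Some ` (UNIV - C)) \<longleftrightarrow> - (Some -` V) = C" for C
    proof -
      have "V = insert None (Some ` (Some -` V))" using True
        by (auto simp: image_iff)
      then have "V = insert None (Some ` (UNIV - C)) \<longleftrightarrow> Some ` (Some -` V) = Some ` (UNIV - C)"
        by (metis None_notin_image_Some insert_ident)
      also have "\<dots> \<longleftrightarrow> - (Some -` V) = C" by (subst inj_image_eq_iff) auto
      finally show ?thesis .
    qed
    have "openin (Alexandroff_compactification euclidean) V \<longleftrightarrow> compact (- (Some -` V))"
      using True V by (auto simp: openin_Alexandroff_compactification compact_imp_closed)
    also have "\<dots> \<longleftrightarrow> open (Some -` V) \<and> (\<exists>r. \<forall>z. r < norm z \<longrightarrow> Some z \<in> V)"
    proof -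
      have "bounded (- (Some -` V)) \<longleftrightarrow> (\<exists>r. \<forall>z. r < norm z \<longrightarrow> Some z \<in> V)"
        unfolding bounded_iff by (metis ComplD ComplI not_le vimage_eq)
      then show ?thesis by (auto simp: compact_eq_bounded_closed closed_def)
    qed
    finally show ?thesis using True by (simp add: openin_sphere_top)
  qed
qed

lemma compact_space_sphere_top: "compact_space sphere_top"
  by (simp add: sphere_top_eq_Alexandroff)

lemma Hausdorff_space_sphere_top: "Hausdorff_space sphere_top"
  by (simp add: sphere_top_eq_Alexandroff Hausdorff_space_Alexandroff_compactification
      Hausdorff_space_euclidean locally_compact_space_euclidean)

text \<open>\<open>the None\<close> is an unspecified number, so convergence of
  \<open>the (F u)\<close> has to be accompanied by eventual finiteness.\<close>

lemma limitin_sphere_Some: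
  "limitin sphere_top F (Some c) net \<longleftrightarrow>
     eventually (\<lambda>u. F u \<noteq> None) net \<and> ((\<lambda>u. the (F u)) \<longlongrightarrow> c) net"
proof
  assume L: "limitin sphere_top F (Some c) net"
  have ev: "eventually (\<lambda>u. F u \<in> Some ` U) net" if "open U" "c \<in> U" for U
    using L that unfolding limitin_def
    by (auto simp: openin_sphere_top inj_vimage_image_eq)
  have "eventually (\<lambda>u. F u \<noteq> None) net" using ev[of UNIV] by (auto elim: eventually_mono)
  moreover have "((\<lambda>u. the (F u)) \<longlongrightarrow> c) net"
  proof (rule topological_tendstoI)
    fix U assume "open U" "c \<in> U"
    from ev[OF this] show "eventually (\<lambda>u. the (F u) \<in> U) net" by (auto elim!: eventually_mono)
  qed
  ultimately show "eventually (\<lambda>u. F u \<noteq> None) net \<and> ((\<lambda>u. the (F u)) \<longlongrightarrow> c) net" ..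
next
  assume R: "eventually (\<lambda>u. F u \<noteq> None) net \<and> ((\<lambda>u. the (F u)) \<longlongrightarrow> c) net"
  show "limitin sphere_top F (Some c) net"
    unfolding limitin_def
  proof (intro conjI allI impI)
    fix V assume V: "openin sphere_top V \<and> Some c \<in> V"
    then have "eventually (\<lambda>u. the (F u) \<in> Some -` V) net"
      using R by (intro topological_tendstoD) (auto simp: openin_sphere_top)
    with R show "eventually (\<lambda>u. F u \<in> V) net"
      by (auto elim: eventually_elim2)
  qed auto
qed

lemma limitin_sphere_None:
  "limitin sphere_top F None net \<longleftrightarrow> (\<forall>r. eventually (\<lambda>u. F u = None \<or> r < norm (the (F u))) net)"
proof
  assume L: "limitin sphere_top F None net"
  show "\<forall>r. eventually (\<lambda>u. F u = None \<or> r < norm (the (F u))) net"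
  proof
    fix r
    have "openin sphere_top (insert None (Some ` {w. r < norm w}))"
      unfolding sphere_top_def by (intro topology_generated_by_Basis) blast
    then have "eventually (\<lambda>u. F u \<in> insert None (Some ` {w. r < norm w})) net"
      using L unfolding limitin_def by blast
    then show "eventually (\<lambda>u. F u = None \<or> r < norm (the (F u))) net"
      by (auto elim!: eventually_mono)
  qed
next
  assume R: "\<forall>r. eventually (\<lambda>u. F u = None \<or> r < norm (the (F u))) net"
  show "limitin sphere_top F None net"
    unfolding limitin_def
  proof (intro conjI allI impI)
    fix V assume V: "openin sphere_top V \<and> None \<in> V"
    then obtain r where r: "\<forall>z. r < norm z \<longrightarrow> Some z \<in> V" by (auto simp: openin_sphere_top)
    have "F u \<in> V" if "F u = None \<or> r < norm (the (F u))" for u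
      using that r V by (cases "F u") auto
    with R[rule_format, of r] show "eventually (\<lambda>u. F u \<in> V) net" by (rule eventually_mono)
  qed auto
qed

lemma limitin_at_self:
  assumes "limitin X F (F w) (at w)"
  shows "limitin X F (F w) (nhds w)"
  using assms unfolding limitin_def eventually_nhds_conv_at by blast

lemma continuous_map_sphereI:
  assumes fin: "\<And>w. limitin X (\<lambda>u. F (Some u)) (F (Some w)) (at w)"
    and inf: "limitin X (\<lambda>u. F (Some u)) (F None) at_infinity"
  shows "continuous_map sphere_top X F"
  unfolding continuous_map
proof (intro conjI allI impI)
  show "F ` topspace sphere_top \<subseteq> topspace X"
  proof
    fix y assume "y \<in> F ` topspace sphere_top"
    then obtain z where "y = F z" by auto
    then show "y \<in> topspace X"
      using fin inf by (cases z) (auto dest: limitin_topspace)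
  qed
next
  fix V assume V: "openin X V"
  have "open {u. F (Some u) \<in> V}"
    unfolding open_subopen[of "{u. F (Some u) \<in> V}"]
  proof clarify
    fix w assume "F (Some w) \<in> V"
    then have "eventually (\<lambda>u. F (Some u) \<in> V) (nhds w)"
      using limitin_at_self[OF fin] V unfolding limitin_def by blast
    then show "\<exists>T. open T \<and> w \<in> T \<and> T \<subseteq> {u. F (Some u) \<in> V}"
      unfolding eventually_nhds by blast
  qed
  moreover have "\<exists>r. \<forall>z. r < norm z \<longrightarrow> F (Some z) \<in> V" if "F None \<in> V"
  proof -
    have "eventually (\<lambda>u. F (Some u) \<in> V) at_infinity"
      using inf V that unfolding limitin_def by blast
    then show ?thesis unfolding eventually_at_infinity by (meson less_imp_le)
  qed
  ultimately show "openin sphere_top {x \<in> topspace sphere_top. F x \<in> V}"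
    by (simp add: openin_sphere_top)
qed

lemma continuous_map_sphere_at:
  assumes "continuous_map sphere_top X F"
  shows "limitin X (\<lambda>u. F (Some u)) (F (Some w)) (at w)"
  unfolding limitin_def
proof (intro conjI allI impI)
  show "F (Some w) \<in> topspace X" using assms by (auto simp: continuous_map_def)
next
  fix V assume V: "openin X V \<and> F (Some w) \<in> V"
  then have "open (Some -` {x. F x \<in> V})"
    using assms by (auto simp: continuous_map openin_sphere_top)
  then have "eventually (\<lambda>u. u \<in> Some -` {x. F x \<in> V}) (nhds w)"
    using V by (intro eventually_nhds_in_open) auto
  then show "eventually (\<lambda>u. F (Some u) \<in> V) (at w)"
    by (simp add: eventually_nhds_conv_at)
qed

lemma continuous_map_sphere_at_infinity:
  assumes "continuous_map sphere_top X F"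
  shows "limitin X (\<lambda>u. F (Some u)) (F None) at_infinity"
  unfolding limitin_def
proof (intro conjI allI impI)
  show "F None \<in> topspace X" using assms by (auto simp: continuous_map_def)
next
  fix V assume V: "openin X V \<and> F None \<in> V"
  then have "\<exists>r. \<forall>z. r < norm z \<longrightarrow> F (Some z) \<in> V"
    using assms by (auto simp: continuous_map openin_sphere_top)
  then show "eventually (\<lambda>u. F (Some u) \<in> V) at_infinity"
    unfolding eventually_at_infinity by (metis gt_ex less_le_trans)
qed

section \<open>The reciprocal as change of charts, and local holomorphy on the sphere\<close>

lemma sph_inv_simps [simp]:
  "sph_inv None = Some 0" "sph_inv (Some 0) = None"
  "w \<noteq> 0 \<Longrightarrow> sph_inv (Some w) = Some (inverse w)"
  by (auto simp: sph_inv_def)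

lemma sph_inv_sph_inv [simp]: "sph_inv (sph_inv z) = z"
  by (cases z) (auto simp: sph_inv_def)

lemma sph_inv_eq_None_iff [simp]: "sph_inv z = None \<longleftrightarrow> z = Some 0"
  by (cases z) (auto simp: sph_inv_def)

lemma continuous_map_sph_inv: "continuous_map sphere_top sphere_top sph_inv"
proof (rule continuous_map_sphereI)
  fix w :: complex
  show "limitin sphere_top (\<lambda>u. sph_inv (Some u)) (sph_inv (Some w)) (at w)"
  proof (cases "w = 0")
    case True
    have "eventually (\<lambda>u::complex. sph_inv (Some u) = None \<or> r < norm (the (sph_inv (Some u)))) (at 0)" for r
    proof -
      have "filterlim (inverse :: complex \<Rightarrow> complex) at_infinity (at 0)" by (rule filterlim_inverse_at_infinity)
      then have "eventually (\<lambda>u. r < norm (inverse u :: complex)) (at 0)"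
        by (metis filterlim_at_infinity_imp_norm_at_top filterlim_at_top_dense)
      moreover have "eventually (\<lambda>u::complex. u \<noteq> 0) (at 0)" by (simp add: eventually_at_filter)
      ultimately show ?thesis by eventually_elim simp
    qed
    then show ?thesis using True by (simp add: limitin_sphere_None)
  next
    case False
    then have "eventually (\<lambda>u. u \<noteq> 0) (at w)"
      by (intro tendsto_imp_eventually_ne[OF tendsto_ident_at])
    moreover have "((\<lambda>u. the (sph_inv (Some u))) \<longlongrightarrow> inverse w) (at w)"
    proof (rule Lim_transform_eventually)
      show "(inverse \<longlongrightarrow> inverse w) (at w)" using False by (intro tendsto_intros)
      show "eventually (\<lambda>u. inverse u = the (sph_inv (Some u))) (at w)"
        using calculation by eventually_elim simp
    qed
    ultimately show ?thesis using False
      by (auto simp: limitin_sphere_Some elim: eventually_mono)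
  qed
next
  have "eventually (\<lambda>u::complex. u \<noteq> 0) at_infinity"
    by (simp add: eventually_at_infinity) (metis norm_zero not_one_le_zero)
  moreover have "((\<lambda>u. the (sph_inv (Some u))) \<longlongrightarrow> 0) at_infinity"
  proof (rule Lim_transform_eventually)
    show "((inverse::complex\<Rightarrow>complex) \<longlongrightarrow> 0) at_infinity" by (rule tendsto_inverse_0)
    show "eventually (\<lambda>u. inverse u = the (sph_inv (Some u))) at_infinity"
      using calculation by eventually_elim simp
  qed
  ultimately show "limitin sphere_top (\<lambda>u. sph_inv (Some u)) (sph_inv None) at_infinity"
    by (auto simp: limitin_sphere_Some elim: eventually_mono)
qed

lemma limitin_sph_inv:
  "limitin sphere_top F l net \<Longrightarrow> limitin sphere_top (\<lambda>u. sph_inv (F u)) (sph_inv l) net"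
  using continuous_map_limit[OF continuous_map_sph_inv, of F l net]
  by (simp add: o_def)

lemma sph_holo_at_sph_inv:
  assumes "sph_holo_at F w" shows "sph_holo_at (\<lambda>u. sph_inv (F u)) w"
proof -
  obtain M e where M: "M \<in> {id, sph_inv}" "e > 0" "\<forall>u\<in>ball w e. M (F u) \<noteq> None"
    "(\<lambda>u. the (M (F u))) holomorphic_on ball w e"
    using assms unfolding sph_holo_at_def by blast
  \<comment> \<open>The other chart: \<open>sph_inv\<close> is an involution, so
    \<open>sph_inv (F u)\<close> read in \<open>M'\<close> is the same function as
    \<open>F u\<close> read in \<open>M\<close>.\<close>
  define M' where "M' = (if M = id then sph_inv else id)"
  have *: "M' (sph_inv z) = M z" for z
  proof -
    have "sph_inv \<noteq> id" by (metis id_apply option.distinct(1) sph_inv_simps(1))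
    then show ?thesis using M(1) by (auto simp: M'_def)
  qed
  have "M' \<in> {id, sph_inv}" by (auto simp: M'_def)
  then show ?thesis unfolding sph_holo_at_def
    using M by (intro bexI[of _ M'] exI[of _ e]) (auto simp: *)
qed

text \<open>If holomorphy is given in the reciprocal chart, a finite value at \<open>w\<close> means
  that the chart function is nonzero there, hence nonzero nearby by continuity, and it can be
  inverted on a smaller disc.\<close>

lemma sph_holo_at_finite:
  assumes "sph_holo_at F w" "F w \<noteq> None"
  obtains e where "e > 0" "\<And>u. u \<in> ball w e \<Longrightarrow> F u \<noteq> None"
    "(\<lambda>u. the (F u)) holomorphic_on ball w e"
proof -
  obtain M e where M: "M \<in> {id, sph_inv}" "e > 0" "\<forall>u\<in>ball w e. M (F u) \<noteq> None"
    and hol: "(\<lambda>u. the (M (F u))) holomorphic_on ball w e"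
    using assms unfolding sph_holo_at_def by blast
  from M(1) consider "M = id" | "M = sph_inv" by auto
  then show ?thesis
  proof cases
    case 1
    then show ?thesis using that M hol by auto
  next
    case 2
    let ?f = "\<lambda>u. the (sph_inv (F u))"
    have hol: "?f holomorphic_on ball w e" using hol 2 by simp
    have F: "F u = (if ?f u = 0 then None else Some (inverse (?f u)))" if "u \<in> ball w e" for u
    proof -
      have "F u \<noteq> Some 0" using M 2 that by auto
      then show ?thesis by (cases "F u") (auto simp: sph_inv_def)
    qed
    have "?f w \<noteq> 0" using F[of w] assms M(2) by auto
    moreover have "continuous (at w) ?f"
      using hol M(2) holomorphic_on_imp_continuous_on continuous_on_interior by fastforce
    ultimately obtain d where d: "d > 0" "\<And>u. dist w u < d \<Longrightarrow> ?f u \<noteq> 0"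
      using continuous_at_avoid[of w ?f 0] by metis
    define e' where "e' = min d e"
    have e': "e' > 0" "ball w e' \<subseteq> ball w e" "\<And>u. u \<in> ball w e' \<Longrightarrow> ?f u \<noteq> 0"
      using d M(2) by (auto simp: e'_def)
    have "(\<lambda>u. inverse (?f u)) holomorphic_on ball w e'"
      using hol e' by (intro holomorphic_intros) (auto intro: holomorphic_on_subset)
    then have "(\<lambda>u. the (F u)) holomorphic_on ball w e'"
    proof (rule holomorphic_transform)
      fix u assume u: "u \<in> ball w e'"
      show "inverse (?f u) = the (F u)"
        using e'(3)[OF u] arg_cong[OF F[of u], of the] u e'(2) by auto
    qed
    moreover have "F u \<noteq> None" if "u \<in> ball w e'" for u
      using F[of u] e'(3)[OF that] e'(2) that by (metis option.distinct(1) subsetD)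
    ultimately show ?thesis using that e'(1) by blast
  qed
qed

lemma sph_holo_atI:
  assumes "open S" "w \<in> S" "\<And>u. u \<in> S \<Longrightarrow> F u \<noteq> None" "(\<lambda>u. the (F u)) holomorphic_on S"
  shows "sph_holo_at F w"
proof -
  obtain e where "e > 0" "ball w e \<subseteq> S" using assms(1,2) open_contains_ball by blast
  then show ?thesis unfolding sph_holo_at_def
    using assms(3,4) by (intro bexI[of _ id] exI[of _ e]) (auto intro: holomorphic_on_subset)
qed

lemma holomorphic_on_the_sph:
  assumes "open S" "\<And>u. u \<in> S \<Longrightarrow> sph_holo_at F u" "\<And>u. u \<in> S \<Longrightarrow> F u \<noteq> None"
  shows "(\<lambda>u. the (F u)) holomorphic_on S"
proof -
  have "(\<lambda>u. the (F u)) field_differentiable (at z)" if z: "z \<in> S" for z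
  proof -
    obtain e where "e > 0" "(\<lambda>u. the (F u)) holomorphic_on ball z e"
      using assms(2)[OF z] assms(3)[OF z] by (rule sph_holo_at_finite)
    then show ?thesis by (meson centre_in_ball holomorphic_on_imp_differentiable_at open_ball)
  qed
  then show ?thesis by (simp add: holomorphic_on_def field_differentiable_at_within)
qed

lemma sph_holo_at_cong:
  assumes "sph_holo_at F w" "open S" "w \<in> S" "\<And>u. u \<in> S \<Longrightarrow> F u = F' u"
  shows "sph_holo_at F' w"
proof -
  obtain M e where M: "M \<in> {id, sph_inv}" "e > 0" "\<forall>u\<in>ball w e. M (F u) \<noteq> None"
    and hol: "(\<lambda>u. the (M (F u))) holomorphic_on ball w e"
    using assms unfolding sph_holo_at_def by blast
  obtain d where d: "d > 0" "ball w d \<subseteq> S" using assms(2,3) open_contains_ball by blast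
  have sub: "ball w (min d e) \<subseteq> S" "ball w (min d e) \<subseteq> ball w e" using d by auto
  have "(\<lambda>u. the (M (F' u))) holomorphic_on ball w (min d e)"
    by (rule holomorphic_transform[OF holomorphic_on_subset[OF hol sub(2)]]) (use sub assms(4) in auto)
  moreover have "\<forall>u\<in>ball w (min d e). M (F' u) \<noteq> None" using M(3) sub assms(4) by (metis subsetD)
  ultimately show ?thesis unfolding sph_holo_at_def
    using M d by (intro bexI[of _ M] exI[of _ "min d e"]) auto
qed

lemma sph_holo_at_compose:
  assumes "sph_holo_at S (G z)" "open U" "z \<in> U" "G holomorphic_on U"
  shows "sph_holo_at (\<lambda>u. S (G u)) z"
proof -
  obtain M e where M: "M \<in> {id, sph_inv}" "e > 0" "\<forall>u\<in>ball (G z) e. M (S u) \<noteq> None"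
    and hol: "(\<lambda>u. the (M (S u))) holomorphic_on ball (G z) e"
    using assms unfolding sph_holo_at_def by blast
  have "open (U \<inter> G -` ball (G z) e)"
    using assms holomorphic_on_imp_continuous_on continuous_open_preimage by blast
  moreover have "z \<in> U \<inter> G -` ball (G z) e" using assms M by auto
  ultimately obtain d where d: "d > 0" "ball z d \<subseteq> U \<inter> G -` ball (G z) e"
    by (meson open_contains_ball)
  have "((\<lambda>u. the (M (S u))) \<circ> G) holomorphic_on ball z d"
    using d by (intro holomorphic_on_compose_gen[OF _ hol] holomorphic_on_subset[OF assms(4)]) auto
  then show ?thesis unfolding sph_holo_at_def
    using M d by (intro bexI[of _ M] exI[of _ d]) (auto simp: o_def)
qed

text \<open>Passing to the reciprocal, it is enough to treat functions that are finite at the given point.\<close>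

lemma sph_holo_at_isolated:
  assumes "open S" "w \<in> S" and holo: "\<And>u. u \<in> S \<Longrightarrow> u \<noteq> w \<Longrightarrow> sph_holo_at F u"
    and lim: "limitin sphere_top F (F w) (at w)"
  shows "sph_holo_at F w"
proof -
  have main: "sph_holo_at K w" if K: "\<And>u. u \<in> S \<Longrightarrow> u \<noteq> w \<Longrightarrow> sph_holo_at K u"
    "limitin sphere_top K (K w) (at w)" "K w \<noteq> None" for K
  proof -
    obtain c where c: "K w = Some c" using K(3) by auto
    have "eventually (\<lambda>u. K u \<noteq> None) (at w)" and cont: "((\<lambda>u. the (K u)) \<longlongrightarrow> c) (at w)"
      using K(2) c by (auto simp: limitin_sphere_Some)
    then obtain d where d: "d > 0" "\<And>u. u \<noteq> w \<Longrightarrow> dist u w < d \<Longrightarrow> K u \<noteq> None"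
      by (auto simp: eventually_at)
    obtain d' where d': "d' > 0" "ball w d' \<subseteq> S" using assms(1,2) open_contains_ball by blast
    define B where "B = ball w (min d d')"
    have B: "B \<subseteq> S" "w \<in> B" "open B" "\<And>u. u \<in> B \<Longrightarrow> K u \<noteq> None"
      using d(1) d' c d(2) by (auto simp: B_def dist_commute) (metis d(2) dist_commute option.distinct(1) not_None_eq)
    have "(\<lambda>u. the (K u)) holomorphic_on B"
    proof (rule no_isolated_singularity'[of "{w}"])
      show "(\<lambda>u. the (K u)) holomorphic_on B - {w}"
        using B K by (intro holomorphic_on_the_sph) auto
      fix z assume "z \<in> {w}"
      then show "((\<lambda>u. the (K u)) \<longlongrightarrow> the (K z)) (at z within B)"
        using cont c by (auto intro: tendsto_within_subset)
    qed (use B in auto)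
    then show ?thesis using B by (intro sph_holo_atI) auto
  qed
  show ?thesis
  proof (cases "F w = None")
    case False
    then show ?thesis using main holo lim by blast
  next
    case True
    have "sph_holo_at (\<lambda>u. sph_inv (F u)) w"
      using True holo limitin_sph_inv[OF lim] by (intro main) (auto intro: sph_holo_at_sph_inv)
    from sph_holo_at_sph_inv[OF this] show ?thesis by simp
  qed
qed

text \<open>A local inverse of \<open>G\<close> straightens the exceptional arc into the real axis.\<close>

lemma sph_holo_at_across_arc:
  assumes "open S" "w \<in> S" and G: "G holomorphic_on S" "inj_on G S"
    and holo: "\<And>u. u \<in> S \<Longrightarrow> Im (G u) \<noteq> 0 \<Longrightarrow> sph_holo_at F u"
    and lim: "\<And>u. u \<in> S \<Longrightarrow> limitin sphere_top F (F u) (at u)"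
  shows "sph_holo_at F w"
proof -
  have main: "sph_holo_at K w" if K: "\<And>u. u \<in> S \<Longrightarrow> Im (G u) \<noteq> 0 \<Longrightarrow> sph_holo_at K u"
    "\<And>u. u \<in> S \<Longrightarrow> limitin sphere_top K (K u) (at u)" "K w \<noteq> None" for K
  proof -
    obtain c where c: "K w = Some c" using K(3) by auto
    have "eventually (\<lambda>u. K u \<noteq> None) (at w)"
      using K(2)[of w] c assms(2) by (auto simp: limitin_sphere_Some)
    then obtain d where d: "d > 0" "\<And>u. u \<noteq> w \<Longrightarrow> dist u w < d \<Longrightarrow> K u \<noteq> None"
      by (auto simp: eventually_at)
    obtain d' where d': "d' > 0" "ball w d' \<subseteq> S" using assms(1,2) open_contains_ball by blast
    define B where "B = ball w (min d d')"
    have B: "B \<subseteq> S" "w \<in> B" "open B" "\<And>u. u \<in> B \<Longrightarrow> K u \<noteq> None"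
      using d(1) d' c d(2) by (auto simp: B_def dist_commute) (metis d(2) dist_commute option.distinct(1) not_None_eq)
    define f where "f u = the (K u)" for u
    have contf: "continuous_on B f"
    proof (rule continuous_at_imp_continuous_on, rule ballI)
      fix u assume u: "u \<in> B"
      then obtain c where "K u = Some c" using B by blast
      then show "isCont f u"
        using K(2)[of u] B(1) u by (auto simp: limitin_sphere_Some f_def[abs_def] isCont_def)
    qed
    have GB: "G holomorphic_on B" "inj_on G B" using G B inj_on_subset holomorphic_on_subset by blast+
    obtain k where k: "k holomorphic_on G ` B" "\<And>z. z \<in> B \<Longrightarrow> k (G z) = z"
      using holomorphic_has_inverse[OF GB(1) B(3) GB(2)] by metis
    have opG: "open (G ` B)" by (rule open_mapping_thm3[OF GB(1) B(3) GB(2)])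
    have hol: "(f \<circ> k) holomorphic_on (G ` B \<inter> {z. Im z \<noteq> 0})"
    proof (rule holomorphic_on_compose_gen)
      show "k holomorphic_on (G ` B \<inter> {z. Im z \<noteq> 0})" using k(1) by (rule holomorphic_on_subset) auto
      have "open (B \<inter> G -` {z. Im z \<noteq> 0})"
        using GB(1) B(3) by (intro continuous_open_preimage holomorphic_on_imp_continuous_on
            open_Collect_neq continuous_intros)
      then show "f holomorphic_on (B \<inter> G -` {z. Im z \<noteq> 0})"
        unfolding f_def using K(1) B by (intro holomorphic_on_the_sph) auto
      show "k ` (G ` B \<inter> {z. Im z \<noteq> 0}) \<subseteq> B \<inter> G -` {z. Im z \<noteq> 0}"
        using k(2) by auto
    qed
    \<comment> \<open>A continuous function that is holomorphic on both sides of a line is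
      holomorphic across it. The line is the real axis: the inner product with \<i> is the imaginary
      part.\<close>
    have "(f \<circ> k) holomorphic_on G ` B"
    proof (rule holomorphic_on_paste_across_line[OF opG, of \<i> _ 0])
      show "(f \<circ> k) holomorphic_on G ` B \<inter> {z. \<i> \<bullet> z < 0}"
        "(f \<circ> k) holomorphic_on G ` B \<inter> {z. 0 < \<i> \<bullet> z}"
        by (auto intro: holomorphic_on_subset[OF hol])
      show "continuous_on (G ` B) (f \<circ> k)"
      proof (rule continuous_on_compose)
        show "continuous_on (G ` B) k" using k(1) by (rule holomorphic_on_imp_continuous_on)
        have "k ` G ` B = B" using k(2) by (force simp: image_image)
        then show "continuous_on (k ` G ` B) f" using contf by simp
      qed
    qed auto
    then have "(f \<circ> k) \<circ> G holomorphic_on B" by (rule holomorphic_on_compose[OF GB(1)])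
    then have "f holomorphic_on B" by (rule holomorphic_transform) (use k in auto)
    then show ?thesis using B by (intro sph_holo_atI[of B]) (auto simp: f_def[abs_def])
  qed
  show ?thesis
  proof (cases "F w = None")
    case False
    then show ?thesis using main holo lim by blast
  next
    case True
    have "sph_holo_at (\<lambda>u. sph_inv (F u)) w"
      using True holo limitin_sph_inv[OF lim] by (intro main) (auto intro: sph_holo_at_sph_inv)
    from sph_holo_at_sph_inv[OF this] show ?thesis by simp
  qed
qed

text \<open>Affine maps and \<open>sph_inv\<close> generate the Moebius maps, so both maps
  \<open>psi_formula\<close> are obtained as compositions, and their homeomorphy and holomorphy need
  only be checked for these two building blocks.\<close>

definition sph_aff :: "complex \<Rightarrow> complex \<Rightarrow> complex option \<Rightarrow> complex option" where
  "sph_aff k m = map_option (\<lambda>u. k * u + m)"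

lemma continuous_map_sph_aff:
  assumes "k \<noteq> 0" shows "continuous_map sphere_top sphere_top (sph_aff k m)"
proof (rule continuous_map_sphereI)
  fix w
  have "((\<lambda>u. k * u + m) \<longlongrightarrow> k * w + m) (at w)" by (intro tendsto_intros)
  then show "limitin sphere_top (\<lambda>u. sph_aff k m (Some u)) (sph_aff k m (Some w)) (at w)"
    by (simp add: sph_aff_def limitin_sphere_Some)
next
  have "filterlim (\<lambda>u. k * u + m) at_infinity at_infinity"
    using assms by (intro tendsto_add_filterlim_at_infinity'[OF _ tendsto_const]
        tendsto_mult_filterlim_at_infinity[OF tendsto_const]) (auto intro: filterlim_ident)
  then have "eventually (\<lambda>u. r < norm (k * u + m)) at_infinity" for r
    by (metis filterlim_at_infinity_imp_norm_at_top filterlim_at_top_dense)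
  then show "limitin sphere_top (\<lambda>u. sph_aff k m (Some u)) (sph_aff k m None) at_infinity"
    by (simp add: sph_aff_def limitin_sphere_None)
qed

lemma homeomorphic_map_sph_aff:
  assumes "k \<noteq> 0" shows "homeomorphic_map sphere_top sphere_top (sph_aff k m)"
proof -
  have "homeomorphic_maps sphere_top sphere_top (sph_aff k m) (sph_aff (1 / k) (- m / k))"
    unfolding homeomorphic_maps_def
    using assms continuous_map_sph_aff[of k m] continuous_map_sph_aff[of "1 / k" "- m / k"]
    by (auto simp: sph_aff_def option.map_comp o_def field_simps option.map_ident)
  then show ?thesis using homeomorphic_map_maps by blast
qed

lemma homeomorphic_map_sph_inv: "homeomorphic_map sphere_top sphere_top sph_inv"
proof -
  have "homeomorphic_maps sphere_top sphere_top sph_inv sph_inv"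
    by (simp add: homeomorphic_maps_def continuous_map_sph_inv)
  then show ?thesis using homeomorphic_map_maps by blast
qed

lemma sph_holo_at_sph_aff:
  assumes F: "sph_holo_at F w" and k: "k \<noteq> 0"
  shows "sph_holo_at (\<lambda>u. sph_aff k m (F u)) w"
proof (cases "F w")
  case (Some c)
  obtain e where e: "e > 0" "\<And>u. u \<in> ball w e \<Longrightarrow> F u \<noteq> None" "(\<lambda>u. the (F u)) holomorphic_on ball w e"
    using sph_holo_at_finite[OF F] Some by auto
  have "(\<lambda>u. k * the (F u) + m) holomorphic_on ball w e" using e(3) by (intro holomorphic_intros)
  then have "(\<lambda>u. the (sph_aff k m (F u))) holomorphic_on ball w e"
    by (rule holomorphic_transform) (use e(2) in \<open>force simp: sph_aff_def\<close>)
  then show ?thesis using e by (intro sph_holo_atI[of "ball w e"]) (auto simp: sph_aff_def)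
next
  case None
  define f where "f u = the (sph_inv (F u))" for u
  obtain e where e: "e > 0" "\<And>u. u \<in> ball w e \<Longrightarrow> sph_inv (F u) \<noteq> None" "f holomorphic_on ball w e"
    using sph_holo_at_finite[OF sph_holo_at_sph_inv[OF F]] None by (auto simp: f_def[abs_def])
  have fw: "f w = 0" using None by (simp add: f_def)
  \<comment> \<open>In the coordinate \<open>f u\<close> = 1 / F the affine map becomes f / (k + m
    f), which is holomorphic where the denominator does not vanish; at \<open>w\<close> it equals
    \<open>k\<close>.\<close>
  define B where "B = ball w e \<inter> {u. k + m * f u \<noteq> 0}"
  have "B = ball w e \<inter> (\<lambda>u. k + m * f u) -` (- {0})" by (auto simp: B_def)
  then have "open B"
    using e(3) by (auto intro!: continuous_open_preimage holomorphic_intros holomorphic_on_imp_continuous_on)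
  moreover have "w \<in> B" using e(1) fw k by (simp add: B_def)
  moreover have inv: "sph_inv (sph_aff k m (F u)) = Some (f u / (k + m * f u))" if u: "u \<in> B" for u
  proof (cases "F u")
    case None
    then show ?thesis by (simp add: sph_aff_def f_def)
  next
    case (Some v)
    then have "v \<noteq> 0" using e(2)[of u] u by (auto simp: B_def)
    then have "f u = inverse v" using Some by (simp add: f_def)
    moreover have "k + m * inverse v \<noteq> 0" using u calculation by (simp add: B_def)
    then have "k * v + m \<noteq> 0" using \<open>v \<noteq> 0\<close> by (auto simp: field_simps)
    moreover have "k + m * f u = (k * v + m) / v" using \<open>f u = inverse v\<close> \<open>v \<noteq> 0\<close> by (simp add: field_simps)
    then have "f u / (k + m * f u) = inverse (k * v + m)"
      unfolding \<open>f u = inverse v\<close> using \<open>v \<noteq> 0\<close> by (simp only:) (simp add: divide_simps)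
    then show ?thesis using Some \<open>k * v + m \<noteq> 0\<close> by (simp add: sph_aff_def)
  qed
  moreover have "(\<lambda>u. the (sph_inv (sph_aff k m (F u)))) holomorphic_on B"
  proof (rule holomorphic_transform)
    show "(\<lambda>u. f u / (k + m * f u)) holomorphic_on B"
      using e(3) by (intro holomorphic_intros) (auto simp: B_def intro: holomorphic_on_subset)
    show "f u / (k + m * f u) = the (sph_inv (sph_aff k m (F u)))" if "u \<in> B" for u
      using inv[OF that] by simp
  qed
  ultimately have "sph_holo_at (\<lambda>u. sph_inv (sph_aff k m (F u))) w" by (intro sph_holo_atI[of B]) auto
  from sph_holo_at_sph_inv[OF this] show ?thesis by simp
qed

section \<open>Boundedness near a point and Liouville's theorem\<close>

lemma tendsto_eventually_bounded:
  fixes f :: "'a \<Rightarrow> complex"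
  assumes "(f \<longlongrightarrow> l) F" shows "\<exists>B. eventually (\<lambda>x. norm (f x) \<le> B) F"
proof -
  have "eventually (\<lambda>x. dist (f x) l < 1) F" using assms tendstoD by fastforce
  then have "eventually (\<lambda>x. norm (f x) \<le> norm l + 1) F"
  proof eventually_elim
    case (elim x)
    then show ?case using norm_triangle_ineq2[of "f x" l] by (simp add: dist_norm)
  qed
  then show ?thesis by blast
qed

lemma eventually_bounded_diff:
  fixes f g :: "'a \<Rightarrow> complex"
  assumes "\<exists>B. eventually (\<lambda>x. norm (f x) \<le> B) F" "\<exists>B. eventually (\<lambda>x. norm (g x) \<le> B) F"
  shows "\<exists>B. eventually (\<lambda>x. norm (f x - g x) \<le> B) F"
proof -
  obtain B C where "eventually (\<lambda>x. norm (f x) \<le> B) F" "eventually (\<lambda>x. norm (g x) \<le> C) F" using assms by blast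
  then have "eventually (\<lambda>x. norm (f x - g x) \<le> B + C) F"
  proof eventually_elim
    case (elim x)
    then show ?case using norm_triangle_ineq4[of "f x" "g x"] by simp
  qed
  then show ?thesis by blast
qed

lemma bounded_punctured_plane_imp_constant:
  assumes hol: "f holomorphic_on - {p}" and p: "\<exists>B. eventually (\<lambda>z. norm (f z) \<le> B) (at p)"
    and inf: "\<exists>B. eventually (\<lambda>z. norm (f z) \<le> B) at_infinity"
  obtains d where "\<And>z. z \<noteq> p \<Longrightarrow> f z = d"
proof -
  have "\<exists>k. k holomorphic_on UNIV \<and> (\<forall>z \<in> UNIV - {p}. k z = f z)"
    using holomorphic_on_extend_bounded[of f UNIV p] hol p by (simp add: Compl_eq_Diff_UNIV)
  then obtain k where k: "k holomorphic_on UNIV" "\<And>z. z \<noteq> p \<Longrightarrow> k z = f z" by blast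
  obtain B A where B: "\<And>z. A \<le> norm z \<Longrightarrow> norm (f z) \<le> B" using inf by (auto simp: eventually_at_infinity)
  \<comment> \<open>The bound is available only outside a disc, so Liouville's theorem is used in
    its polynomial form with exponent 0. The term \<open>norm p + 1\<close> keeps \<open>z\<close>
    away from \<open>p\<close>, where \<open>k\<close> and \<open>f\<close> may differ.\<close>
  have "norm (k z) \<le> B * norm z ^ 0" if "max A (norm p + 1) \<le> norm z" for z
  proof -
    have "A \<le> norm z" "z \<noteq> p" using that by auto
    then show ?thesis using B[of z] k(2)[of z] by simp
  qed
  then have "k z = (\<Sum>i\<le>0. (deriv ^^ i) k 0 / fact i * z ^ i)" for z
    by (rule Liouville_polynomial[OF k(1)])
  then have "k z = k 0" for z by simp
  then show ?thesis using that[of "k 0"] k(2) by metis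
qed

section \<open>The topology of the three-sheeted surface\<close>

text \<open>This and the next three sets name the four families of generators in
  \<open>R_sub\<close>, so that topological statements can be checked family by family.\<close>

definition reg_nbhd :: "nat \<Rightarrow> complex set \<Rightarrow> rpt set" where
  "reg_nbhd k U = {Reg k (Some w) | w. w \<in> U}"

definition inf_nbhd :: "nat \<Rightarrow> real \<Rightarrow> rpt set" where
  "inf_nbhd k r = insert (Reg k None) {Reg k (Some w) | w. r < norm w}"

definition cut_nbhd :: "nat \<Rightarrow> bool \<Rightarrow> real \<Rightarrow> real \<Rightarrow> rpt set" where
  "cut_nbhd j b x r = {Cut j b y | y. \<bar>y - x\<bar> < r}
     \<union> {Reg (j - 1) (Some w) | w. dist w (complex_of_real x) < r \<and> (if b then Im w > 0 else Im w < 0)}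
     \<union> {Reg j (Some w) | w. dist w (complex_of_real x) < r \<and> (if b then Im w < 0 else Im w > 0)}"

definition branch_nbhd :: "real \<Rightarrow> nat \<Rightarrow> real \<Rightarrow> real \<Rightarrow> rpt set" where
  "branch_nbhd lam j e r = {Br e} \<union> {Cut j b y | b y. y \<in> cut_int lam j \<and> \<bar>y - e\<bar> < r}
     \<union> {Reg k (Some w) | k w. k \<in> {j - 1, j} \<and> dist w (complex_of_real e) < r \<and> w \<notin> Dcut lam j}"

lemma R_sub_eq:
  "R_sub lam = {reg_nbhd k U | k U. k \<le> 2 \<and> open U \<and> U \<inter> cutset lam k = {}}
   \<union> {inf_nbhd k r | k r. k \<le> 2 \<and> lam \<le> r}
   \<union> {cut_nbhd j b x r | j b x r. j \<in> {1,2} \<and> 0 < r \<and> {y. \<bar>y - x\<bar> < r} \<subseteq> cut_int lam j}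
   \<union> {branch_nbhd lam j e r | j e r. j \<in> {1,2} \<and> e \<in> cut_ends lam j \<and> 0 < r \<and> r \<le> lam - 1 \<and> r \<le> 1}"
  unfolding R_sub_def reg_nbhd_def inf_nbhd_def cut_nbhd_def branch_nbhd_def by (rule refl)

lemma openin_reg_nbhd:
  "k \<le> 2 \<Longrightarrow> open U \<Longrightarrow> U \<inter> cutset lam k = {} \<Longrightarrow> openin (R_top lam) (reg_nbhd k U)"
  unfolding R_top_def R_sub_eq by (rule topology_generated_by_Basis) blast

lemma openin_inf_nbhd: "k \<le> 2 \<Longrightarrow> lam \<le> r \<Longrightarrow> openin (R_top lam) (inf_nbhd k r)"
  unfolding R_top_def R_sub_eq by (rule topology_generated_by_Basis) blast

lemma openin_cut_nbhd:
  "j \<in> {1,2} \<Longrightarrow> 0 < r \<Longrightarrow> {y. \<bar>y - x\<bar> < r} \<subseteq> cut_int lam j \<Longrightarrow> openin (R_top lam) (cut_nbhd j b x r)"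
  unfolding R_top_def R_sub_eq by (rule topology_generated_by_Basis) blast

lemma openin_branch_nbhd:
  "j \<in> {1,2} \<Longrightarrow> e \<in> cut_ends lam j \<Longrightarrow> 0 < r \<Longrightarrow> r \<le> lam - 1 \<Longrightarrow> r \<le> 1 \<Longrightarrow>
    openin (R_top lam) (branch_nbhd lam j e r)"
  unfolding R_top_def R_sub_eq by (rule topology_generated_by_Basis) blast

lemma closed_cutset: "closed (cutset lam k)"
  unfolding cutset_def Delta1_def Delta2_def
  by (auto intro!: closed_Un compact_imp_closed compact_continuous_image continuous_intros)

lemma cutset_norm_le: "1 < lam \<Longrightarrow> w \<in> cutset lam k \<Longrightarrow> norm w \<le> lam"
  by (auto simp: cutset_def Delta1_def Delta2_def split: if_splits)

lemma cut_int_radius: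
  assumes "x \<in> cut_int lam j"
  obtains r where "0 < r" "{y. \<bar>y - x\<bar> < r} \<subseteq> cut_int lam j"
proof -
  have "open (cut_int lam j)" by (simp add: cut_int_def)
  then obtain r where "0 < r" "ball x r \<subseteq> cut_int lam j" using assms open_contains_ball by blast
  moreover have "{y. \<bar>y - x\<bar> < r} = ball x r" by (auto simp: dist_real_def)
  ultimately show ?thesis using that by simp
qed

lemma R_set_cases:
  assumes "p \<in> R_set lam"
  obtains (Reg) k w where "p = Reg k (Some w)" "k \<le> 2" "w \<notin> cutset lam k"
  | (Inf) k where "p = Reg k None" "k \<le> 2"
  | (Cut) j b x where "p = Cut j b x" "j \<in> {1,2}" "x \<in> cut_int lam j"
  | (Br) j x where "p = Br x" "j \<in> {1,2}" "x \<in> cut_ends lam j"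
  using assms unfolding R_set_def by blast

text \<open>An endpoint of one cut has distance at least 2 from the other cut, so a disc of radius 1
  around it meets no cut but its own.\<close>

lemma notin_cut_set:
  assumes "dist w (complex_of_real e) < 1" "j \<in> {1,2}" "e \<in> cut_ends lam j" "k \<in> {j - 1, j}"
    "w \<notin> Dcut lam j" "1 < lam" shows "w \<notin> cutset lam k"
proof
  assume "w \<in> cutset lam k"
  then have w: "w \<in> Dcut lam (3 - j)" using assms by (auto simp: cutset_def Dcut_def split: if_splits)
  then obtain x where x: "w = complex_of_real x" by (auto simp: Dcut_def Delta1_def Delta2_def split: if_splits)
  have "\<bar>x - e\<bar> < 1" using assms(1) by (simp add: x dist_norm flip: of_real_diff)
  then show False using w assms x by (auto simp: Dcut_def Delta1_def Delta2_def cut_ends_def split: if_splits)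
qed

text \<open>\<open>R_top\<close> is given by generators alone: each of them lies in
  \<open>R_set lam\<close>, and together they cover it. The bounds \<open>lam \<le> r\<close> at
  infinity and \<open>r \<le> 1\<close> at the branch points keep the generators off cuts where they
  do not belong.\<close>

lemma topspace_R_top: assumes lam: "1 < lam" shows "topspace (R_top lam) = R_set lam"
proof
  have "U \<subseteq> R_set lam" if "U \<in> R_sub lam" for U
  proof -
    have 1: "reg_nbhd k V \<subseteq> R_set lam" if "k \<le> 2" "V \<inter> cutset lam k = {}" for k V
      using that by (auto simp: reg_nbhd_def R_set_def)
    have 2: "inf_nbhd k r \<subseteq> R_set lam" if "k \<le> 2" "lam \<le> r" for k r
      using that cutset_norm_le[OF lam] by (fastforce simp: inf_nbhd_def R_set_def)
    have 3: "cut_nbhd j b x r \<subseteq> R_set lam" if "j \<in> {1,2}" "{y. \<bar>y - x\<bar> < r} \<subseteq> cut_int lam j" for j b x r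
    proof -
      have im: "w \<notin> cutset lam k" if "Im w \<noteq> 0" for w k
        using that by (auto simp: cutset_def Delta1_def Delta2_def)
      have "j - 1 \<le> 2" "j \<le> 2" using that by auto
      then show ?thesis using that im by (force simp: cut_nbhd_def R_set_def split: if_splits)
    qed
    have 4: "branch_nbhd lam j e r \<subseteq> R_set lam" if "j \<in> {1,2}" "e \<in> cut_ends lam j" "r \<le> 1" for j e r
    proof
      fix p assume "p \<in> branch_nbhd lam j e r"
      then consider "p = Br e" | b y where "p = Cut j b y" "y \<in> cut_int lam j"
        | k w where "p = Reg k (Some w)" "k \<in> {j - 1, j}" "dist w (complex_of_real e) < r" "w \<notin> Dcut lam j"
        unfolding branch_nbhd_def by blast
      then show "p \<in> R_set lam"
      proof cases
        case (3 k w)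
        then have "w \<notin> cutset lam k" using notin_cut_set[of w e j lam k] that lam by auto
        moreover have "k \<le> 2" using 3 that by auto
        ultimately show ?thesis using 3 by (auto simp: R_set_def)
      qed (use that in \<open>unfold R_set_def, blast+\<close>)
    qed
    show ?thesis using \<open>U \<in> R_sub lam\<close> unfolding R_sub_eq Un_iff mem_Collect_eq
      by (elim disjE exE conjE) (simp_all add: 1 2 3 4)
  qed
  then show "topspace (R_top lam) \<subseteq> R_set lam" by (auto simp: R_top_def)
next
  show "R_set lam \<subseteq> topspace (R_top lam)"
  proof
    fix p assume "p \<in> R_set lam"
    then show "p \<in> topspace (R_top lam)"
    proof (cases rule: R_set_cases)
      case (Reg k w)
      have "openin (R_top lam) (reg_nbhd k (- cutset lam k))"
        using Reg closed_cutset by (intro openin_reg_nbhd) auto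
      moreover have "p \<in> reg_nbhd k (- cutset lam k)" using Reg by (auto simp: reg_nbhd_def)
      ultimately show ?thesis using openin_subset by blast
    next
      case (Inf k)
      then have "p \<in> inf_nbhd k lam" by (auto simp: inf_nbhd_def)
      then show ?thesis using openin_inf_nbhd[of k lam lam] Inf openin_subset by blast
    next
      case (Cut j b x)
      then obtain r where r: "0 < r" "{y. \<bar>y - x\<bar> < r} \<subseteq> cut_int lam j" using cut_int_radius by blast
      have "p \<in> cut_nbhd j b x r" using Cut r by (auto simp: cut_nbhd_def)
      then show ?thesis using openin_cut_nbhd[OF Cut(2) r] openin_subset by blast
    next
      case (Br j x)
      have "p \<in> branch_nbhd lam j x (min 1 (lam - 1))" using Br by (auto simp: branch_nbhd_def)
      then show ?thesis using openin_branch_nbhd[OF Br(2,3), of "min 1 (lam - 1)"] lam openin_subset by auto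
    qed
  qed
qed

lemma continuous_map_proj:
  assumes lam: "1 < lam" shows "continuous_map (R_top lam) sphere_top proj"
  unfolding continuous_map
proof (intro conjI allI impI)
  fix V assume V: "openin sphere_top V"
  then have oV: "open (Some -` V)" by (simp add: openin_sphere_top)
  show "openin (R_top lam) {p \<in> topspace (R_top lam). proj p \<in> V}"
  proof (subst openin_subopen, rule ballI)
    fix p assume "p \<in> {p \<in> topspace (R_top lam). proj p \<in> V}"
    then have p: "p \<in> R_set lam" "proj p \<in> V" using topspace_R_top[OF lam] by auto
    have "\<exists>T. openin (R_top lam) T \<and> p \<in> T \<and> proj ` T \<subseteq> V"
      using p(1)
    proof (cases rule: R_set_cases)
      case (Reg k w)
      have "openin (R_top lam) (reg_nbhd k (Some -` V - cutset lam k))"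
        using Reg closed_cutset oV by (intro openin_reg_nbhd) auto
      then show ?thesis using Reg p by (auto simp: reg_nbhd_def intro!: exI[of _ "reg_nbhd k (Some -` V - cutset lam k)"])
    next
      case (Inf k)
      then have "None \<in> V" using p by simp
      then obtain r where r: "\<forall>z. r < norm z \<longrightarrow> Some z \<in> V" using V by (auto simp: openin_sphere_top)
      have "openin (R_top lam) (inf_nbhd k (max r lam))" using Inf by (intro openin_inf_nbhd) auto
      then show ?thesis using Inf p r \<open>None \<in> V\<close>
        by (auto simp: inf_nbhd_def intro!: exI[of _ "inf_nbhd k (max r lam)"])
    next
      case (Cut j b x)
      obtain r where r: "0 < r" "{y. \<bar>y - x\<bar> < r} \<subseteq> cut_int lam j" using cut_int_radius Cut(3) .
      have "complex_of_real x \<in> Some -` V" using Cut p by simp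
      then obtain s where s: "0 < s" "ball (complex_of_real x) s \<subseteq> Some -` V" using oV open_contains_ball by blast
      have sV: "Some w \<in> V" if "dist w (complex_of_real x) < s" for w using s that by (auto simp: dist_commute)
      have "openin (R_top lam) (cut_nbhd j b x (min r s))" using r s Cut by (intro openin_cut_nbhd) auto
      moreover have "p \<in> cut_nbhd j b x (min r s)" using Cut r s by (auto simp: cut_nbhd_def)
      moreover have "proj ` cut_nbhd j b x (min r s) \<subseteq> V"
        using sV by (auto simp: cut_nbhd_def dist_norm simp flip: of_real_diff split: if_splits)
      ultimately show ?thesis by blast
    next
      case (Br j x)
      have "complex_of_real x \<in> Some -` V" using Br p by simp
      then obtain s where s: "0 < s" "ball (complex_of_real x) s \<subseteq> Some -` V" using oV open_contains_ball by blast
      have sV: "Some w \<in> V" if "dist w (complex_of_real x) < s" for w using s that by (auto simp: dist_commute)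
      define r where "r = min s (min 1 (lam - 1))"
      have "openin (R_top lam) (branch_nbhd lam j x r)" using s Br lam by (intro openin_branch_nbhd) (auto simp: r_def)
      moreover have "p \<in> branch_nbhd lam j x r" using Br by (auto simp: branch_nbhd_def)
      moreover have "proj ` branch_nbhd lam j x r \<subseteq> V"
        using sV Br p by (auto simp: branch_nbhd_def dist_norm r_def simp flip: of_real_diff)
      ultimately show ?thesis by blast
    qed
    then obtain T where T: "openin (R_top lam) T" "p \<in> T" "proj ` T \<subseteq> V" by blast
    have "T \<subseteq> {p \<in> topspace (R_top lam). proj p \<in> V}" using openin_subset[OF T(1)] T(3) by auto
    then show "\<exists>T. openin (R_top lam) T \<and> p \<in> T \<and> T \<subseteq> {p \<in> topspace (R_top lam). proj p \<in> V}"
      using T by blast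
  qed
qed simp

text \<open>Points over one base point differ in sheet or in bank. Sheets are separated by their
  number, the two glued points of a cut by opposite half discs, and a branch point shares its fibre
  only with a point of the remaining sheet.\<close>

lemma same_fibre_separated:
  assumes lam: "1 < lam" and pq: "p \<in> R_set lam" "q \<in> R_set lam" "p \<noteq> q" "proj p = proj q"
  shows "\<exists>U V. openin (R_top lam) U \<and> openin (R_top lam) V \<and> p \<in> U \<and> q \<in> V \<and> disjnt U V"
proof -
  have reg: "openin (R_top lam) (reg_nbhd k (- cutset lam k))" if "k \<le> 2" for k
    using that closed_cutset by (intro openin_reg_nbhd) auto
  \<comment> \<open>Quantified over \<open>p\<close> and \<open>q\<close> because it is used below
    with their roles exchanged.\<close>
  have Reg_any: "\<exists>U V. openin (R_top lam) U \<and> openin (R_top lam) V \<and> p \<in> U \<and> q \<in> V \<and> disjnt U V"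
    if p: "p = Reg k (Some w)" "k \<le> 2" "w \<notin> cutset lam k" and q: "q \<in> R_set lam" "p \<noteq> q" "proj p = proj q"
    for p q k w
  proof -
    have pin: "p \<in> reg_nbhd k (- cutset lam k)" using p by (auto simp: reg_nbhd_def)
    have "\<exists>V. openin (R_top lam) V \<and> q \<in> V \<and> disjnt (reg_nbhd k (- cutset lam k)) V"
      using q(1)
    proof (cases rule: R_set_cases)
      case (Reg k' w')
      then have "q \<in> reg_nbhd k' (- cutset lam k')" "k \<noteq> k'" using p q by (auto simp: reg_nbhd_def)
      then show ?thesis using reg[of k'] Reg by (auto simp: disjnt_iff reg_nbhd_def)
    next
      case (Inf k')
      then show ?thesis using p q by simp
    next
      case (Cut j b x)
      obtain r where r: "0 < r" "{y. \<bar>y - x\<bar> < r} \<subseteq> cut_int lam j" using cut_int_radius Cut(3) .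
      have "w = complex_of_real x" using p q Cut by simp
      then have "k \<noteq> j - 1" "k \<noteq> j" using p Cut
        by (auto simp: cutset_def Delta1_def Delta2_def cut_int_def split: if_splits)
      then have "disjnt (reg_nbhd k (- cutset lam k)) (cut_nbhd j b x r)"
        by (auto simp: disjnt_iff reg_nbhd_def cut_nbhd_def)
      moreover have "q \<in> cut_nbhd j b x r" using Cut r by (auto simp: cut_nbhd_def)
      ultimately show ?thesis using openin_cut_nbhd[OF Cut(2) r] by blast
    next
      case (Br j x)
      have "w = complex_of_real x" using p q Br by simp
      then have "k \<notin> {j - 1, j}" using p Br lam
        by (auto simp: cutset_def Delta1_def Delta2_def cut_ends_def split: if_splits)
      then have "disjnt (reg_nbhd k (- cutset lam k)) (branch_nbhd lam j x (min 1 (lam - 1)))"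
        by (auto simp: disjnt_iff reg_nbhd_def branch_nbhd_def)
      moreover have "q \<in> branch_nbhd lam j x (min 1 (lam - 1))" using Br by (auto simp: branch_nbhd_def)
      ultimately show ?thesis using openin_branch_nbhd[OF Br(2,3), of "min 1 (lam - 1)"] lam by auto
    qed
    then show ?thesis using reg[OF p(2)] pin by blast
  qed
  show ?thesis
    using pq(1)
  proof (cases rule: R_set_cases)
    case (Reg k w)
    then show ?thesis using Reg_any pq by blast
  next
    case (Inf k)
    then obtain k' where k': "q = Reg k' None" "k' \<le> 2" using pq
      by (cases rule: R_set_cases[OF pq(2)]) auto
    then have "disjnt (inf_nbhd k lam) (inf_nbhd k' lam)" using Inf pq by (auto simp: disjnt_iff inf_nbhd_def)
    moreover have "p \<in> inf_nbhd k lam" "q \<in> inf_nbhd k' lam" using Inf k' by (auto simp: inf_nbhd_def)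
    ultimately show ?thesis using openin_inf_nbhd[of k lam lam] openin_inf_nbhd[of k' lam lam] Inf k' by auto
  next
    case (Cut j b x)
    show ?thesis
    proof (cases rule: R_set_cases[OF pq(2)])
      case (1 k w)
      then show ?thesis using Reg_any[of q k w p] pq by (metis disjnt_sym)
    next
      case (2 k)
      then show ?thesis using Cut pq by simp
    next
      case (3 j' b' x')
      then have x: "x' = x" using Cut pq by simp
      then have "j' = j" using 3 Cut by (auto simp: cut_int_def split: if_splits)
      then have b: "b' \<noteq> b" using 3 Cut pq x by auto
      obtain r where r: "0 < r" "{y. \<bar>y - x\<bar> < r} \<subseteq> cut_int lam j" using cut_int_radius Cut(3) .
      \<comment> \<open>Subtraction on \<open>nat\<close> is truncated, so \<open>j \<ge> 1\<close>
        is what makes the two glued sheets distinct. Flipping the bank then swaps the half discs on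
        both of them.\<close>
      have "j - 1 \<noteq> j" using Cut by auto
      then have "disjnt (cut_nbhd j b x r) (cut_nbhd j b' x r)" using b
        by (auto simp: disjnt_iff cut_nbhd_def)
      moreover have "p \<in> cut_nbhd j b x r" "q \<in> cut_nbhd j b' x r"
        using r Cut 3 x \<open>j' = j\<close> by (auto simp: cut_nbhd_def)
      ultimately show ?thesis using openin_cut_nbhd[OF Cut(2) r] by blast
    next
      case (4 j' x')
      then show ?thesis using Cut pq lam by (auto simp: cut_int_def cut_ends_def split: if_splits)
    qed
  next
    case (Br j x)
    show ?thesis
    proof (cases rule: R_set_cases[OF pq(2)])
      case (1 k w)
      then show ?thesis using Reg_any[of q k w p] pq by (metis disjnt_sym)
    next
      case (2 k)
      then show ?thesis using Br pq by simp
    next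
      case (3 j' b' x')
      then show ?thesis using Br pq lam by (auto simp: cut_int_def cut_ends_def split: if_splits)
    next
      case (4 j' x')
      then show ?thesis using Br pq by auto
    qed
  qed
qed

lemma Hausdorff_R_top:
  assumes lam: "1 < lam" shows "Hausdorff_space (R_top lam)"
  unfolding Hausdorff_space_def
proof (intro allI impI)
  fix p q assume pq: "p \<in> topspace (R_top lam) \<and> q \<in> topspace (R_top lam) \<and> p \<noteq> q"
  show "\<exists>U V. openin (R_top lam) U \<and> openin (R_top lam) V \<and> p \<in> U \<and> q \<in> V \<and> disjnt U V"
  proof (cases "proj p = proj q")
    case True
    then show ?thesis using same_fibre_separated[OF lam] pq topspace_R_top[OF lam] by auto
  next
    case False
    then obtain U V where UV: "openin sphere_top U" "openin sphere_top V" "proj p \<in> U" "proj q \<in> V" "disjnt U V"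
      using Hausdorff_space_sphere_top unfolding Hausdorff_space_def by (metis UNIV_I topspace_sphere_top)
    have "openin (R_top lam) {x \<in> topspace (R_top lam). proj x \<in> U}"
      "openin (R_top lam) {x \<in> topspace (R_top lam). proj x \<in> V}"
      using continuous_map_proj[OF lam] UV by (auto simp: continuous_map)
    moreover have "disjnt {x \<in> topspace (R_top lam). proj x \<in> U} {x \<in> topspace (R_top lam). proj x \<in> V}"
      using UV(5) by (auto simp: disjnt_iff)
    ultimately show ?thesis using UV pq by blast
  qed
qed

text \<open>The sets \<open>inf_nbhd k r\<close> are the only generators of the topology that contain the point at
  infinity of sheet \<open>k\<close>.\<close>

lemma R_top_nbhd_infinity:
  assumes "openin (R_top lam) V" "Reg k None \<in> V"
  shows "\<exists>r. inf_nbhd k r \<subseteq> V"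
proof -
  have "generate_topology_on (R_sub lam) V"
    using assms(1) unfolding R_top_def by (rule openin_topology_generated_by)
  then show ?thesis using assms(2)
  proof induct
    case (Int A B)
    then obtain r s where "inf_nbhd k r \<subseteq> A" "inf_nbhd k s \<subseteq> B" by auto
    then have "inf_nbhd k (max r s) \<subseteq> A \<inter> B" by (auto simp: inf_nbhd_def)
    then show ?case by blast
  next
    case (UN K)
    then show ?case by blast
  next
    case (Basis B)
    then obtain r where "B = inf_nbhd k r"
      unfolding R_sub_eq by (auto simp: reg_nbhd_def inf_nbhd_def cut_nbhd_def branch_nbhd_def)
    then show ?case by blast
  qed auto
qed

lemma limitin_R_top_infinity:
  assumes "1 < lam" "k \<le> 2"
  shows "limitin (R_top lam) (\<lambda>w. Reg k (Some w)) (Reg k None) at_infinity"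
  unfolding limitin_def
proof (intro conjI allI impI)
  show "Reg k None \<in> topspace (R_top lam)" using assms topspace_R_top by (auto simp: R_set_def)
next
  fix V assume "openin (R_top lam) V \<and> Reg k None \<in> V"
  then obtain r where "inf_nbhd k r \<subseteq> V" using R_top_nbhd_infinity by blast
  then have "\<forall>w. r + 1 \<le> norm w \<longrightarrow> Reg k (Some w) \<in> V" by (auto simp: inf_nbhd_def)
  then show "eventually (\<lambda>w. Reg k (Some w) \<in> V) at_infinity" unfolding eventually_at_infinity by blast
qed

lemma eventually_notin_cutset:
  assumes "1 < lam" shows "eventually (\<lambda>w. w \<notin> cutset lam k) at_infinity"
proof -
  have "\<forall>w. lam + 1 \<le> norm w \<longrightarrow> w \<notin> cutset lam k" using cutset_norm_le[OF assms] by fastforce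
  then show ?thesis unfolding eventually_at_infinity by blast
qed

section \<open>The cubic map\<close>

text \<open>As 16 lam^2 - 8 is positive, the polynomial increases strictly on the nonnegative axis,
  from -27 at 0 to 16 (lam^2 - 1) > 0 at 1.\<close>

lemma ex1_parameter:
  fixes lam :: real
  assumes "1 < lam"
  shows "\<exists>!a::real. 0 < a \<and> a < 1 \<and> a ^ 8 + (16 * lam\<^sup>2 - 8) * a ^ 6 + 18 * a ^ 4 - 27 = 0"
proof -
  let ?p = "\<lambda>a::real. a ^ 8 + (16 * lam\<^sup>2 - 8) * a ^ 6 + 18 * a ^ 4 - 27"
  have lam2: "lam\<^sup>2 > 1" using assms by (simp add: one_less_power)
  have mono: "?p x < ?p y" if "0 \<le> x" "x < y" for x y
  proof -
    have "x ^ 8 < y ^ 8" "x ^ 4 < y ^ 4" using that by (auto intro: power_strict_mono)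
    moreover have "(16 * lam\<^sup>2 - 8) * x ^ 6 \<le> (16 * lam\<^sup>2 - 8) * y ^ 6"
      using that lam2 by (intro mult_left_mono power_mono) auto
    ultimately show ?thesis by linarith
  qed
  have "\<exists>x\<ge>0. x \<le> 1 \<and> ?p x = 0"
    using lam2 by (intro IVT') (auto intro!: continuous_intros)
  then obtain x where x: "0 \<le> x" "x \<le> 1" "?p x = 0" by blast
  have "x \<noteq> 0" "x \<noteq> 1" using x(3) lam2 by auto
  then have "0 < x \<and> x < 1 \<and> ?p x = 0" using x by auto
  moreover have "y = x" if "0 < y \<and> y < 1 \<and> ?p y = 0" for y
    using mono[of x y] mono[of y x] that x by (metis less_eq_real_def less_irrefl linorder_less_linear)
  ultimately show ?thesis by blast
qed

text \<open>Each closed half plane minus \<open>C\<close> lies between an open half plane and its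
  closure, hence is connected, and the two pieces share the point 0.\<close>

lemma connected_Compl_real_subset:
  assumes C: "C \<subseteq> \<real>" and "0 \<notin> C"
  shows "connected (- C :: complex set)"
proof -
  have up: "connected ({z. 0 \<le> Im z} - C)"
  proof (rule connected_intermediate_closure)
    show "connected {z. Im z > 0}" by (intro convex_connected convex_halfspace_Im_gt)
    show "{z. Im z > 0} \<subseteq> {z. 0 \<le> Im z} - C" using C by (auto simp: complex_is_Real_iff)
    show "{z. 0 \<le> Im z} - C \<subseteq> closure {z. Im z > 0}"
      using closure_halfspace_gt[of "\<i>" 0] by (auto simp: inner_complex_def)
  qed
  have lo: "connected ({z. Im z \<le> 0} - C)"
  proof (rule connected_intermediate_closure)
    show "connected {z. Im z < 0}" by (intro convex_connected convex_halfspace_Im_lt)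
    show "{z. Im z < 0} \<subseteq> {z. Im z \<le> 0} - C" using C by (auto simp: complex_is_Real_iff)
    show "{z. Im z \<le> 0} - C \<subseteq> closure {z. Im z < 0}"
      using closure_halfspace_lt[of "\<i>" 0] by (auto simp: inner_complex_def)
  qed
  have "connected (({z. 0 \<le> Im z} - C) \<union> ({z. Im z \<le> 0} - C))"
  proof (rule connected_Un[OF up lo])
    have "0 \<in> ({z. 0 \<le> Im z} - C) \<inter> ({z. Im z \<le> 0} - C)" using assms(2) by simp
    then show "({z. 0 \<le> Im z} - C) \<inter> ({z. Im z \<le> 0} - C) \<noteq> {}" by blast
  qed
  moreover have "({z. 0 \<le> Im z} - C) \<union> ({z. Im z \<le> 0} - C) = - C" by auto
  ultimately show ?thesis by simp
qed

locale two_cut_surface =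
  fixes lam a :: real
  assumes lam: "1 < lam" and a_pos: "0 < a" and a_less: "a < 1"
    and param: "a ^ 8 + (16 * lam\<^sup>2 - 8) * a ^ 6 + 18 * a ^ 4 - 27 = 0"
begin

text \<open>The coefficient for which \<open>a\<close> is a critical point: the derivative of z + c
  z / (z^2 - 1) vanishes exactly where (z^2 - 1)^2 = c (1 + z^2).\<close>

definition c :: real where "c = (1 - a\<^sup>2)\<^sup>2 / (1 + a\<^sup>2)"
text \<open>The value of \<open>H a\<close> at \<open>a\<close> in closed form, so that
  \<open>G\<close> takes the value 1 at the critical point \<open>a\<close>.\<close>

definition h :: real where "h = 2 * a ^ 3 / (1 + a\<^sup>2)"
text \<open>The other positive critical point.\<close>

definition b :: real where "b = sqrt ((3 - a\<^sup>2) / (1 + a\<^sup>2))"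
text \<open>The finite part of \<open>G_sph\<close>. At the poles 1 and -1 division by zero yields a
  default value, hence the premises \<open>u\<^sup>2 \<noteq> 1\<close> below.\<close>

definition G :: "complex \<Rightarrow> complex" where "G z = H a z / complex_of_real h"

text \<open>\<open>Im (H z)\<close> is \<open>Im z * ff z\<close> up to a positive factor, so \<open>{ff = 0}\<close> is the closure of the
  non-real part of the preimage of the real line.\<close>
definition ff :: "complex \<Rightarrow> real" where "ff z = (norm (z\<^sup>2 - 1))\<^sup>2 - c * (1 + (norm z)\<^sup>2)"

lemma a2_bounds: "0 < a\<^sup>2" "a\<^sup>2 < 1"
  using a_pos a_less by (auto simp: power_less_one_iff)

lemma a2_add_pos: "0 < 1 + a\<^sup>2" "1 + a\<^sup>2 \<noteq> 0"
  using a2_bounds(1) by linarith+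

lemma c_pos: "0 < c"
  unfolding c_def using a2_bounds by (intro divide_pos_pos a2_add_pos zero_less_power) linarith

lemma c_less: "c < 1"
proof -
  have "(1 - a\<^sup>2)\<^sup>2 < 1 + a\<^sup>2" using mult_strict_right_mono[of "a\<^sup>2" 3 "a\<^sup>2"] a2_bounds
    by (simp add: power2_eq_square[of "1 - a\<^sup>2"] algebra_simps)
  then show ?thesis using a2_add_pos by (simp add: c_def)
qed

lemma h_pos: "0 < h"
  unfolding h_def using a_pos by (intro divide_pos_pos a2_add_pos) simp

lemma b_sq: "b\<^sup>2 = (3 - a\<^sup>2) / (1 + a\<^sup>2)"
  using a2_bounds by (simp add: b_def)

lemma b2_gt: "1 < b\<^sup>2"
  using a2_bounds(2) a2_add_pos by (simp add: b_sq less_divide_eq)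

lemma b_gt: "1 < b"
  using a2_bounds(2) a2_add_pos by (simp add: b_def less_divide_eq)

text \<open>In s = z^2 the critical point equation is s^2 - (2 + c) s + (1 - c) = 0, and its roots
  are a^2 and b^2.\<close>

lemma vieta_sum: "a\<^sup>2 + b\<^sup>2 = 2 + c"
  and vieta_prod: "a\<^sup>2 * b\<^sup>2 = 1 - c"
proof -
  have "c * (1 + a\<^sup>2) = (1 - a\<^sup>2)\<^sup>2" "b\<^sup>2 * (1 + a\<^sup>2) = 3 - a\<^sup>2"
    using a2_add_pos(2) by (simp_all add: c_def b_sq)
  then have "(1 + a\<^sup>2) * (a\<^sup>2 + b\<^sup>2 - (2 + c)) = 0" "(1 + a\<^sup>2) * (a\<^sup>2 * b\<^sup>2 - (1 - c)) = 0"
    by algebra+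
  then show "a\<^sup>2 + b\<^sup>2 = 2 + c" "a\<^sup>2 * b\<^sup>2 = 1 - c" using a2_add_pos(2) by simp_all
qed

lemma vieta: "(s - a\<^sup>2) * (s - b\<^sup>2) = s\<^sup>2 - (2 + c) * s + (1 - c)"
proof -
  have "(s - a\<^sup>2) * (s - b\<^sup>2) = s\<^sup>2 - (a\<^sup>2 + b\<^sup>2) * s + a\<^sup>2 * b\<^sup>2"
    by (simp add: power2_eq_square algebra_simps)
  then show ?thesis by (simp only: vieta_sum vieta_prod)
qed

text \<open>This is G(b) = lam in disguise: \<open>a\<close> and \<open>b\<close> satisfy the same
  critical point equation, so H takes at \<open>b\<close> the value given by the formula for
  \<open>h\<close> with \<open>b\<close> in place of \<open>a\<close>. Both sides are nonnegative,
  so their squares are compared.\<close>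

lemma lam_h: "lam * h = 2 * b ^ 3 / (1 + b\<^sup>2)"
proof -
  have b1: "1 + b\<^sup>2 = 4 / (1 + a\<^sup>2)" using a2_add_pos by (simp add: b_sq field_simps)
  have 1: "(lam * h)\<^sup>2 * (4 * (1 + a\<^sup>2)^2) = 16 * lam\<^sup>2 * a ^ 6"
    using a2_add_pos by (simp add: h_def power_mult_distrib power_divide flip: power_mult)
  \<comment> \<open>The octic in factored form: (3 - a^2)^3 (1 + a^2) expands to 27 - 18 a^4 + 8 a^6
    - a^8.\<close>
  have 2: "16 * lam\<^sup>2 * a ^ 6 = (3 - a\<^sup>2) ^ 3 * (1 + a\<^sup>2)"
    using param by algebra
  have "(2 * b ^ 3 / (1 + b\<^sup>2))\<^sup>2 = (b\<^sup>2) ^ 3 * (1 + a\<^sup>2)\<^sup>2 / 4"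
    using a2_add_pos by (simp add: b1 power_mult_distrib power_divide flip: power_mult)
  also have "\<dots> * (4 * (1 + a\<^sup>2)^2) = (3 - a\<^sup>2) ^ 3 * (1 + a\<^sup>2)"
    using a2_add_pos by (simp add: b_sq power_divide field_simps) algebra
  finally have "(2 * b ^ 3 / (1 + b\<^sup>2))\<^sup>2 * (4 * (1 + a\<^sup>2)^2) = (lam * h)\<^sup>2 * (4 * (1 + a\<^sup>2)^2)"
    using 1 2 by simp
  then have "(lam * h)\<^sup>2 = (2 * b ^ 3 / (1 + b\<^sup>2))\<^sup>2" using a2_add_pos by simp
  moreover have "0 \<le> lam * h" "0 \<le> 2 * b ^ 3 / (1 + b\<^sup>2)" using lam h_pos b_gt by auto
  ultimately show ?thesis by (simp add: power2_eq_iff_nonneg)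
qed

lemma H_a: "H a (complex_of_real a) = complex_of_real h"
proof -
  have ne: "complex_of_real (1 + a\<^sup>2) \<noteq> 0" "complex_of_real (1 - a\<^sup>2) \<noteq> 0"
    using a2_bounds(2) a2_add_pos(2) unfolding of_real_eq_0_iff by linarith+
  have "H a (complex_of_real a) = complex_of_real (a - (1 - a\<^sup>2)\<^sup>2 * a / ((1 + a\<^sup>2) * (1 - a\<^sup>2)))"
    by (simp add: H_def)
  also have "a - (1 - a\<^sup>2)\<^sup>2 * a / ((1 + a\<^sup>2) * (1 - a\<^sup>2)) = h"
    using a2_bounds a2_add_pos by (simp add: h_def divide_simps) algebra
  finally show ?thesis .
qed

lemma H_eq:
  fixes z :: complex
  shows "H a z = z + c * z / (z\<^sup>2 - 1)"
proof -
  have "H a z = z - complex_of_real c * (z / (1 - z\<^sup>2))"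
    unfolding H_def c_def by simp
  also have "z / (1 - z\<^sup>2) = - (z / (z\<^sup>2 - 1))"
    by (metis minus_diff_eq minus_divide_right)
  finally show ?thesis by simp
qed

lemma hG:
  fixes z :: complex
  shows "complex_of_real h * G z = z + c * z / (z\<^sup>2 - 1)"
  using h_pos by (simp add: G_def H_eq)

lemma G_sph_Some:
  "G_sph a (Some u) = (if u\<^sup>2 = 1 then None else Some (G u))"
  by (simp add: G_sph_def G_def H_a power2_eq_1_iff)

lemma G_sph_None [simp]: "G_sph a None = None"
  by (simp add: G_sph_def)

text \<open>The left side is |z - 1|^2 |z + 1|^2, the product of 1 + |z|^2 - 2 Re z and 1 + |z|^2 +
  2 Re z. Hence \<open>ff\<close> depends only on |z|^2 and (Re z)^2.\<close>

lemma norm_sq_minus_one: "(norm (z\<^sup>2 - 1))\<^sup>2 = (1 + (norm z)\<^sup>2)\<^sup>2 - 4 * (Re z)\<^sup>2"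
  unfolding cmod_power2 by (simp add: power2_eq_square algebra_simps)

text \<open>Multiplying by |u^2 - 1|^2 turns the quotient c u / (u^2 - 1) into c u times the
  conjugate of u^2 - 1, whose real and imaginary parts are polynomials.\<close>

lemma Im_hG: "u\<^sup>2 \<noteq> 1 \<Longrightarrow> h * Im (G u) * (norm (u\<^sup>2 - 1))\<^sup>2 = Im u * ff u"
  and Re_hG: "u\<^sup>2 \<noteq> 1 \<Longrightarrow> h * Re (G u) * (norm (u\<^sup>2 - 1))\<^sup>2 =
     Re u * (norm (u\<^sup>2 - 1))\<^sup>2 + c * Re u * ((norm u)\<^sup>2 - 1)"
proof -
  assume u: "u\<^sup>2 \<noteq> 1"
  define N where "N = (norm (u\<^sup>2 - 1))\<^sup>2"
  have N: "N \<noteq> 0" using u by (simp add: N_def)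
  have N2: "complex_of_real N = (u\<^sup>2 - 1) * cnj (u\<^sup>2 - 1)"
    unfolding N_def by (rule complex_norm_square)
  have "c * u / (u\<^sup>2 - 1) * complex_of_real N = c * (u * cnj (u\<^sup>2 - 1))"
    unfolding N2 using u by simp
  then have "complex_of_real h * G u * N = u * N + c * (u * cnj (u\<^sup>2 - 1))"
    by (simp only: hG distrib_right)
  then have "Re (complex_of_real h * G u * N) = Re (u * N + c * (u * cnj (u\<^sup>2 - 1)))"
    "Im (complex_of_real h * G u * N) = Im (u * N + c * (u * cnj (u\<^sup>2 - 1)))" by (simp_all only:)
  then have *: "h * Re (G u) * N = Re u * N + c * Re (u * cnj (u\<^sup>2 - 1))"
    "h * Im (G u) * N = Im u * N + c * Im (u * cnj (u\<^sup>2 - 1))"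
    by (simp_all del: complex_cnj_diff complex_cnj_power)
  have Re1: "Re (u * cnj (u\<^sup>2 - 1)) = Re u * ((norm u)\<^sup>2 - 1)"
    and Im1: "Im (u * cnj (u\<^sup>2 - 1)) = - Im u * ((norm u)\<^sup>2 + 1)"
    unfolding cmod_power2 by (simp_all add: power2_eq_square algebra_simps)
  show "h * Im (G u) * (norm (u\<^sup>2 - 1))\<^sup>2 = Im u * ff u"
    using *(2) unfolding Im1 ff_def N_def[symmetric] by (simp add: algebra_simps)
  show "h * Re (G u) * (norm (u\<^sup>2 - 1))\<^sup>2 = Re u * (norm (u\<^sup>2 - 1))\<^sup>2 + c * Re u * ((norm u)\<^sup>2 - 1)"
    using *(1) unfolding Re1 N_def[symmetric] by (simp add: algebra_simps)
qed

section \<open>The two ovals and the values of the cubic map on them\<close>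

lemma ff_pole: "u\<^sup>2 = 1 \<Longrightarrow> ff u < 0"
  using c_pos by (simp add: ff_def add_pos_nonneg)

lemma ff_zero_iff: "ff u = 0 \<longleftrightarrow> 4 * (Re u)\<^sup>2 = (1 + (norm u)\<^sup>2) * (1 + (norm u)\<^sup>2 - c)"
proof -
  have *: "(1 + r)\<^sup>2 - 4 * y - c * (1 + r) = (1 + r) * (1 + r - c) - 4 * y" for r y :: real
    by (simp add: power2_eq_square algebra_simps)
  show ?thesis unfolding ff_def norm_sq_minus_one * right_minus_eq by (rule eq_commute)
qed

text \<open>Eliminating Re u from \<open>ff_zero_iff\<close> by |u|^2 = (Re u)^2 + (Im u)^2 leaves a
  quadratic in |u|^2 with roots a^2 and b^2. Up to the signs of its coordinates, a point of the
  ovals is thus determined by |u|^2.\<close>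

lemma curve_Im: "ff u = 0 \<Longrightarrow> ((norm u)\<^sup>2 - a\<^sup>2) * ((norm u)\<^sup>2 - b\<^sup>2) = - 4 * (Im u)\<^sup>2"
  unfolding vieta ff_zero_iff cmod_power2 by (simp add: power2_eq_square algebra_simps)

lemma curve_range: assumes "ff u = 0" shows "a\<^sup>2 \<le> (norm u)\<^sup>2" "(norm u)\<^sup>2 \<le> b\<^sup>2"
proof -
  have "((norm u)\<^sup>2 - a\<^sup>2) * ((norm u)\<^sup>2 - b\<^sup>2) \<le> 0" using curve_Im[OF assms] by simp
  then show "a\<^sup>2 \<le> (norm u)\<^sup>2" "(norm u)\<^sup>2 \<le> b\<^sup>2"
    using a2_bounds b2_gt by (auto simp: mult_le_0_iff)
qed

lemma curve_Im_zero_iff: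
  "ff u = 0 \<Longrightarrow> Im u = 0 \<longleftrightarrow> (norm u)\<^sup>2 = a\<^sup>2 \<or> (norm u)\<^sup>2 = b\<^sup>2"
  using curve_Im[of u] by auto

text \<open>The square of h G on the ovals as a function of s = |u|^2. Squaring removes the sign of
  Re u, so one function serves both ovals.\<close>

definition K :: "real \<Rightarrow> real" where "K s = s\<^sup>2 * (1 - c / (1 + s))"

text \<open>Both factors increase, and the second one is nonnegative because c < 1.\<close>

lemma K_strict_mono: "0 \<le> s \<Longrightarrow> s < t \<Longrightarrow> K s < K t"
  unfolding K_def
proof (rule mult_strict_mono)
  assume st: "0 \<le> s" "s < t"
  show "s\<^sup>2 < t\<^sup>2" using st by (simp add: power_strict_mono)
  show "1 - c / (1 + s) < 1 - c / (1 + t)"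
    using st c_pos by (simp add: divide_strict_left_mono)
  show "0 < t\<^sup>2" using st by simp
  show "0 \<le> 1 - c / (1 + s)" using st c_less c_pos by simp
qed

lemma K_factor: "1 + s \<noteq> 0 \<Longrightarrow> 1 - c / (1 + s) = (1 + s) * (1 + s - c) / (1 + s)\<^sup>2"
  by (simp add: power2_eq_square divide_simps)

lemma K_a: "K (a\<^sup>2) = h\<^sup>2"
proof -
  have "(1 + a\<^sup>2) * (1 + a\<^sup>2 - c) = 4 * a\<^sup>2" using vieta[of "a\<^sup>2"] by algebra
  then have *: "1 - c / (1 + a\<^sup>2) = 4 * a\<^sup>2 / (1 + a\<^sup>2)\<^sup>2"
    using a2_add_pos(2) K_factor by metis
  show ?thesis unfolding K_def h_def * by (simp add: power_mult_distrib power_divide flip: power_mult power_add)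
qed

lemma K_b: "K (b\<^sup>2) = (lam * h)\<^sup>2"
proof -
  have "(1 + b\<^sup>2) * (1 + b\<^sup>2 - c) = 4 * b\<^sup>2" using vieta[of "b\<^sup>2"] by algebra
  moreover have "1 + b\<^sup>2 \<noteq> 0" using b2_gt by simp
  ultimately have *: "1 - c / (1 + b\<^sup>2) = 4 * b\<^sup>2 / (1 + b\<^sup>2)\<^sup>2" using K_factor by metis
  show ?thesis unfolding K_def lam_h * by (simp add: power_mult_distrib power_divide flip: power_mult power_add)
qed

text \<open>On the curve |u^2 - 1|^2 is c (1 + r) with r = |u|^2. Substituting this in
  \<open>Re_hG\<close>, the factor c cancels, since c (1 + r) + c (r - 1) = 2 c r.\<close>

lemma curve_G:
  assumes "ff u = 0"
  shows "Im (G u) = 0" "h * Re (G u) = 2 * Re u * (norm u)\<^sup>2 / (1 + (norm u)\<^sup>2)"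
    "(h * Re (G u))\<^sup>2 = K ((norm u)\<^sup>2)"
proof -
  have u: "u\<^sup>2 \<noteq> 1" using assms ff_pole by force
  then have N: "(norm (u\<^sup>2 - 1))\<^sup>2 \<noteq> 0" by simp
  have r: "0 < 1 + (norm u)\<^sup>2" by (simp add: add_pos_nonneg)
  show "Im (G u) = 0" using Im_hG[OF u] assms N h_pos by simp
  have N2: "(norm (u\<^sup>2 - 1))\<^sup>2 = c * (1 + (norm u)\<^sup>2)" using assms by (simp add: ff_def)
  have "h * Re (G u) * (c * (1 + (norm u)\<^sup>2)) = c * (2 * Re u * (norm u)\<^sup>2)"
    using Re_hG[OF u] unfolding N2 by (simp add: algebra_simps)
  then have "c * (h * Re (G u) * (1 + (norm u)\<^sup>2)) = c * (2 * Re u * (norm u)\<^sup>2)"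
    by (simp only: mult_ac)
  then have "h * Re (G u) * (1 + (norm u)\<^sup>2) = 2 * Re u * (norm u)\<^sup>2"
    using c_pos by (simp only: mult_cancel_left) simp
  then show *: "h * Re (G u) = 2 * Re u * (norm u)\<^sup>2 / (1 + (norm u)\<^sup>2)"
    using r by (simp only: eq_divide_eq) simp
  define r where "r = (norm u)\<^sup>2"
  have r0: "1 + r \<noteq> 0" using r by (simp add: r_def)
  have "(h * Re (G u))\<^sup>2 = 4 * (Re u)\<^sup>2 * r\<^sup>2 / (1 + r)\<^sup>2"
    unfolding * r_def by (simp add: power_mult_distrib power_divide)
  also have "4 * (Re u)\<^sup>2 = (1 + r) * (1 + r - c)" using assms by (simp add: ff_zero_iff r_def)
  also have "(1 + r) * (1 + r - c) * r\<^sup>2 / (1 + r)\<^sup>2 = K r"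
    using r0 by (simp add: K_def divide_simps) (simp add: power2_eq_square algebra_simps)
  finally show "(h * Re (G u))\<^sup>2 = K ((norm u)\<^sup>2)" by (simp add: r_def)
qed

lemma curve_G_real: "ff u = 0 \<Longrightarrow> G u = complex_of_real (Re (G u))"
  using curve_G(1) by (simp add: complex_eq_iff)

lemma curve_Re: assumes "ff u = 0" shows "Re u \<noteq> 0" "sgn (Re (G u)) = sgn (Re u)"
proof -
  have "0 < (1 + (norm u)\<^sup>2) * (1 + (norm u)\<^sup>2 - c)"
    using c_less zero_le_power2[of "norm u"] by (intro mult_pos_pos) linarith+
  then show R: "Re u \<noteq> 0" using assms unfolding ff_zero_iff by auto
  have "0 < (norm u)\<^sup>2" using curve_range(1)[OF assms] a2_bounds(1) by linarith
  then have "sgn (h * Re (G u)) = sgn (Re u)"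
    unfolding curve_G(2)[OF assms] by (simp add: sgn_mult sgn_divide add_pos_nonneg)
  then show "sgn (Re (G u)) = sgn (Re u)" using h_pos by (simp add: sgn_mult)
qed

text \<open>\<open>K\<close> increases and takes the values h^2 and (lam h)^2 at a^2 and b^2, so
  comparing |x| with 1 and lam is comparing r with a^2 and b^2.\<close>

lemma K_abs_le: assumes "(h * x)\<^sup>2 = K r" "0 \<le> r"
  shows "1 \<le> \<bar>x\<bar> \<longleftrightarrow> a\<^sup>2 \<le> r" "\<bar>x\<bar> \<le> lam \<longleftrightarrow> r \<le> b\<^sup>2"
    "1 < \<bar>x\<bar> \<longleftrightarrow> a\<^sup>2 < r" "\<bar>x\<bar> < lam \<longleftrightarrow> r < b\<^sup>2"
proof -
  have le: "K s \<le> K t \<longleftrightarrow> s \<le> t" "K s < K t \<longleftrightarrow> s < t" if "0 \<le> s" "0 \<le> t" for s t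
    using that K_strict_mono[of s t] K_strict_mono[of t s] by (cases s t rule: linorder_cases; simp)+
  have sq: "h\<^sup>2 \<le> (h * x)\<^sup>2 \<longleftrightarrow> 1 \<le> \<bar>x\<bar>" "h\<^sup>2 < (h * x)\<^sup>2 \<longleftrightarrow> 1 < \<bar>x\<bar>"
    "(h * x)\<^sup>2 \<le> (lam * h)\<^sup>2 \<longleftrightarrow> \<bar>x\<bar> \<le> lam" "(h * x)\<^sup>2 < (lam * h)\<^sup>2 \<longleftrightarrow> \<bar>x\<bar> < lam"
    using h_pos lam abs_le_square_iff[of h "h*x"] abs_le_square_iff[of "h*x" "lam*h"]
     abs_le_square_iff[of "h*x" h] abs_le_square_iff[of "lam*h" "h*x"]
    by (auto simp: abs_mult mult.commute not_le[symmetric])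
  show "1 \<le> \<bar>x\<bar> \<longleftrightarrow> a\<^sup>2 \<le> r" "\<bar>x\<bar> \<le> lam \<longleftrightarrow> r \<le> b\<^sup>2"
    "1 < \<bar>x\<bar> \<longleftrightarrow> a\<^sup>2 < r" "\<bar>x\<bar> < lam \<longleftrightarrow> r < b\<^sup>2"
    using sq le[of "a\<^sup>2" r] le[of r "b\<^sup>2"] assms unfolding K_a K_b by auto
qed

lemma curve_G_bounds:
  assumes "ff u = 0"
  shows "1 \<le> \<bar>Re (G u)\<bar>" "\<bar>Re (G u)\<bar> \<le> lam"
    "Im u \<noteq> 0 \<longleftrightarrow> 1 < \<bar>Re (G u)\<bar> \<and> \<bar>Re (G u)\<bar> < lam"
  using K_abs_le[OF curve_G(3)[OF assms]] curve_range[OF assms] curve_Im_zero_iff[OF assms]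
  by auto

lemma curve_surj:
  assumes "1 \<le> \<bar>x\<bar>" "\<bar>x\<bar> \<le> lam"
  obtains u where "ff u = 0" "0 \<le> Im u" "G u = complex_of_real x"
proof -
  have "h\<^sup>2 \<le> (h * x)\<^sup>2" "(h * x)\<^sup>2 \<le> (lam * h)\<^sup>2"
    using assms h_pos lam by (auto simp: power2_le_iff_abs_le abs_mult mult.commute simp flip: abs_le_square_iff)
  moreover have "continuous_on {a\<^sup>2..b\<^sup>2} K"
    unfolding K_def
  proof (intro continuous_intros ballI)
    fix s assume "s \<in> {a\<^sup>2..b\<^sup>2}"
    then show "1 + s \<noteq> 0" using a2_bounds(1) by (simp only: atLeastAtMost_iff) linarith
  qed
  ultimately obtain r where r: "a\<^sup>2 \<le> r" "r \<le> b\<^sup>2" "K r = (h * x)\<^sup>2"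
    using IVT'[of K "a\<^sup>2" "(h * x)\<^sup>2" "b\<^sup>2"] a2_bounds b2_gt by (auto simp: K_a K_b)
  have r0: "0 < r" using r(1) a2_bounds(1) by linarith
  have x0: "(sgn x)\<^sup>2 = 1" using assms by (auto simp: sgn_if)
  \<comment> \<open>The coordinates forced by |u|^2 = r: X solves \<open>ff_zero_iff\<close> with
    the sign of x, which selects the oval, and Y is the nonnegative solution of
    \<open>curve_Im\<close>.\<close>
  define X where "X = sgn x * sqrt ((1 + r) * (1 + r - c)) / 2"
  define Y where "Y = sqrt (- ((r - a\<^sup>2) * (r - b\<^sup>2))) / 2"
  have X2: "4 * X\<^sup>2 = (1 + r) * (1 + r - c)"
    using r0 c_less by (simp add: X_def power_divide power_mult_distrib x0)
  have Y2: "4 * Y\<^sup>2 = - ((r - a\<^sup>2) * (r - b\<^sup>2))"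
    using r by (simp add: Y_def power_divide mult_nonneg_nonpos)
  define u where "u = Complex X Y"
  have nu: "(norm u)\<^sup>2 = r" unfolding cmod_power2 u_def using X2 Y2 vieta[of r] by simp algebra
  have ff: "ff u = 0" unfolding ff_zero_iff nu using X2 by (simp add: u_def)
  have "(h * Re (G u))\<^sup>2 = (h * x)\<^sup>2" using curve_G(3)[OF ff] r nu by simp
  then have "(Re (G u))\<^sup>2 = x\<^sup>2" using h_pos by (simp add: power_mult_distrib)
  then have "\<bar>Re (G u)\<bar> = \<bar>x\<bar>" by (auto simp: power2_eq_iff)
  moreover have "sgn (Re u) = sgn x" using r0 c_less by (simp add: u_def X_def sgn_mult)
  ultimately have "Re (G u) = x"
    using curve_Re(2)[OF ff] by (metis abs_mult_sgn mult.commute sgn_mult_abs)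
  then have "G u = complex_of_real x" using curve_G_real[OF ff] by simp
  moreover have "0 \<le> Im u" using r by (simp add: u_def Y_def mult_nonneg_nonpos)
  ultimately show ?thesis using ff that by blast
qed

text \<open>The value of G determines |u|^2 by monotonicity of \<open>K\<close>, then Re u by the
  formula for h G. Only conjugate points remain to be identified.\<close>

lemma curve_inj:
  assumes "ff u = 0" "ff v = 0" "G u = G v"
  shows "Re u = Re v" "\<bar>Im u\<bar> = \<bar>Im v\<bar>"
proof -
  have "K ((norm u)\<^sup>2) = K ((norm v)\<^sup>2)" using curve_G(3) assms by metis
  then have n: "(norm u)\<^sup>2 = (norm v)\<^sup>2"
    using K_strict_mono by (metis less_irrefl linorder_less_linear zero_le_power2)
  have p: "0 < (norm v)\<^sup>2" using curve_range(1)[OF assms(2)] a2_bounds(1) by linarith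
  have "2 * Re u * (norm u)\<^sup>2 / (1 + (norm u)\<^sup>2) = 2 * Re v * (norm v)\<^sup>2 / (1 + (norm v)\<^sup>2)"
    using curve_G(2) assms by metis
  moreover have "1 + (norm v)\<^sup>2 \<noteq> 0" using p by linarith
  ultimately show R: "Re u = Re v" using p unfolding n by simp
  then have "(Im u)\<^sup>2 = (Im v)\<^sup>2" using n by (simp add: cmod_power2)
  then show "\<bar>Im u\<bar> = \<bar>Im v\<bar>" by (simp add: power2_eq_iff abs_eq_iff)
qed

lemma cnj_curve: "ff (cnj u) = ff u"
  by (simp add: ff_def norm_sq_minus_one del: complex_cnj_power)

lemma G_cnj: "G (cnj u) = cnj (G u)"
  by (simp add: G_def H_def)

section \<open>Fibres as roots of a cubic polynomial\<close>

lemma G_eq_iff: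
  fixes u w :: complex
  assumes "u\<^sup>2 \<noteq> 1"
  shows "G u = w \<longleftrightarrow> u ^ 3 - (h * w) * u\<^sup>2 - (1 - c) * u + h * w = 0"
proof -
  have d: "u\<^sup>2 - 1 \<noteq> 0" using assms by simp
  have "G u = w \<longleftrightarrow> complex_of_real h * G u = h * w" using h_pos by simp
  also have "\<dots> \<longleftrightarrow> (u + c * u / (u\<^sup>2 - 1)) * (u\<^sup>2 - 1) = h * w * (u\<^sup>2 - 1)"
    unfolding hG mult_cancel_right using d by simp
  also have "\<dots> \<longleftrightarrow> u * (u\<^sup>2 - 1) + c * u = h * w * (u\<^sup>2 - 1)"
    unfolding ring_distribs(2) using d by simp
  also have "\<dots> \<longleftrightarrow> u ^ 3 - (h * w) * u\<^sup>2 - (1 - c) * u + h * w = 0" by (simp add: power2_eq_square power3_eq_cube) algebra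
  finally show ?thesis .
qed

text \<open>Vieta's relation for the sum of the roots of the monic cubic in \<open>G_eq_iff\<close>,
  whose quadratic coefficient is -h w. Two rounds of difference quotients give it without factoring
  the polynomial.\<close>

lemma fibre_sum:
  fixes u v x w :: complex
  assumes "u\<^sup>2 \<noteq> 1" "v\<^sup>2 \<noteq> 1" "x\<^sup>2 \<noteq> 1" "G u = w" "G v = w" "G x = w" "u \<noteq> v" "u \<noteq> x" "v \<noteq> x"
  shows "x = h * w - u - v"
proof -
  define W where "W = complex_of_real h * w"
  have root: "y ^ 3 - W * y\<^sup>2 - (1 - c) * y + W = 0" if "y \<in> {u, v, x}" for y :: complex
    using G_eq_iff[of y w] that assms(1-6) by (auto simp: W_def)
  have quot: "y\<^sup>2 + y * y' + y'\<^sup>2 - W * (y + y') - (1 - c) = 0"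
    if "y \<in> {u, v, x}" "y' \<in> {u, v, x}" "y \<noteq> y'" for y y' :: complex
  proof -
    have "(y - y') * (y\<^sup>2 + y * y' + y'\<^sup>2 - W * (y + y') - (1 - c)) = 0"
      using root[OF that(1)] root[OF that(2)] by algebra
    then show ?thesis using that(3) by simp
  qed
  have "(v - x) * (x + u + v - W) = 0"
    using quot[of u v] quot[of u x] assms(7,8) by simp algebra
  then have "x + u + v - W = 0" using assms(9) by simp
  then show ?thesis unfolding W_def by algebra
qed

lemma fibre_card_le_3:
  fixes u v x y w :: complex
  assumes "u\<^sup>2 \<noteq> 1" "v\<^sup>2 \<noteq> 1" "x\<^sup>2 \<noteq> 1" "y\<^sup>2 \<noteq> 1" "G u = w" "G v = w" "G x = w" "G y = w"
    and "u \<noteq> v" "u \<noteq> x" "v \<noteq> x"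
  shows "y \<in> {u, v, x}"
proof (rule ccontr)
  assume "y \<notin> {u, v, x}"
  then have ne: "u \<noteq> y" "v \<noteq> y" "y \<noteq> x" by auto
  have "x = h * w - u - v" by (rule fibre_sum) (use assms in simp_all)
  moreover have "y = h * w - u - v" by (rule fibre_sum) (use assms ne in simp_all)
  ultimately show False using ne(3) by metis
qed

text \<open>A real point of the ovals is one of a, -a, b, -b, hence a double root of its own fibre
  equation, and only one simple root is left.\<close>

lemma fibre_double:
  fixes e u v :: complex
  assumes e: "ff e = 0" "Im e = 0" and uv: "u\<^sup>2 \<noteq> 1" "v\<^sup>2 \<noteq> 1" "u \<noteq> e" "v \<noteq> e" "G u = G e" "G v = G e"
  shows "u = v"
proof -
  define W where "W = h * G e"
  have e2: "e\<^sup>2 \<noteq> 1" using ff_pole e by force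
  have er: "e = of_real (Re e)" "(norm e)\<^sup>2 = (Re e)\<^sup>2" using e by (auto simp: complex_eq_iff cmod_power2)
  have p: "1 + (Re e)\<^sup>2 \<noteq> 0" by (simp add: add_nonneg_eq_0_iff)
  have "h * Re (G e) * (1 + (Re e)\<^sup>2) = 2 * Re e ^ 3"
    unfolding curve_G(2)[OF e(1)] er(2) using p by (simp add: power3_eq_cube power2_eq_square)
  moreover have "((Re e)\<^sup>2)\<^sup>2 - (2 + c) * (Re e)\<^sup>2 + (1 - c) = 0"
    using curve_Im[OF e(1)] e(2) unfolding vieta er(2) by simp
  ultimately have "(1 + (Re e)\<^sup>2) * (3 * (Re e)\<^sup>2 - 2 * (h * Re (G e)) * Re e - (1 - c)) = 0" by algebra
  then have "3 * (Re e)\<^sup>2 - 2 * (h * Re (G e)) * Re e - (1 - c) = 0" using p by simp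
  then have "complex_of_real (3 * (Re e)\<^sup>2 - 2 * (h * Re (G e)) * Re e - (1 - c)) = 0" by simp
  \<comment> \<open>The derivative of the fibre cubic vanishes at \<open>e\<close>. Inserting h G(e)
    = 2 e^3 / (1 + e^2) reduces this to the critical point equation in e^2.\<close>
  then have crit: "3 * e\<^sup>2 - 2 * W * e - (1 - c) = 0"
    using er(1) curve_G_real[OF e(1)] unfolding W_def by (metis of_real_diff of_real_mult of_real_numeral of_real_power of_real_1)
  have "x = W - 2 * e" if "x\<^sup>2 \<noteq> 1" "x \<noteq> e" "G x = G e" for x :: complex
  proof -
    have "x ^ 3 - W * x\<^sup>2 - (1 - c) * x + W = 0" "e ^ 3 - W * e\<^sup>2 - (1 - c) * e + W = 0"
      using G_eq_iff[of x "G e"] G_eq_iff[of e "G e"] that e2 by (auto simp: W_def)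
    then have "(x - e) ^ 2 * (x + 2 * e - W) = 0" using crit by algebra
    then have "x + 2 * e - W = 0" using that(2) by simp
    then show ?thesis by algebra
  qed
  then show ?thesis using uv by metis
qed

section \<open>The sheets\<close>

lemma open_sq_ne_1: "open {u::complex. u\<^sup>2 \<noteq> 1}"
  by (intro open_Collect_neq continuous_intros)

lemma G_holomorphic: "G holomorphic_on {u. u\<^sup>2 \<noteq> 1}"
  unfolding G_def H_eq using h_pos by (intro holomorphic_intros) auto

lemma G_holomorphic_subset: "(\<And>u. u \<in> S \<Longrightarrow> u\<^sup>2 \<noteq> 1) \<Longrightarrow> G holomorphic_on S"
  by (rule holomorphic_on_subset[OF G_holomorphic]) auto

lemma filterlim_G_pole:
  fixes w :: complex
  assumes "w\<^sup>2 = 1" shows "filterlim G at_infinity (at w)"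
proof -
  have ev: "eventually (\<lambda>z. z\<^sup>2 \<noteq> 1) (at w)"
  proof -
    \<comment> \<open>The other square root of 1 is \<open>- w\<close>, at distance 2.\<close>
    have "z\<^sup>2 \<noteq> 1" if "z \<noteq> w" "dist z w < 1" for z
    proof
      assume "z\<^sup>2 = 1"
      then have "(z - w) * (z + w) = 0" using assms by algebra
      then have "z = - w" using that(1) by (auto simp: add_eq_0_iff)
      moreover have "norm w = 1" using assms by (auto simp: power2_eq_1_iff)
      ultimately have "dist z w = 2" by (simp add: dist_norm norm_mult flip: mult_2)
      then show False using that(2) by simp
    qed
    then show ?thesis unfolding eventually_at using zero_less_one by blast
  qed
  have "filterlim (\<lambda>z. (z * (z\<^sup>2 - 1) + c * z) / (h * (z\<^sup>2 - 1))) at_infinity (at w)"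
  proof (rule filterlim_divide_at_infinity)
    show "((\<lambda>z. z * (z\<^sup>2 - 1) + c * z) \<longlongrightarrow> w * (w\<^sup>2 - 1) + c * w) (at w)" by (intro tendsto_intros)
    have "((\<lambda>z. h * (z\<^sup>2 - 1)) \<longlongrightarrow> h * (w\<^sup>2 - 1)) (at w)" by (intro tendsto_intros)
    moreover have "eventually (\<lambda>z. h * (z\<^sup>2 - 1) \<noteq> (0::complex)) (at w)"
      using ev h_pos by (auto elim: eventually_mono)
    ultimately show "filterlim (\<lambda>z. h * (z\<^sup>2 - 1)) (at 0) (at w)"
      using assms by (auto simp: filterlim_at)
    show "w * (w\<^sup>2 - 1) + c * w \<noteq> 0" using assms c_pos by auto
  qed
  moreover have "eventually (\<lambda>z. (z * (z\<^sup>2 - 1) + c * z) / (h * (z\<^sup>2 - 1)) = G z) (at w)"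
    using ev
  proof eventually_elim
    case (elim z)
    then have "z\<^sup>2 - 1 \<noteq> 0" "complex_of_real h \<noteq> 0" using h_pos by auto
    then show ?case unfolding G_def H_eq by (simp add: divide_simps)
  qed
  ultimately show ?thesis using filterlim_cong[OF refl refl] by fast
qed

lemma sq_minus_one_at_infinity: "filterlim (\<lambda>z::complex. z\<^sup>2 - 1) at_infinity at_infinity"
  unfolding diff_conv_add_uminus
  by (intro tendsto_add_filterlim_at_infinity' filterlim_power_at_infinity) (auto intro: filterlim_ident)

lemma G_ratio_at_infinity: "((\<lambda>z::complex. (1 + complex_of_real c / (z\<^sup>2 - 1)) / complex_of_real h) \<longlongrightarrow> complex_of_real (1 / h)) at_infinity"
proof -
  have "((\<lambda>z::complex. complex_of_real c / (z\<^sup>2 - 1)) \<longlongrightarrow> 0) at_infinity"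
    using sq_minus_one_at_infinity by (intro tendsto_divide_0[OF tendsto_const])
  then have "((\<lambda>z::complex. (1 + complex_of_real c / (z\<^sup>2 - 1)) / complex_of_real h) \<longlongrightarrow> (1 + 0) / complex_of_real h) at_infinity"
    using h_pos by (intro tendsto_intros) auto
  then show ?thesis by simp
qed

lemma filterlim_G_infinity: "filterlim G at_infinity at_infinity"
proof -
  have "filterlim (\<lambda>z::complex. (1 + complex_of_real c / (z\<^sup>2 - 1)) / complex_of_real h * z) at_infinity at_infinity"
    by (rule tendsto_mult_filterlim_at_infinity[OF G_ratio_at_infinity])
      (use h_pos in \<open>auto intro: filterlim_ident\<close>)
  moreover have "(1 + c / (z\<^sup>2 - 1)) / h * z = G z" for z :: complex
    unfolding G_def H_eq by (simp add: ring_distribs add_divide_distrib)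
  ultimately show ?thesis by simp
qed

lemma continuous_G_sph: "continuous_map sphere_top sphere_top (G_sph a)"
proof (rule continuous_map_sphereI)
  fix w :: complex
  show "limitin sphere_top (\<lambda>u. G_sph a (Some u)) (G_sph a (Some w)) (at w)"
  proof (cases "w\<^sup>2 = 1")
    case True
    have "eventually (\<lambda>u. G_sph a (Some u) = None \<or> r < norm (the (G_sph a (Some u)))) (at w)" for r
      using filterlim_at_infinityD[OF filterlim_G_pole[OF True], of r]
      by eventually_elim (auto simp: G_sph_Some)
    then show ?thesis using True by (simp add: limitin_sphere_None G_sph_Some)
  next
    case False
    have ev: "eventually (\<lambda>u. u\<^sup>2 \<noteq> 1) (at w)"
      using open_sq_ne_1 False eventually_at_in_open'[of "{u. u\<^sup>2 \<noteq> 1}" w] by auto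
    have "isCont G w"
      using G_holomorphic False open_sq_ne_1
      by (auto dest!: holomorphic_on_imp_continuous_on simp: continuous_on_eq_continuous_at)
    then have "(G \<longlongrightarrow> G w) (at w)" by (simp add: isCont_def)
    moreover have "eventually (\<lambda>u. G u = the (G_sph a (Some u))) (at w)"
      using ev by eventually_elim (simp add: G_sph_Some)
    ultimately have "((\<lambda>u. the (G_sph a (Some u))) \<longlongrightarrow> G w) (at w)" by (rule Lim_transform_eventually)
    moreover have "eventually (\<lambda>u. G_sph a (Some u) \<noteq> None) (at w)"
      using ev by eventually_elim (simp add: G_sph_Some)
    ultimately show ?thesis using False by (simp add: limitin_sphere_Some G_sph_Some)
  qed
next
  have "eventually (\<lambda>u. G_sph a (Some u) = None \<or> r < norm (the (G_sph a (Some u)))) at_infinity" for r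
    using filterlim_at_infinityD[OF filterlim_G_infinity, of r]
    by eventually_elim (auto simp: G_sph_Some)
  then show "limitin sphere_top (\<lambda>u. G_sph a (Some u)) (G_sph a None) at_infinity"
    by (simp add: limitin_sphere_None)
qed

text \<open>The set ff < 0 misses the imaginary axis, so the sign of Re u tells its two components
  apart. On the curve itself the value is a default, which \<open>Om\<close> excludes.\<close>

definition sheet :: "complex \<Rightarrow> nat" where
  "sheet u = (if ff u > 0 then 1 else if Re u < 0 then 0 else 2)"

definition Om :: "nat \<Rightarrow> complex set" where "Om k = {u. ff u \<noteq> 0 \<and> sheet u = k}"

text \<open>The region of sheet k together with its bounding ovals, taken on the sphere so that it
  is compact; the unbounded region belongs to sheet 1.\<close>

definition closed_sheet :: "nat \<Rightarrow> complex option set" where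
  "closed_sheet k = (if k = 0 then Some ` {u. ff u \<le> 0 \<and> Re u \<le> 0}
     else if k = 1 then insert None (Some ` {u. ff u \<ge> 0}) else Some ` {u. ff u \<le> 0 \<and> Re u \<ge> 0})"

lemma continuous_ff [continuous_intros]: "continuous_on S ff"
  unfolding ff_def by (intro continuous_intros)

lemma ff_eq: "ff u = (1 + (norm u)\<^sup>2) * (1 + (norm u)\<^sup>2 - c) - 4 * (Re u)\<^sup>2"
  unfolding ff_def norm_sq_minus_one by (simp add: power2_eq_square algebra_simps)

lemma ff_imaginary: "Re u = 0 \<Longrightarrow> 0 < ff u"
  unfolding ff_eq using c_less zero_le_power2[of "norm u"]
  by (simp only: power2_eq_square mult_zero_right diff_0_right) (intro mult_pos_pos; linarith)

text \<open>A crude bound that places a neighbourhood of infinity in sheet 1: with r = |u|^2 > 4 one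
  has (1 + r)(1 + r - c) \<ge> r (1 + r) > 4 r \<ge> 4 (Re u)^2.\<close>

lemma ff_large: assumes "2 < norm u" shows "0 < ff u"
proof -
  define r where "r = (norm u)\<^sup>2"
  have r: "4 < r" using assms power_strict_mono[of 2 "norm u" 2] by (simp add: r_def)
  have "(Re u)\<^sup>2 \<le> r" by (simp add: r_def cmod_power2)
  moreover have "r * (1 + r) \<le> (1 + r) * (1 + r - c)" using r c_less by (subst mult.commute) (intro mult_left_mono; linarith)
  moreover have "4 * r < r * (1 + r)" using r by simp
  ultimately show ?thesis unfolding ff_eq r_def[symmetric] by linarith
qed

lemma Om_eq: "Om 0 = {u. ff u < 0 \<and> Re u < 0}" "Om 1 = {u. ff u > 0}" "Om 2 = {u. ff u < 0 \<and> Re u > 0}"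
proof -
  have "u \<in> Om 0 \<longleftrightarrow> ff u < 0 \<and> Re u < 0" "u \<in> Om 1 \<longleftrightarrow> ff u > 0" "u \<in> Om 2 \<longleftrightarrow> ff u < 0 \<and> Re u > 0" for u
    using ff_imaginary[of u] by (cases "Re u" "0::real" rule: linorder_cases; auto simp: Om_def sheet_def)+
  then show "Om 0 = {u. ff u < 0 \<and> Re u < 0}" "Om 1 = {u. ff u > 0}" "Om 2 = {u. ff u < 0 \<and> Re u > 0}"
    by blast+
qed

lemma sheet_le_2: "sheet u \<le> 2" by (simp add: sheet_def)

lemma Om_empty: "2 < k \<Longrightarrow> Om k = {}" using sheet_le_2 by (force simp: Om_def not_less[symmetric])

lemma open_Om: "open (Om k)"
proof -
  consider "k = 0" | "k = 1" | "k = 2" | "2 < k" by linarith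
  then show ?thesis
    by cases (auto simp: Om_eq[simplified] Om_empty intro!: open_Collect_conj open_Collect_less continuous_intros)
qed

lemma vimage_insert_None: "Some -` insert None (Some ` S) = S"
  by auto

lemma closedin_closed_sheet: "closedin sphere_top (closed_sheet k)"
proof -
  have o: "open {u. 0 < ff u \<or> 0 < Re u}" "open {u. ff u < 0}" "open {u. 0 < ff u \<or> Re u < 0}"
    by (intro open_Collect_disj open_Collect_less continuous_intros)+
  have "UNIV - closed_sheet k = (if k = 0 then insert None (Some ` {u. 0 < ff u \<or> 0 < Re u})
     else if k = 1 then Some ` {u. ff u < 0} else insert None (Some ` {u. 0 < ff u \<or> Re u < 0}))"
    unfolding closed_sheet_def by (auto simp: not_le image_iff) (metis not_le option.exhaust)+
  moreover have "openin sphere_top \<dots>"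
    using o ff_large by (auto simp: openin_sphere_top inj_vimage_image_eq vimage_Un vimage_insert_None)
  ultimately show ?thesis by (simp add: closedin_def)
qed

lemma curve_cases: assumes "ff u = 0"
  shows "Re u < 0 \<and> G u \<in> Delta1 lam \<and> G u \<notin> Delta2 lam \<or> 0 < Re u \<and> G u \<in> Delta2 lam \<and> G u \<notin> Delta1 lam"
proof -
  note b = curve_G_bounds(1,2)[OF assms] and R = curve_Re[OF assms] and G = curve_G_real[OF assms]
  consider "Re u < 0" "Re (G u) < 0" | "Re u > 0" "Re (G u) > 0"
    using R by (auto simp: sgn_if split: if_splits)
  then show ?thesis
  proof cases
    case 1
    then have "Re (G u) \<in> {-lam..-1}" "Re (G u) \<notin> {1..lam}" using b by auto
    then show ?thesis using 1 G unfolding Delta1_def Delta2_def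
      by (metis (no_types, lifting) Re_complex_of_real image_iff)
  next
    case 2
    then have "Re (G u) \<notin> {-lam..-1}" "Re (G u) \<in> {1..lam}" using b by auto
    then show ?thesis using 2 G unfolding Delta1_def Delta2_def
      by (metis (no_types, lifting) Re_complex_of_real image_iff)
  qed
qed

text \<open>Four distinct points with one common value would contradict degree three. This is the
  hypothesis of the open mapping theorem on every open subset.\<close>

lemma nonconstant_G: assumes "open X" "X \<noteq> {}" "\<And>u. u \<in> X \<Longrightarrow> u\<^sup>2 \<noteq> 1" shows "\<not> G constant_on X"
proof
  assume "G constant_on X"
  then obtain w where w: "\<And>u. u \<in> X \<Longrightarrow> G u = w" by (auto simp: constant_on_def)
  have inf: "infinite X" using assms finite_imp_not_open by blast
  then obtain u where u: "u \<in> X" by fastforce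
  obtain v where v: "v \<in> X" "v \<notin> {u}" using inf by (metis finite.emptyI finite.insertI finite_subset subsetI)
  obtain x where x: "x \<in> X" "x \<notin> {u, v}" using inf by (metis finite.emptyI finite.insertI finite_subset subsetI)
  obtain y where y: "y \<in> X" "y \<notin> {u, v, x}" using inf by (metis finite.emptyI finite.insertI finite_subset subsetI)
  show False using fibre_card_le_3[of u v x y w] u v x y assms(3) w by auto
qed

lemma cutset_real: "cutset lam k \<subseteq> \<real>" "0 \<notin> cutset lam k"
  unfolding cutset_def Delta1_def Delta2_def by auto

text \<open>A non-real value certainly lies off the cuts, so this gives a starting point for the
  connectedness argument.\<close>

lemma nonreal_point_in_Om:
  assumes "k \<le> 2" obtains u where "u \<in> Om k" "u\<^sup>2 \<noteq> 1" "Im (G u) \<noteq> 0"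
proof -
  have "\<exists>u\<in>Om k. Im u \<noteq> 0"
  proof (cases "k = 1")
    case True
    have "ff \<i> > 0" by (rule ff_imaginary) simp
    then show ?thesis using True Om_eq(2) by (metis (mono_tags) complex_i_not_zero imaginary_unit.sel(2) mem_Collect_eq zero_neq_one)
  next
    case False
    \<comment> \<open>The points 1 + \<i> e and -1 + \<i> e with e^2 = c / 4 lie inside the ovals:
      there \<open>ff\<close> equals - c - 3 c^2 / 16.\<close>
    define e where "e = sqrt c / 2"
    have e: "e\<^sup>2 = c / 4" "e \<noteq> 0" using c_pos by (auto simp: e_def power_divide)
    have ff: "ff (Complex s e) < 0" if "s\<^sup>2 = 1" for s
    proof -
      have "ff (Complex s e) = - c - 3 * c\<^sup>2 / 16"
        unfolding ff_eq cmod_power2 by (simp add: that e(1)) (simp add: power2_eq_square algebra_simps)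
      also have "\<dots> < 0" using c_pos zero_le_power2[of c] by linarith
      finally show ?thesis .
    qed
    have "Complex (-1) e \<in> Om 0" "Complex 1 e \<in> Om 2" using ff[of "-1"] ff[of 1] by (auto simp: Om_eq)
    moreover have "k = 0 \<or> k = 2" using False assms by auto
    ultimately show ?thesis using e(2) by (metis complex.sel(2))
  qed
  then obtain u where u: "u \<in> Om k" "Im u \<noteq> 0" by blast
  then have "u\<^sup>2 \<noteq> 1" by (auto simp: power2_eq_1_iff)
  moreover have "Im u * ff u \<noteq> 0" using u by (auto simp: Om_def)
  ultimately have "Im (G u) \<noteq> 0" using Im_hG[of u] by auto
  then show ?thesis using that u \<open>u\<^sup>2 \<noteq> 1\<close> by blast
qed

text \<open>The image of a sheet is open by the open mapping theorem and, up to the cuts, closed by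
  compactness of the sphere.\<close>

lemma sheet_surj:
  assumes k: "k \<le> 2" and w: "w \<notin> cutset lam k"
  obtains u where "u \<in> Om k" "u\<^sup>2 \<noteq> 1" "G u = w"
proof -
  define S where "S = Om k \<inter> {u. u\<^sup>2 \<noteq> 1}"
  define A where "A = G ` S - cutset lam k"
  have "open S" unfolding S_def using open_Om open_sq_ne_1 by blast
  then have "open (G ` S)"
    using nonconstant_G by (intro open_mapping_thm2[of G S S]) (auto simp: S_def intro!: G_holomorphic_subset)
  then have opA: "openin (top_of_set (- cutset lam k)) A"
    by (auto simp: A_def openin_open Diff_eq Int_commute)
  have "compactin sphere_top (closed_sheet k)"
    using compact_space_sphere_top closedin_closed_sheet closedin_compact_space by blast
  then have "closedin sphere_top (G_sph a ` closed_sheet k)"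
    using continuous_G_sph Hausdorff_space_sphere_top compactin_imp_closedin image_compactin by blast
  then have "openin sphere_top (- G_sph a ` closed_sheet k)"
    by (simp add: closedin_def Compl_eq_Diff_UNIV)
  then have cl: "closed (Some -` (G_sph a ` closed_sheet k))"
    by (auto simp: openin_sphere_top closed_def vimage_Compl)
  \<comment> \<open>Off the cuts the region and its compact closure have the same image, so the
    relatively open set \<open>A\<close> is also relatively closed.\<close>
  have "A = Some -` (G_sph a ` closed_sheet k) - cutset lam k"
  proof (rule set_eqI)
    fix y
    have 1: "y \<in> G ` S" if y: "Some y \<in> G_sph a ` closed_sheet k" "y \<notin> cutset lam k"
    proof -
      obtain u where u: "Some y = G_sph a (Some u)" "Some u \<in> closed_sheet k"
        using y(1) by (metis G_sph_None image_iff not_Some_eq)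
      then have u1: "u\<^sup>2 \<noteq> 1" "y = G u" by (auto simp: G_sph_Some split: if_splits)
      \<comment> \<open>A bounding oval of the region is mapped into a cut of the same sheet, and
        \<open>y\<close> lies off those cuts.\<close>
      have "ff u \<noteq> 0"
      proof
        assume ff: "ff u = 0"
        show False using curve_cases[OF ff] y(2) u(2) u1(2)
          by (auto simp: cutset_def closed_sheet_def split: if_splits)
      qed
      moreover have "k = 0 \<or> k = 1 \<or> k = 2" using k by auto
      ultimately have "u \<in> Om k" using u(2) ff_imaginary[of u]
        by (auto simp: closed_sheet_def Om_eq[simplified] less_eq_real_def)
      then show ?thesis using u1 by (auto simp: S_def)
    qed
    have 2: "Some y \<in> G_sph a ` closed_sheet k" if y: "y \<in> G ` S"
    proof -
      obtain u where u: "u \<in> Om k" "u\<^sup>2 \<noteq> 1" "y = G u" using y by (auto simp: S_def)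
      have "k = 0 \<or> k = 1 \<or> k = 2" using k by auto
      then have "Some u \<in> closed_sheet k" using u(1) by (auto simp: closed_sheet_def Om_eq[simplified])
      moreover have "G_sph a (Some u) = Some y" using u by (simp add: G_sph_Some)
      ultimately show ?thesis by (metis image_eqI)
    qed
    show "y \<in> A \<longleftrightarrow> y \<in> Some -` (G_sph a ` closed_sheet k) - cutset lam k"
      unfolding A_def using 1 2 by blast
  qed
  then have clA: "closedin (top_of_set (- cutset lam k)) A"
    using cl by (auto simp: closedin_closed Diff_eq Int_commute)
  have "A \<noteq> {}"
  proof -
    obtain u where "u \<in> Om k" "u\<^sup>2 \<noteq> 1" "Im (G u) \<noteq> 0" using nonreal_point_in_Om[OF k] .
    then have "G u \<in> A" using cutset_real(1)[of k] by (auto simp: A_def S_def complex_is_Real_iff)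
    then show ?thesis by blast
  qed
  moreover have "connected (- cutset lam k)" by (rule connected_Compl_real_subset[OF cutset_real])
  ultimately have "A = - cutset lam k" using opA clA by (auto simp: connected_clopen)
  then have "w \<in> A" using w by simp
  then show ?thesis using that by (auto simp: A_def S_def)
qed

section \<open>Counting preimages sheet by sheet\<close>

lemma curve_surj_cut:
  assumes "w \<in> Delta1 lam \<union> Delta2 lam"
  obtains e where "ff e = 0" "0 \<le> Im e" "G e = w"
proof -
  obtain x where "w = complex_of_real x" "1 \<le> \<bar>x\<bar>" "\<bar>x\<bar> \<le> lam"
    using assms by (auto simp: Delta1_def Delta2_def)
  then show ?thesis using curve_surj that by metis
qed

text \<open>Over a point of the cuts two preimages, counted with multiplicity, lie on the ovals: a
  conjugate pair, or one real double point. Degree three leaves room for one more.\<close>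

lemma fibre_over_cut:
  assumes w: "w \<in> Delta1 lam \<union> Delta2 lam" and "ff u \<noteq> 0" "ff v \<noteq> 0" "u\<^sup>2 \<noteq> 1" "v\<^sup>2 \<noteq> 1" "G u = w" "G v = w"
  shows "u = v"
proof -
  obtain e where e: "ff e = 0" "0 \<le> Im e" "G e = w" using curve_surj_cut[OF w] .
  have e1: "e\<^sup>2 \<noteq> 1" using ff_pole[of e] e by auto
  have ne: "u \<noteq> e" "v \<noteq> e" "u \<noteq> cnj e" "v \<noteq> cnj e" using e cnj_curve[of e] assms by auto
  show ?thesis
  proof (cases "Im e = 0")
    case True
    show ?thesis using fibre_double[OF e(1) True, of u v] assms ne e by auto
  next
    case False
    have "w \<in> \<real>" using e curve_G_real[OF e(1)] by (metis Reals_of_real)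
    then have "G (cnj e) = w" using e by (simp add: G_cnj Reals_cnj_iff)
    moreover have "e \<noteq> cnj e" using False by (auto simp: complex_eq_iff)
    moreover have "(cnj e)\<^sup>2 \<noteq> 1" using ff_pole[of "cnj e"] e(1) cnj_curve[of e] by auto
    ultimately have "v \<in> {e, cnj e, u}"
      using fibre_card_le_3[of e "cnj e" u v w] assms e e1 ne by auto
    then show ?thesis using ne by auto
  qed
qed

lemma OmD: "u \<in> Om k \<Longrightarrow> ff u \<noteq> 0" "u \<in> Om k \<Longrightarrow> sheet u = k"
  by (auto simp: Om_def)

text \<open>If \<open>G u\<close> lay on a cut of its own sheet, surjectivity of a sheet without
  that cut would give a second preimage off the ovals, in a different region.\<close>

lemma Om_avoids_cut:
  assumes u: "u \<in> Om k" "u\<^sup>2 \<noteq> 1" shows "G u \<notin> cutset lam k"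
proof
  assume w: "G u \<in> cutset lam k"
  have k: "k \<le> 2" using u sheet_le_2 OmD by metis
  have disj: "Delta1 lam \<inter> Delta2 lam = {}" by (auto simp: Delta1_def Delta2_def)
  \<comment> \<open>The sheet without the cut in question: sheet 2 for \<open>Delta1\<close>, sheet
    0 for \<open>Delta2\<close>.\<close>
  obtain m where m: "m \<le> 2" "m \<noteq> k" "G u \<notin> cutset lam m"
  proof (cases "G u \<in> Delta1 lam")
    case True
    then show ?thesis using w k disj by (intro that[of 2]) (auto simp: cutset_def split: if_splits)
  next
    case False
    then show ?thesis using w by (intro that[of 0]) (auto simp: cutset_def split: if_splits)
  qed
  obtain v where v: "v \<in> Om m" "v\<^sup>2 \<noteq> 1" "G v = G u" using sheet_surj[OF m(1,3)] .
  have "G u \<in> Delta1 lam \<union> Delta2 lam" using w by (auto simp: cutset_def split: if_splits)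
  then have "u = v" using fibre_over_cut[of "G u" u v] u v OmD(1) by auto
  then show False using u v m(2) OmD(2) by metis
qed

text \<open>Over the cuts this is \<open>fibre_over_cut\<close>. Elsewhere each of the other two
  sheets contributes a preimage, and degree three leaves one for sheet k.\<close>

lemma sheet_inj:
  assumes u: "u \<in> Om k" "u\<^sup>2 \<noteq> 1" and v: "v \<in> Om k" "v\<^sup>2 \<noteq> 1" and eq: "G u = G v"
  shows "u = v"
proof (cases "G u \<in> Delta1 lam \<union> Delta2 lam")
  case True
  then show ?thesis
    by (rule fibre_over_cut) (use OmD(1)[OF u(1)] OmD(1)[OF v(1)] u(2) v(2) eq in simp_all)
next
  case False
  then have nc: "G u \<notin> cutset lam m" for m by (auto simp: cutset_def)
  have k: "k \<le> 2" using u sheet_le_2 OmD by metis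
  then obtain m n :: nat where mn: "m \<le> 2" "n \<le> 2" "m \<noteq> n" "m \<noteq> k" "n \<noteq> k"
  proof -
    consider "k = 0" | "k = 1" | "k = 2" using k by linarith
    then show ?thesis
    proof cases
      case 1
      then show ?thesis using that[of 1 2] by simp
    next
      case 2
      then show ?thesis using that[of 0 2] by simp
    next
      case 3
      then show ?thesis using that[of 0 1] by simp
    qed
  qed
  obtain p where p: "p \<in> Om m" "p\<^sup>2 \<noteq> 1" "G p = G u" using sheet_surj[OF mn(1) nc] .
  obtain q where q: "q \<in> Om n" "q\<^sup>2 \<noteq> 1" "G q = G u" using sheet_surj[OF mn(2) nc] .
  have ne: "p \<noteq> q" "p \<noteq> u" "q \<noteq> u" "p \<noteq> v" "q \<noteq> v" using OmD(2) p(1) q(1) u(1) v(1) mn by metis+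
  have "v \<in> {p, q, u}" by (rule fibre_card_le_3[of p q u v "G u"]) (use u v p q eq ne in simp_all)
  then show ?thesis using ne by blast
qed

section \<open>The homeomorphism of the sphere onto the surface\<close>

text \<open>The bank of a point of an oval is read off from the sign of \<open>Im G\<close> on its two sides, which is
  \<open>sgn (Im u) * sgn (ff u)\<close>; the outside \<open>ff > 0\<close> is sheet 1, hence the factor \<open>Re u\<close>.\<close>

definition g :: "complex option \<Rightarrow> rpt" where
  "g z = (case z of None \<Rightarrow> Reg 1 None
     | Some u \<Rightarrow> if ff u \<noteq> 0 then Reg (sheet u) (G_sph a (Some u))
        else if Im u = 0 then Br (Re (G u))
        else Cut (if Re u < 0 then 1 else 2) (0 < Re u * Im u) (Re (G u)))"

text \<open>The region of a sheet as a subset of the sphere. With infinity added to sheet 1, each of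
  the three regions contains exactly one point over infinity.\<close>

definition sOm :: "nat \<Rightarrow> complex option set" where
  "sOm k = (if k = 1 then insert None (Some ` Om 1) else Some ` Om k)"

lemma openin_sOm: "openin sphere_top (sOm k)"
proof (cases "k = 1")
  case True
  have "\<forall>z. 2 < norm z \<longrightarrow> z \<in> Om 1" using ff_large Om_eq(2) by blast
  then show ?thesis using True open_Om[of 1]
    by (auto simp: sOm_def openin_sphere_top vimage_insert_None)
next
  case False
  then show ?thesis using open_Om[of k] by (auto simp: sOm_def openin_sphere_top inj_vimage_image_eq)
qed

lemma g_simps:
  "g None = Reg 1 None"
  "ff u \<noteq> 0 \<Longrightarrow> g (Some u) = Reg (sheet u) (G_sph a (Some u))"
  "ff u = 0 \<Longrightarrow> Im u = 0 \<Longrightarrow> g (Some u) = Br (Re (G u))"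
  "ff u = 0 \<Longrightarrow> Im u \<noteq> 0 \<Longrightarrow> g (Some u) = Cut (if Re u < 0 then 1 else 2) (0 < Re u * Im u) (Re (G u))"
  by (simp_all add: g_def)

lemma g_eq_Reg_iff: "g z = Reg k W \<longleftrightarrow> z \<in> sOm k \<and> G_sph a z = W"
  by (cases z) (auto simp: g_def sOm_def Om_def)

lemma sOm_cases: "(\<exists>k\<le>2. z \<in> sOm k) \<or> (\<exists>u. z = Some u \<and> ff u = 0)"
  using sheet_le_2 by (cases z) (auto simp: sOm_def Om_def)

lemma proj_g: "proj (g z) = G_sph a z"
proof (cases z)
  case (Some u)
  have "u\<^sup>2 \<noteq> 1" if "ff u = 0" using that ff_pole[of u] by auto
  then show ?thesis using Some curve_G_real[of u] by (auto simp: g_def G_sph_Some)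
qed (simp add: g_def)

lemma curve_cut_int: "ff u = 0 \<Longrightarrow> Im u \<noteq> 0 \<Longrightarrow> Re (G u) \<in> cut_int lam (if Re u < 0 then 1 else 2)"
  using curve_G_bounds[of u] curve_Re[of u] by (auto simp: cut_int_def sgn_if split: if_splits)

lemma curve_cut_ends: "ff u = 0 \<Longrightarrow> Im u = 0 \<Longrightarrow> Re (G u) \<in> cut_ends lam (if Re u < 0 then 1 else 2)"
  using curve_G_bounds[of u] curve_Re[of u] by (auto simp: cut_ends_def sgn_if split: if_splits)

lemma pole_sheet: "u\<^sup>2 = 1 \<Longrightarrow> u = 1 \<and> u \<in> Om 2 \<or> u = -1 \<and> u \<in> Om 0"
  using ff_pole[of u] by (auto simp: power2_eq_1_iff Om_eq)

lemma sOm_inj: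
  assumes "x \<in> sOm k" "y \<in> sOm k" "G_sph a x = G_sph a y" shows "x = y"
proof (cases "G_sph a x")
  case None
  have pole: "z = (if k = 1 then None else if k = 0 then Some (-1) else Some 1)" if "z \<in> sOm k" "G_sph a z = None" for z
  proof (cases z)
    case None
    then show ?thesis using that by (auto simp: sOm_def split: if_splits)
  next
    case (Some u)
    then have "u\<^sup>2 = 1" "u \<in> Om k" using that by (auto simp: G_sph_Some sOm_def split: if_splits)
    then show ?thesis using pole_sheet[of u] Some by (auto simp: Om_def)
  qed
  show ?thesis using pole[of x] pole[of y] None assms by simp
next
  case (Some w)
  obtain u v where "x = Some u" "y = Some v" using Some assms(3) by (cases x; cases y) auto
  then show ?thesis using sheet_inj[of u k v] Some assms by (auto simp: sOm_def G_sph_Some split: if_splits)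
qed

lemma inj_g: "inj g"
proof (rule injI)
  fix x y assume eq: "g x = g y"
  have curve: "x = y" if u: "x = Some u" "ff u = 0" "g x = g y" for x y u
  proof -
    have "g x \<noteq> Reg k W" for k W using u(1,2) by (cases "Im u = 0") (simp_all add: g_simps)
    then obtain v where v: "y = Some v" "ff v = 0" using u(3) sOm_cases[of y] g_eq_Reg_iff by metis
    have "Re (G u) = Re (G v)" using u v by (auto simp: g_def split: if_splits)
    then have "G u = G v" using curve_G_real u v by metis
    note R = curve_inj[OF u(2) v(2) this]
    \<comment> \<open>G identifies conjugate points of an oval; the bank, which flips with the sign
      of Im u, tells them apart.\<close>
    moreover have "(0 < Re u * Im u) = (0 < Re v * Im v)" if "Im u \<noteq> 0"
      using that u v R by (auto simp: g_def split: if_splits)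
    ultimately have "Im u = Im v" using curve_Re(1)[OF u(2)]
      by (auto simp: zero_less_mult_iff abs_if split: if_splits)
    then show ?thesis using u v R by (auto intro: complex_eqI)
  qed
  show "x = y"
  proof (cases "\<exists>u. x = Some u \<and> ff u = 0")
    case True
    then show ?thesis using curve eq by blast
  next
    case False
    then obtain k where k: "x \<in> sOm k" using sOm_cases by blast
    then have "g y = Reg k (G_sph a x)" using eq g_eq_Reg_iff by metis
    then show ?thesis using sOm_inj[OF k] g_eq_Reg_iff by metis
  qed
qed

lemma range_g: "range g = R_set lam"
proof
  show "range g \<subseteq> R_set lam"
  proof clarify
    fix z
    show "g z \<in> R_set lam"
      using sOm_cases[of z]
    proof (elim disjE exE conjE)
      fix k assume k: "k \<le> 2" "z \<in> sOm k"
      then have gz: "g z = Reg k (G_sph a z)" using g_eq_Reg_iff by blast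
      show ?thesis
      proof (cases "G_sph a z")
        case None
        then show ?thesis using gz k by (auto simp: R_set_def)
      next
        case (Some w)
        then obtain u where "z = Some u" by (cases z) auto
        then have "w \<notin> cutset lam k" using Om_avoids_cut[of u k] k Some by (auto simp: G_sph_Some sOm_def split: if_splits)
        then show ?thesis using gz k Some by (auto simp: R_set_def)
      qed
    next
      fix u assume u: "z = Some u" "ff u = 0"
      have j: "(if Re u < 0 then 1 else 2) \<in> {1, 2::nat}" by simp
      show ?thesis
      proof (cases "Im u = 0")
        case True
        then have gz: "g z = Br (Re (G u))" using u by (simp add: g_simps)
        show ?thesis using curve_cut_ends[OF u(2) True] j unfolding R_set_def gz by blast
      next
        case False
        then have gz: "g z = Cut (if Re u < 0 then 1 else 2) (0 < Re u * Im u) (Re (G u))"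
          using u by (simp add: g_simps)
        show ?thesis using curve_cut_int[OF u(2) False] j unfolding R_set_def gz by blast
      qed
    qed
  qed
next
  show "R_set lam \<subseteq> range g"
  proof
    fix p assume "p \<in> R_set lam"
    then show "p \<in> range g"
    proof (cases rule: R_set_cases)
      case (Reg k w)
      obtain u where "u \<in> Om k" "u\<^sup>2 \<noteq> 1" "G u = w" using sheet_surj[OF Reg(2,3)] .
      then have "g (Some u) = p" using Reg by (auto simp: g_eq_Reg_iff G_sph_Some sOm_def)
      then show ?thesis by blast
    next
      case (Inf k)
      have "-1 \<in> Om 0" "1 \<in> Om 2" using ff_pole[of 1] ff_pole[of "-1"] by (auto simp: Om_eq)
      then have "g (if k = 1 then None else if k = 0 then Some (-1) else Some 1) = p"
        using Inf by (auto simp: g_eq_Reg_iff G_sph_Some sOm_def le_Suc_eq numeral_2_eq_2)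
      then show ?thesis by blast
    next
      case (Cut j b x)
      have xb: "1 < \<bar>x\<bar>" "\<bar>x\<bar> < lam" "x < 0 \<longleftrightarrow> j = 1" using Cut by (auto simp: cut_int_def split: if_splits)
      obtain u where u: "ff u = 0" "0 \<le> Im u" "G u = complex_of_real x" using curve_surj[of x] xb by auto
      have im: "0 < Im u" using curve_G_bounds(3)[OF u(1)] u xb by auto
      have re: "Re u < 0 \<longleftrightarrow> j = 1" "Re u \<noteq> 0" using curve_Re[OF u(1)] u xb by (auto simp: sgn_if split: if_splits)
      have u': "ff (cnj u) = 0" "G (cnj u) = complex_of_real x" using u by (simp_all add: cnj_curve G_cnj)
      \<comment> \<open>As Im u > 0, the bank of \<open>u\<close> is \<open>0 < Re u\<close> and
        that of \<open>cnj u\<close> is its negation, so exactly one of them has bank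
        \<open>b\<close>.\<close>
      have "g (Some (if b = (0 < Re u) then u else cnj u)) = p"
        using u u' im re Cut by (auto simp: g_simps zero_less_mult_iff)
      then show ?thesis by blast
    next
      case (Br j x)
      have xb: "\<bar>x\<bar> = 1 \<or> \<bar>x\<bar> = lam" using Br lam by (auto simp: cut_ends_def split: if_splits)
      then have "1 \<le> \<bar>x\<bar>" "\<bar>x\<bar> \<le> lam" using lam by auto
      then obtain u where u: "ff u = 0" "0 \<le> Im u" "G u = complex_of_real x" using curve_surj by blast
      then have "Im u = 0" using curve_G_bounds(3)[OF u(1)] xb by auto
      then have "g (Some u) = p" using u Br by (simp add: g_simps)
      then show ?thesis by blast
    qed
  qed
qed

lemma openin_G_preimage: "openin sphere_top V \<Longrightarrow> openin sphere_top (G_sph a -` V)"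
  using continuous_G_sph by (simp add: continuous_map vimage_def)

lemma openin_Some_image: "open U \<Longrightarrow> openin sphere_top (Some ` U)"
  by (auto simp: openin_sphere_top inj_vimage_image_eq)

lemma sgn_Im_G: assumes "u\<^sup>2 \<noteq> 1" shows "sgn (Im (G u)) = sgn (Im u) * sgn (ff u)"
proof -
  have "sgn (h * Im (G u) * (norm (u\<^sup>2 - 1))\<^sup>2) = sgn (Im (G u))" using h_pos assms by (simp add: sgn_mult)
  then show ?thesis unfolding Im_hG[OF assms] by (simp add: sgn_mult)
qed

lemma Im_G_pos_iff: "u\<^sup>2 \<noteq> 1 \<Longrightarrow> Im (G u) > 0 \<longleftrightarrow> Im u > 0 \<and> ff u > 0 \<or> Im u < 0 \<and> ff u < 0"
  and Im_G_neg_iff: "u\<^sup>2 \<noteq> 1 \<Longrightarrow> Im (G u) < 0 \<longleftrightarrow> Im u < 0 \<and> ff u > 0 \<or> Im u > 0 \<and> ff u < 0"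
  using sgn_Im_G[of u] by (auto simp: sgn_if split: if_splits)

text \<open>The regions of sheets j - 1 and j together with the oval between them: an open set that
  serves as the preimage of a neighbourhood of cut j.\<close>

definition around_cut :: "nat \<Rightarrow> complex set" where
  "around_cut j = {u. ff u > 0 \<or> (if j = 1 then Re u < 0 else Re u > 0)}"

lemma open_around_cut: "open (around_cut j)"
  unfolding around_cut_def
  by (cases "j = 1") (simp_all add: open_Collect_disj open_Collect_less continuous_intros)

lemma sheet_around_cut: "j \<in> {1, 2} \<Longrightarrow> ff u \<noteq> 0 \<Longrightarrow> u \<in> around_cut j \<longleftrightarrow> sheet u \<in> {j - 1, j}"
  using ff_imaginary[of u] by (cases "Re u" "0::real" rule: linorder_cases) (auto simp: around_cut_def sheet_def)

lemma curve_around_cut: "j \<in> {1, 2} \<Longrightarrow> ff u = 0 \<Longrightarrow> u \<in> around_cut j \<longleftrightarrow> (if Re u < 0 then 1 else 2) = j"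
  using curve_Re(1)[of u] by (auto simp: around_cut_def)

lemma G_sph_in_ball: "G_sph a (Some u) \<in> Some ` ball w r \<longleftrightarrow> u\<^sup>2 \<noteq> 1 \<and> dist (G u) w < r"
  by (auto simp: G_sph_Some dist_commute)

text \<open>Only generators have to be examined. Each preimage is an open subset of the sphere
  intersected with a preimage under \<open>G_sph a\<close>, so continuity of the cubic finishes the
  argument.\<close>

lemma continuous_g: "continuous_map sphere_top (R_top lam) g"
  unfolding R_top_def
proof (rule continuous_on_generated_topo)
  show "g ` topspace sphere_top \<subseteq> \<Union> (R_sub lam)"
    using range_g topspace_R_top[OF lam] by (simp add: R_top_def)
  fix U assume "U \<in> R_sub lam"
  then consider (Reg) k V where "U = reg_nbhd k V" "open V"
    | (Inf) k r where "U = inf_nbhd k r"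
    | (Cut) j b x r where "U = cut_nbhd j b x r" "j \<in> {1,2}" "{y. \<bar>y - x\<bar> < r} \<subseteq> cut_int lam j"
    | (Br) j e r where "U = branch_nbhd lam j e r" "j \<in> {1,2}" "e \<in> cut_ends lam j" "0 < r" "r \<le> lam - 1" "r \<le> 1"
    unfolding R_sub_eq by blast
  then have "openin sphere_top (g -` U)"
  proof cases
    case (Reg k V)
    have "g -` U = sOm k \<inter> G_sph a -` (Some ` V)"
      unfolding Reg reg_nbhd_def by (auto simp: g_eq_Reg_iff)
    then show ?thesis using openin_sOm openin_G_preimage[OF openin_Some_image[OF Reg(2)]] by auto
  next
    case (Inf k r)
    have "openin sphere_top (insert None (Some ` {w. r < norm w}))"
      unfolding sphere_top_def by (intro topology_generated_by_Basis) blast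
    moreover have "g -` U = sOm k \<inter> G_sph a -` (insert None (Some ` {w. r < norm w}))"
      unfolding Inf inf_nbhd_def by (auto simp: g_eq_Reg_iff)
    ultimately show ?thesis using openin_sOm openin_G_preimage by auto
  next
    case (Cut j b x r)
    \<comment> \<open>The half plane follows from \<open>sgn_Im_G\<close>. Bank True means Im G > 0
      on sheet j - 1; for j = 1 this sheet has ff < 0, so Im u < 0, while for j = 2 it has ff > 0,
      so Im u > 0. Crossing the oval flips the sign of \<open>ff\<close>, and with it that of Im G,
      in accordance with the crosswise gluing.\<close>
    define N where "N = around_cut j \<inter> {u. if b = (j = 1) then Im u < 0 else Im u > 0}"
    have "open {u. Im u < 0}" "open {u. Im u > 0}" by (intro open_Collect_less continuous_intros)+
    then have "open N" unfolding N_def using open_around_cut by (cases "b = (j = 1)") auto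
    moreover have "g -` U = Some ` N \<inter> G_sph a -` (Some ` ball (complex_of_real x) r)"
    proof (rule set_eqI)
      fix z
      show "z \<in> g -` U \<longleftrightarrow> z \<in> Some ` N \<inter> G_sph a -` (Some ` ball (complex_of_real x) r)"
      proof (cases z)
        case None
        then show ?thesis by (auto simp: g_simps Cut cut_nbhd_def)
      next
        case (Some u)
        have rhs: "z \<in> Some ` N \<inter> G_sph a -` (Some ` ball (complex_of_real x) r) \<longleftrightarrow>
          u \<in> N \<and> u\<^sup>2 \<noteq> 1 \<and> dist (G u) x < r" using G_sph_in_ball[of u x r] by (auto simp: Some)
        consider "u\<^sup>2 = 1" | "u\<^sup>2 \<noteq> 1" "ff u \<noteq> 0" | "ff u = 0" "Im u = 0" | "ff u = 0" "Im u \<noteq> 0" by blast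
        then show ?thesis
        proof cases
          case 1
          then have "ff u \<noteq> 0" using ff_pole[of u] by auto
          then have "g z = Reg (sheet u) None" using 1 by (simp add: Some g_simps G_sph_Some)
          then show ?thesis unfolding rhs using 1 by (auto simp: Cut cut_nbhd_def)
        next
          case 2
          then have gz: "g z = Reg (sheet u) (Some (G u))" by (simp add: Some g_simps G_sph_Some)
          have "g z \<in> U \<longleftrightarrow> dist (G u) x < r \<and> (sheet u = j - 1 \<and> (if b then Im (G u) > 0 else Im (G u) < 0)
              \<or> sheet u = j \<and> (if b then Im (G u) < 0 else Im (G u) > 0))"
            unfolding gz Cut cut_nbhd_def by auto
          also have "\<dots> \<longleftrightarrow> dist (G u) x < r \<and> u \<in> N"
            unfolding N_def Im_G_pos_iff[OF 2(1)] Im_G_neg_iff[OF 2(1)] using Cut(2) 2 sheet_around_cut[OF Cut(2) 2(2)]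
            by (auto simp: sheet_def split: if_splits)
          finally show ?thesis unfolding rhs using 2 by auto
        next
          case 3
          then show ?thesis unfolding rhs by (auto simp: Some g_simps Cut cut_nbhd_def N_def split: if_splits)
        next
          case 4
          have u1: "u\<^sup>2 \<noteq> 1" using 4 ff_pole[of u] by auto
          have "dist (G u) x = \<bar>Re (G u) - x\<bar>"
            using curve_G_real[OF 4(1)] by (metis dist_of_real dist_real_def)
          moreover have "g z \<in> U \<longleftrightarrow> (if Re u < 0 then 1 else 2) = j \<and> (0 < Re u * Im u) = b \<and> \<bar>Re (G u) - x\<bar> < r"
            using 4 by (auto simp: Some g_simps Cut cut_nbhd_def)
          moreover have "(if Re u < 0 then 1 else 2) = j \<and> (0 < Re u * Im u) = b \<longleftrightarrow> u \<in> N"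
            unfolding N_def Int_iff curve_around_cut[OF Cut(2) 4(1)] using 4(2) curve_Re(1)[OF 4(1)]
            by (auto simp: zero_less_mult_iff)
          ultimately show ?thesis unfolding rhs using u1 by auto
        qed
      qed
    qed
    ultimately show ?thesis using openin_G_preimage[OF openin_Some_image] openin_Some_image by auto
  next
    case (Br j e r)
    have "g -` U = Some ` around_cut j \<inter> G_sph a -` (Some ` ball (complex_of_real e) r)"
    proof (rule set_eqI)
      fix z
      show "z \<in> g -` U \<longleftrightarrow> z \<in> Some ` around_cut j \<inter> G_sph a -` (Some ` ball (complex_of_real e) r)"
      proof (cases z)
        case None
        then show ?thesis by (auto simp: g_simps Br branch_nbhd_def)
      next
        case (Some u)
        have rhs: "z \<in> Some ` around_cut j \<inter> G_sph a -` (Some ` ball (complex_of_real e) r) \<longleftrightarrow>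
          u \<in> around_cut j \<and> u\<^sup>2 \<noteq> 1 \<and> dist (G u) e < r" using G_sph_in_ball[of u e r] by (auto simp: Some)
        consider "u\<^sup>2 = 1" | "u\<^sup>2 \<noteq> 1" "ff u \<noteq> 0" | "ff u = 0" "Im u = 0" | "ff u = 0" "Im u \<noteq> 0" by blast
        then show ?thesis
        proof cases
          case 1
          then have "ff u \<noteq> 0" using ff_pole[of u] by auto
          then have "g z = Reg (sheet u) None" using 1 by (simp add: Some g_simps G_sph_Some)
          then show ?thesis unfolding rhs using 1 by (auto simp: Br branch_nbhd_def)
        next
          case 2
          then have gz: "g z = Reg (sheet u) (Some (G u))" by (simp add: Some g_simps G_sph_Some)
          \<comment> \<open>This disposes of the condition \<open>w \<notin> Dcut lam j\<close> in
            the branch neighbourhood, which has no counterpart on the side of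
            \<open>around_cut\<close>.\<close>
          have "G u \<notin> cutset lam (sheet u)" using Om_avoids_cut[of u "sheet u"] 2 by (auto simp: Om_def)
          then have "sheet u \<in> {j - 1, j} \<Longrightarrow> G u \<notin> Dcut lam j" using Br(2) by (auto simp: cutset_def Dcut_def)
          then have "g z \<in> U \<longleftrightarrow> dist (G u) e < r \<and> sheet u \<in> {j - 1, j}"
            unfolding gz Br branch_nbhd_def by auto
          then show ?thesis unfolding rhs using 2 sheet_around_cut[OF Br(2) 2(2)] by auto
        next
          case 3
          have u1: "u\<^sup>2 \<noteq> 1" using 3 ff_pole[of u] by auto
          have d: "dist (G u) e = \<bar>Re (G u) - e\<bar>"
            using curve_G_real[OF 3(1)] by (metis dist_of_real dist_real_def)
          have lhs: "g z \<in> U \<longleftrightarrow> Re (G u) = e"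
            using 3 by (auto simp: Some g_simps Br branch_nbhd_def)
          have "Re (G u) = e \<longleftrightarrow> (if Re u < 0 then 1 else 2) = j \<and> \<bar>Re (G u) - e\<bar> < r"
          proof -
            have sign: "x < 0 \<longleftrightarrow> i = 1" if "x \<in> cut_ends lam i" for x i
              using that lam by (auto simp: cut_ends_def split: if_splits)
            \<comment> \<open>The endpoints of a cut are lam - 1 apart, so the radius bound admits
              only the centre.\<close>
            have sep: "x = y" if "x \<in> cut_ends lam i" "y \<in> cut_ends lam i" "\<bar>x - y\<bar> < lam - 1" for x y i
              using that by (auto simp: cut_ends_def split: if_splits)
            let ?i = "if Re u < 0 then 1 else 2 :: nat"
            have "?i = 1 \<or> ?i = 2" "j = 1 \<or> j = 2" using Br(2) by auto
            then have "?i = j" if "Re (G u) = e"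
              using sign[OF curve_cut_ends[OF 3]] sign[OF Br(3)] that by metis
            moreover have "Re (G u) = e" if "?i = j" "\<bar>Re (G u) - e\<bar> < r"
              using sep[of "Re (G u)" j e] curve_cut_ends[OF 3] Br(3,5) that by simp
            ultimately show ?thesis using Br(4) by auto
          qed
          then show ?thesis unfolding rhs using u1 lhs d curve_around_cut[OF Br(2) 3(1)] by auto
        next
          case 4
          have u1: "u\<^sup>2 \<noteq> 1" using 4 ff_pole[of u] by auto
          have d: "dist (G u) e = \<bar>Re (G u) - e\<bar>"
            using curve_G_real[OF 4(1)] by (metis dist_of_real dist_real_def)
          have lhs: "g z \<in> U \<longleftrightarrow> (if Re u < 0 then 1 else 2) = j \<and> \<bar>Re (G u) - e\<bar> < r"
            using 4 curve_cut_int[OF 4] by (auto simp: Some g_simps Br branch_nbhd_def)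
          then show ?thesis unfolding rhs using u1 lhs d curve_around_cut[OF Br(2) 4(1)] by auto
        qed
      qed
    qed
    then show ?thesis using openin_G_preimage[OF openin_Some_image] openin_Some_image[OF open_around_cut] by auto
  qed
  then show "openin sphere_top (g -` U \<inter> topspace sphere_top)" by simp
qed

lemma homeomorphic_g: "homeomorphic_map sphere_top (R_top lam) g"
  using continuous_g compact_space_sphere_top Hausdorff_R_top[OF lam] inj_g range_g topspace_R_top[OF lam]
  by (intro continuous_imp_homeomorphic_map) auto

text \<open>The map written G^(-1) in the theorem. Off \<open>R_set lam\<close> its values are
  arbitrary.\<close>

abbreviation S :: "rpt \<Rightarrow> complex option" where "S \<equiv> inv_into UNIV g"

lemma S_g [simp]: "S (g z) = z"
  using inj_g by (rule inv_into_f_f) simp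

lemma g_S: "p \<in> R_set lam \<Longrightarrow> g (S p) = p"
  using range_g by (simp add: f_inv_into_f)

lemma homeomorphic_S: "homeomorphic_map (R_top lam) sphere_top S"
proof -
  obtain k where k: "homeomorphic_maps sphere_top (R_top lam) g k"
    using homeomorphic_g homeomorphic_map_maps by blast
  have "k p = S p" if "p \<in> topspace (R_top lam)" for p
    using k that by (metis S_g homeomorphic_maps_map)
  moreover have "homeomorphic_map (R_top lam) sphere_top k" using k homeomorphic_maps_map by blast
  ultimately show ?thesis using homeomorphic_map_eq by metis
qed

section \<open>The conformal maps\<close>

definition pole :: "nat \<Rightarrow> complex option" where
  "pole k = (if k = 1 then None else if k = 0 then Some (-1) else Some 1)"

text \<open>Punctured neighbourhoods of the point over infinity of sheet k. Asymptotics on that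
  sheet become statements along this filter under the substitution w = G z.\<close>

definition at_pole :: "nat \<Rightarrow> complex filter" where
  "at_pole k = (if k = 1 then at_infinity else if k = 0 then at (-1) else at 1)"

lemma pole_points_in_Om: "-1 \<in> Om 0" "1 \<in> Om 2"
  using ff_pole[of 1] ff_pole[of "-1"] by (auto simp: Om_eq)

lemma g_pole: assumes "k \<le> 2" shows "g (pole k) = Reg k None"
proof -
  have "k = 0 \<or> k = 1 \<or> k = 2" using assms by auto
  then show ?thesis using pole_points_in_Om by (auto simp: g_eq_Reg_iff pole_def sOm_def G_sph_Some)
qed

lemma S_infinity: "k \<le> 2 \<Longrightarrow> S (Reg k None) = pole k"
  using g_pole S_g by metis

lemma g_regular: "u \<in> Om k \<Longrightarrow> u\<^sup>2 \<noteq> 1 \<Longrightarrow> g (Some u) = Reg k (Some (G u))"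
  by (auto simp: g_eq_Reg_iff sOm_def G_sph_Some)

lemma S_regular:
  assumes "k \<le> 2" "w \<notin> cutset lam k"
  obtains u where "S (Reg k (Some w)) = Some u" "u \<in> Om k" "u\<^sup>2 \<noteq> 1" "G u = w"
proof -
  obtain u where "u \<in> Om k" "u\<^sup>2 \<noteq> 1" "G u = w" using sheet_surj[OF assms] .
  then show ?thesis using that g_regular S_g by metis
qed

text \<open>On the region of sheet k without its pole G is injective and holomorphic, and
  \<open>S\<close> on that sheet is its holomorphic inverse.\<close>

lemma sph_holo_at_S_finite:
  assumes k: "k \<le> 2" and w: "w \<notin> cutset lam k"
  shows "sph_holo_at (\<lambda>u. S (Reg k (Some u))) w"
proof -
  define X where "X = Om k \<inter> {u. u\<^sup>2 \<noteq> 1}"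
  have X: "open X" "G holomorphic_on X" "inj_on G X"
    unfolding X_def using open_Om open_sq_ne_1 sheet_inj by (auto intro!: G_holomorphic_subset inj_onI)
  obtain q where q: "q holomorphic_on G ` X" "\<And>z. z \<in> X \<Longrightarrow> q (G z) = z"
    using holomorphic_has_inverse[OF X(2,1,3)] by metis
  have GX: "u \<in> G ` X" "S (Reg k (Some u)) = Some (q u)" if u: "u \<notin> cutset lam k" for u
  proof -
    obtain v where "S (Reg k (Some u)) = Some v" "v \<in> Om k" "v\<^sup>2 \<noteq> 1" "G v = u" using S_regular[OF k u] .
    then show "u \<in> G ` X" "S (Reg k (Some u)) = Some (q u)" using q(2)[of v] by (auto simp: X_def)
  qed
  show ?thesis
  proof (rule sph_holo_atI)
    show "open (- cutset lam k)" using closed_cutset by blast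
    have "q holomorphic_on - cutset lam k" using GX by (intro holomorphic_on_subset[OF q(1)]) auto
    then show "(\<lambda>u. the (S (Reg k (Some u)))) holomorphic_on - cutset lam k"
      by (rule holomorphic_transform) (simp add: GX)
  qed (use w GX in auto)
qed

lemma limitin_R_top_zero:
  assumes "k \<le> 2"
  shows "limitin (R_top lam) (\<lambda>u. Reg k (if u = 0 then None else Some (inverse u))) (Reg k None) (at 0)"
  unfolding limitin_def
proof (intro conjI allI impI)
  show "Reg k None \<in> topspace (R_top lam)" by (rule limitin_topspace[OF limitin_R_top_infinity[OF lam assms]])
next
  fix V assume "openin (R_top lam) V \<and> Reg k None \<in> V"
  then have "eventually (\<lambda>w. Reg k (Some w) \<in> V) at_infinity"
    using limitin_R_top_infinity[OF lam assms] unfolding limitin_def by blast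
  then have "eventually (\<lambda>u. Reg k (Some (inverse u)) \<in> V) (at 0)"
    using filterlim_inverse_at_infinity filterlim_iff by blast
  moreover have "eventually (\<lambda>u::complex. u \<noteq> 0) (at 0)" by (simp add: eventually_at_filter)
  ultimately show "eventually (\<lambda>u. Reg k (if u = 0 then None else Some (inverse u)) \<in> V) (at 0)"
    by eventually_elim simp
qed

lemma inverse_notin_cutset:
  assumes "u \<in> ball 0 (1 / lam)" "u \<noteq> 0" shows "inverse u \<notin> cutset lam k"
proof
  assume "inverse u \<in> cutset lam k"
  then have "norm (inverse u) \<le> lam" using cutset_norm_le[OF lam] by blast
  then have "norm (inverse u) * norm u \<le> lam * norm u" by (rule mult_right_mono) simp
  then have "1 \<le> lam * norm u" using assms(2) by (simp add: norm_inverse)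
  moreover have "lam * norm u < 1" using assms(1) lam by (simp add: field_simps)
  ultimately show False by simp
qed

lemma conformal_S: "conformal_R lam S"
  unfolding conformal_R_def
proof (intro conjI allI impI homeomorphic_S)
  fix k w assume "k \<le> (2::nat)" "w \<notin> cutset lam k"
  then show "sph_holo_at (\<lambda>u. S (Reg k (Some u))) w" by (rule sph_holo_at_S_finite)
next
  fix k :: nat assume k: "k \<le> 2"
  let ?E = "\<lambda>u. S (Reg k (if u = 0 then None else Some (inverse u)))"
  show "sph_holo_at ?E 0"
  proof (rule sph_holo_at_isolated)
    show "open (ball (0::complex) (1 / lam))" "0 \<in> ball (0::complex) (1 / lam)" using lam by auto
    fix u assume u: "u \<in> ball (0::complex) (1 / lam)" "u \<noteq> 0"
    have "sph_holo_at (\<lambda>v. S (Reg k (Some (inverse v)))) u"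
      by (rule sph_holo_at_compose[where S = "\<lambda>v. S (Reg k (Some v))" and G = inverse and U = "- {0}"])
        (use u sph_holo_at_S_finite[OF k inverse_notin_cutset[OF u]] in \<open>auto intro!: holomorphic_intros\<close>)
    then show "sph_holo_at ?E u" by (rule sph_holo_at_cong[of _ _ "- {0}"]) (use u in auto)
  next
    \<comment> \<open>At infinity continuity is enough, because the point is an isolated singularity
      in the coordinate 1/w.\<close>
    have "continuous_map (R_top lam) sphere_top S" using homeomorphic_S homeomorphic_imp_continuous_map by blast
    from continuous_map_limit[OF this limitin_R_top_zero[OF k]]
    show "limitin sphere_top ?E (?E 0) (at 0)" by (simp add: o_def)
  qed
qed

lemma filterlim_S:
  assumes k: "k \<le> 2"
  shows "filterlim (\<lambda>w. the (S (Reg k (Some w)))) (at_pole k) at_infinity"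
proof -
  have "continuous_map (R_top lam) sphere_top S" using homeomorphic_S homeomorphic_imp_continuous_map by blast
  from continuous_map_limit[OF this limitin_R_top_infinity[OF lam k]]
  have lim: "limitin sphere_top (\<lambda>w. S (Reg k (Some w))) (pole k) at_infinity"
    using S_infinity[OF k] by (simp add: o_def)
  have ev: "eventually (\<lambda>w. S (Reg k (Some w)) \<noteq> None \<and> (the (S (Reg k (Some w))))\<^sup>2 \<noteq> 1) at_infinity"
    using eventually_notin_cutset[OF lam, of k]
  proof eventually_elim
    case (elim w)
    then show ?case by (rule S_regular[OF k]) simp
  qed
  show ?thesis
  proof (cases "k = 1")
    case True
    have "eventually (\<lambda>w. r < norm (the (S (Reg k (Some w))))) at_infinity" for r
      using lim ev True by (auto simp: limitin_sphere_None pole_def elim: eventually_elim2)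
    then have "filterlim (\<lambda>w. norm (the (S (Reg k (Some w))))) at_top at_infinity"
      by (simp add: filterlim_at_top_dense)
    then show ?thesis using True filterlim_norm_at_top_imp_at_infinity by (simp add: at_pole_def)
  next
    case False
    define p where "p = (if k = 0 then -1 else 1 :: complex)"
    have "((\<lambda>w. the (S (Reg k (Some w)))) \<longlongrightarrow> p) at_infinity"
      using lim False by (auto simp: pole_def p_def limitin_sphere_Some split: if_splits)
    \<comment> \<open>The filter \<open>at p\<close> is punctured, so convergence to
      \<open>p\<close> has to be complemented by avoiding it; points over finite values are never
      poles.\<close>
    moreover have "eventually (\<lambda>w. the (S (Reg k (Some w))) \<noteq> p) at_infinity"
      using ev by eventually_elim (auto simp: p_def)
    ultimately have "filterlim (\<lambda>w. the (S (Reg k (Some w)))) (at p) at_infinity" by (simp add: filterlim_at)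
    then show ?thesis using False by (simp add: at_pole_def p_def split: if_splits)
  qed
qed

lemma filterlim_G_at_pole: "filterlim G at_infinity (at_pole k)"
  unfolding at_pole_def using filterlim_G_infinity filterlim_G_pole by simp

lemma eventually_at_pole_sheet:
  assumes "k \<le> 2" shows "eventually (\<lambda>z. z \<in> Om k \<and> z\<^sup>2 \<noteq> 1) (at_pole k)"
proof (cases "k = 1")
  case True
  have "\<forall>z. 3 \<le> norm z \<longrightarrow> z \<in> Om 1 \<and> z\<^sup>2 \<noteq> 1"
    using ff_large ff_pole Om_eq(2) by (smt (verit) mem_Collect_eq)
  then show ?thesis using True by (auto simp: at_pole_def eventually_at_infinity)
next
  case False
  define p where "p = (if k = 0 then -1 else 1 :: complex)"
  have p: "p \<in> Om k" "at_pole k = at p" using False assms pole_points_in_Om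
    by (auto simp: p_def at_pole_def numeral_2_eq_2 le_Suc_eq)
  have "eventually (\<lambda>z. z \<in> Om k - {-p}) (at p)"
    using p(1) open_Om[of k] by (intro eventually_at_in_open') (auto simp: p_def)
  moreover have "eventually (\<lambda>z. z \<noteq> p) (at p)" by (simp add: eventually_at_filter)
  ultimately show ?thesis unfolding p(2)
    by eventually_elim (auto simp: power2_eq_1_iff p_def split: if_splits)
qed

section \<open>The Moebius maps and their asymptotics\<close>

definition d :: real where "d = (1 - a\<^sup>2)\<^sup>2 / (8 * a ^ 3)"

definition T :: "nat \<Rightarrow> complex \<Rightarrow> complex" where
  "T l z = (if l = 1 then complex_of_real (1 / h) * (z + 1) else complex_of_real d * ((z + 1) / (z - 1)))"

lemma d_pos: "0 < d"
  unfolding d_def using a_pos a2_bounds by simp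

text \<open>Hence 2 d = c / (2 h), which is the residue of G at 1 and at -1. Since d (z + 1) / (z -
  1) = d + 2 d / (z - 1), this is the scale at which the second Moebius map has the principal part
  of G at 1.\<close>

lemma d_h: "4 * d * h = c"
proof -
  have "d * (8 * a ^ 3) = (1 - a\<^sup>2)\<^sup>2" "h * (1 + a\<^sup>2) = 2 * a ^ 3" "c * (1 + a\<^sup>2) = (1 - a\<^sup>2)\<^sup>2"
    using a_pos a2_add_pos(2) by (simp_all add: d_def h_def c_def)
  then have "(1 + a\<^sup>2) * (4 * d * h - c) = 0" by algebra
  then show ?thesis using a2_add_pos(2) by simp
qed

lemma psi_formula_1: "psi_formula 1 a = sph_aff (complex_of_real (1 / h)) (complex_of_real (1 / h))"
proof
  fix z show "psi_formula 1 a z = sph_aff (complex_of_real (1 / h)) (complex_of_real (1 / h)) z"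
    by (cases z) (simp_all add: psi_formula_def sph_aff_def h_def distrib_left)
qed

lemma psi_formula_2:
  "psi_formula 2 a = (\<lambda>z. sph_aff (complex_of_real (2 * d)) (complex_of_real d) (sph_inv (sph_aff 1 (-1) z)))"
proof
  fix z
  show "psi_formula 2 a z = sph_aff (complex_of_real (2 * d)) (complex_of_real d) (sph_inv (sph_aff 1 (-1) z))"
  proof (cases z)
    case None
    then show ?thesis by (simp add: psi_formula_def sph_aff_def d_def)
  next
    case (Some u)
    show ?thesis
    proof (cases "u = 1")
      case True
      then show ?thesis using Some by (simp add: psi_formula_def sph_aff_def)
    next
      case False
      then have u: "u - 1 \<noteq> 0" by simp
      have "complex_of_real d * ((u + 1) / (u - 1)) = complex_of_real (2 * d) * inverse (u - 1) + complex_of_real d"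
        using u by (simp add: divide_simps) (simp add: algebra_simps)
      then show ?thesis using Some False u by (simp add: psi_formula_def sph_aff_def d_def[symmetric])
    qed
  qed
qed

lemma psi_formula_T: "l \<in> {1, 2} \<Longrightarrow> l = 1 \<or> z \<noteq> 1 \<Longrightarrow> psi_formula l a (Some z) = Some (T l z)"
  by (auto simp: psi_formula_def T_def h_def d_def)

lemma psi_formula_pole: "l \<in> {1, 2} \<Longrightarrow> psi_formula l a (pole l) = None"
  by (auto simp: psi_formula_def pole_def)

lemma homeomorphic_psi_formula:
  assumes "l \<in> {1, 2}" shows "homeomorphic_map sphere_top sphere_top (psi_formula l a)"
proof -
  have 1: "homeomorphic_map sphere_top sphere_top (psi_formula 1 a)"
    unfolding psi_formula_1 using h_pos by (intro homeomorphic_map_sph_aff) simp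
  have "homeomorphic_map sphere_top sphere_top
     (sph_aff (complex_of_real (2 * d)) (complex_of_real d) \<circ> (sph_inv \<circ> sph_aff 1 (-1)))"
    using d_pos
    by (intro homeomorphic_map_compose[OF homeomorphic_map_compose[OF homeomorphic_map_sph_aff homeomorphic_map_sph_inv]
          homeomorphic_map_sph_aff]) auto
  then have "homeomorphic_map sphere_top sphere_top (psi_formula 2 a)"
    unfolding psi_formula_2 by (simp add: o_def)
  then show ?thesis using 1 assms by auto
qed

lemma sph_holo_at_psi_formula:
  assumes "l \<in> {1, 2}" "sph_holo_at F w" shows "sph_holo_at (\<lambda>u. psi_formula l a (F u)) w"
proof -
  have "sph_holo_at (\<lambda>u. psi_formula 1 a (F u)) w"
    unfolding psi_formula_1 using assms(2) h_pos by (intro sph_holo_at_sph_aff) auto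
  moreover have "sph_holo_at (\<lambda>u. psi_formula 2 a (F u)) w"
    unfolding psi_formula_2 using assms(2) d_pos by (intro sph_holo_at_sph_aff sph_holo_at_sph_inv) auto
  ultimately show ?thesis using assms(1) by auto
qed

lemma G_partial_fractions:
  fixes z :: complex
  assumes "z\<^sup>2 \<noteq> 1"
  shows "G z = (z + complex_of_real (2 * d * h) / (z - 1) + complex_of_real (2 * d * h) / (z + 1)) / complex_of_real h"
proof -
  have z: "z - 1 \<noteq> 0" "z + 1 \<noteq> 0" using assms by (auto simp: power2_eq_1_iff eq_neg_iff_add_eq_0[symmetric])
  have c: "complex_of_real c = 2 * complex_of_real (2 * d * h)" unfolding d_h[symmetric] by simp
  have zz: "z\<^sup>2 - 1 = (z - 1) * (z + 1)" by (simp add: power2_eq_square algebra_simps)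
  have "c * z / (z\<^sup>2 - 1) = complex_of_real (2 * d * h) / (z - 1) + complex_of_real (2 * d * h) / (z + 1)"
    unfolding c zz using z by (simp add: divide_simps) (simp add: algebra_simps)
  then show ?thesis unfolding G_def H_eq by simp
qed



text \<open>The principal parts at the pole of sheet l cancel: z / h at infinity for l = 1, and 2 d
  / (z - 1) at 1 for l = 2. This is the normalisation psi = w + O(1) in the coordinate z.\<close>

lemma T_minus_G_bounded:
  assumes l: "l \<in> {1, 2}"
  shows "\<exists>B. eventually (\<lambda>z. norm (T l z - G z) \<le> B) (at_pole l)"
proof -
  define m where "m = complex_of_real (2 * d * h)"
  have h: "complex_of_real h \<noteq> 0" using h_pos by simp
  have sq: "eventually (\<lambda>z. z\<^sup>2 \<noteq> 1) (at_pole l)"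
    using eventually_at_pole_sheet[of l] l by (auto elim!: eventually_mono)
  from l consider "l = 1" | "l = 2" by auto
  then have "\<exists>L. ((\<lambda>z. T l z - G z) \<longlongrightarrow> L) (at_pole l)"
  proof cases
    case 1
    have "filterlim (\<lambda>z::complex. z + s) at_infinity at_infinity" for s
      by (rule tendsto_add_filterlim_at_infinity'[OF filterlim_ident tendsto_const])
    then have "((\<lambda>z. m / (z + s)) \<longlongrightarrow> 0) at_infinity" for s
      by (intro tendsto_divide_0[OF tendsto_const])
    from this[of "-1"] this[of 1]
    have "((\<lambda>z. (1 - m / (z - 1) - m / (z + 1)) / complex_of_real h) \<longlongrightarrow> (1 - 0 - 0) / complex_of_real h) at_infinity"
      using h by (intro tendsto_intros) auto
    moreover have "eventually (\<lambda>z. (1 - m / (z - 1) - m / (z + 1)) / complex_of_real h = T l z - G z) (at_pole l)"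
      using sq
    proof eventually_elim
      case (elim z)
      show ?case unfolding G_partial_fractions[OF elim] m_def[symmetric] using 1 h
        by (simp add: T_def diff_divide_distrib add_divide_distrib)
    qed
    ultimately show ?thesis using 1 by (auto simp: at_pole_def intro: Lim_transform_eventually)
  next
    case 2
    have "((\<lambda>z. complex_of_real d - (z + m / (z + 1)) / complex_of_real h) \<longlongrightarrow>
        complex_of_real d - (1 + m / (1 + 1)) / complex_of_real h) (at 1)"
      using h by (intro tendsto_intros) auto
    moreover have "eventually (\<lambda>z. complex_of_real d - (z + m / (z + 1)) / complex_of_real h = T l z - G z) (at_pole l)"
      using sq
    proof eventually_elim
      case (elim z)
      have z: "z - 1 \<noteq> 0" using elim by auto
      have "T l z = complex_of_real d + 2 * complex_of_real d / (z - 1)"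
        using 2 z by (simp add: T_def divide_simps) (simp add: algebra_simps)
      moreover have "m / (z - 1) / complex_of_real h = 2 * complex_of_real d / (z - 1)"
        using h by (simp add: m_def)
      ultimately show ?case unfolding G_partial_fractions[OF elim] m_def[symmetric]
        by (simp add: diff_divide_distrib add_divide_distrib)
    qed
    ultimately show ?thesis using 2 by (auto simp: at_pole_def intro: Lim_transform_eventually)
  qed
  then show ?thesis using tendsto_eventually_bounded by blast
qed

text \<open>Near \<open>-1\<close> we have \<open>G z = N z / (z + 1)\<close> and \<open>T l z = t z * (z + 1)\<close> with \<open>N\<close> and \<open>t\<close> holomorphic,
  so \<open>T l - C / G\<close> with \<open>C = t (-1) * N (-1)\<close> is a difference quotient of \<open>t * N\<close> times \<open>N / G^2\<close>.\<close>

lemma T_asymptotics_sheet_0: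
  assumes l: "l \<in> {1, 2}"
  shows "\<exists>C B. eventually (\<lambda>z. norm (T l z - C / G z) \<le> B * norm (1 / (G z)\<^sup>2)) (at_pole 0)"
proof -
  define m where "m = complex_of_real (2 * d * h)"
  define t where "t z = (if l = 1 then complex_of_real (1 / h) else complex_of_real d / (z - 1))" for z
  define N where "N z = ((z + 1) * (z + m / (z - 1)) + m) / complex_of_real h" for z
  define \<phi> where "\<phi> z = t z * N z" for z
  have h: "complex_of_real h \<noteq> 0" using h_pos by simp
  have t: "t field_differentiable at (-1)"
    unfolding t_def[abs_def] by (cases "l = 1") (auto intro!: derivative_intros)
  have N: "N field_differentiable at (-1)"
    unfolding N_def[abs_def] using h by (auto intro!: derivative_intros)
  then have "\<phi> field_differentiable at (-1)" unfolding \<phi>_def[abs_def] using t by (intro derivative_intros)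
  then obtain D where "((\<lambda>z. (\<phi> z - \<phi> (-1)) / (z - (-1))) \<longlongrightarrow> D) (at (-1))"
    by (auto simp: field_differentiable_def has_field_derivative_iff)
  moreover have "(N \<longlongrightarrow> N (-1)) (at (-1))"
    using N field_differentiable_imp_continuous_at isCont_def by blast
  ultimately have "((\<lambda>z. (\<phi> z - \<phi> (-1)) / (z - (-1)) * N z) \<longlongrightarrow> D * N (-1)) (at (-1))"
    by (intro tendsto_intros)
  then obtain B where B: "eventually (\<lambda>z. norm ((\<phi> z - \<phi> (-1)) / (z - (-1)) * N z) \<le> B) (at (-1))"
    using tendsto_eventually_bounded by blast
  have "eventually (\<lambda>z. 0 < norm (G z)) (at (-1))"
    by (rule filterlim_at_infinityD) (use filterlim_G_at_pole[of 0] in \<open>simp add: at_pole_def\<close>)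
  moreover have "eventually (\<lambda>z::complex. z\<^sup>2 \<noteq> 1) (at (-1))"
    using eventually_mono[OF eventually_at_pole_sheet[of 0], of "\<lambda>z. z\<^sup>2 \<noteq> 1"] by (simp add: at_pole_def)
  ultimately have "eventually (\<lambda>z. norm (T l z - \<phi> (-1) / G z) \<le> B * norm (1 / (G z)\<^sup>2)) (at (-1))"
    using B
  proof eventually_elim
    case (elim z)
    have z: "z - 1 \<noteq> 0" "z + 1 \<noteq> 0" using elim(2) by (auto simp: power2_eq_1_iff eq_neg_iff_add_eq_0[symmetric])
    have GN: "G z * (z + 1) = N z"
      unfolding G_partial_fractions[OF elim(2)] N_def m_def[symmetric] using z h
      by (simp add: divide_simps)
    have Tt: "T l z = t z * (z + 1)" using l by (auto simp: T_def t_def)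
    have G0: "G z \<noteq> 0" using elim(1) by auto
    have "T l z - \<phi> (-1) / G z = (\<phi> z - \<phi> (-1)) / G z"
      unfolding \<phi>_def[of z] Tt GN[symmetric] using G0 by (simp add: field_simps)
    also have "\<dots> = (\<phi> z - \<phi> (-1)) / (z - (-1)) * N z * (1 / (G z)\<^sup>2)"
      unfolding GN[symmetric] using z G0 by (simp add: divide_simps power2_eq_square)
    finally have "norm (T l z - \<phi> (-1) / G z) = norm ((\<phi> z - \<phi> (-1)) / (z - (-1)) * N z) * norm (1 / (G z)\<^sup>2)"
      by (simp only: norm_mult)
    then show ?case using elim(3) by (simp only: mult_right_mono norm_ge_zero)
  qed
  then show ?thesis by (auto simp: at_pole_def)
qed

section \<open>Holomorphy across the ovals and uniqueness\<close>

lemma G_locally_injective: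
  assumes z: "z\<^sup>2 \<noteq> 1" "Im z \<noteq> 0"
  obtains r where "r > 0" "inj_on G (ball z r)" "\<And>u. u \<in> ball z r \<Longrightarrow> u\<^sup>2 \<noteq> 1"
proof -
  have ne: "z\<^sup>2 - 1 \<noteq> 0" "complex_of_real h \<noteq> 0" using z h_pos by auto
  have "((\<lambda>z. (z + complex_of_real c * z / (z\<^sup>2 - 1)) / complex_of_real h) has_field_derivative
      (1 + (complex_of_real c * (z\<^sup>2 - 1) - complex_of_real c * z * (2 * z)) / ((z\<^sup>2 - 1) * (z\<^sup>2 - 1))) / complex_of_real h) (at z)"
    using ne by (auto intro!: derivative_eq_intros)
  then have der: "deriv G z = (1 + (complex_of_real c * (z\<^sup>2 - 1) - complex_of_real c * z * (2 * z)) / ((z\<^sup>2 - 1) * (z\<^sup>2 - 1))) / complex_of_real h"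
    unfolding G_def[abs_def] H_eq by (rule DERIV_imp_deriv)
  have "deriv G z \<noteq> 0"
  proof
    assume "deriv G z = 0"
    then have "(z\<^sup>2 - 1) * (z\<^sup>2 - 1) + (complex_of_real c * (z\<^sup>2 - 1) - complex_of_real c * z * (2 * z)) = 0"
      unfolding der using ne by (simp add: add_divide_eq_iff)
    moreover have "complex_of_real a ^ 2 + complex_of_real b ^ 2 = 2 + complex_of_real c"
      "complex_of_real a ^ 2 * complex_of_real b ^ 2 = 1 - complex_of_real c"
      using vieta_sum vieta_prod by (metis of_real_add of_real_power of_real_numeral, metis of_real_mult of_real_power of_real_diff of_real_1)
    \<comment> \<open>The numerator of the derivative is z^4 - (2 + c) z^2 + (1 - c), which factors
      by Vieta's relations; all critical points are therefore real.\<close>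
    ultimately have "(z - of_real a) * (z + of_real a) * ((z - of_real b) * (z + of_real b)) = 0" by algebra
    then have "z = of_real a \<or> z = - of_real a \<or> z = of_real b \<or> z = - of_real b"
      by (auto simp: add_eq_0_iff2)
    then show False using z(2) by auto
  qed
  from has_complex_derivative_locally_injective[OF G_holomorphic _ open_sq_ne_1 this]
  obtain r where "r > 0" "ball z r \<subseteq> {u. u\<^sup>2 \<noteq> 1}" "inj_on G (ball z r)" using z(1) by auto
  then show ?thesis using that by blast
qed

lemma sph_holo_at_psi_g:
  assumes psi: "conformal_R lam psi"
  shows "sph_holo_at (\<lambda>u. psi (g (Some u))) z"
proof -
  have lim: "limitin sphere_top (\<lambda>u. psi (g (Some u))) (psi (g (Some w))) (at w)" for w
  proof -
    have "continuous_map sphere_top sphere_top (psi \<circ> g)"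
      using psi homeomorphic_g unfolding conformal_R_def
      by (auto intro: continuous_map_compose homeomorphic_imp_continuous_map)
    from continuous_map_sphere_at[OF this] show ?thesis by simp
  qed
  have sheet: "sph_holo_at (\<lambda>u. psi (g (Some u))) w" if w: "ff w \<noteq> 0" "w\<^sup>2 \<noteq> 1" for w
  proof -
    define k where "k = sheet w"
    have k: "k \<le> 2" "w \<in> Om k" using sheet_le_2 w by (auto simp: k_def Om_def)
    have X: "open (Om k \<inter> {u. u\<^sup>2 \<noteq> 1})" using open_Om open_sq_ne_1 by blast
    have "sph_holo_at (\<lambda>v. psi (Reg k (Some v))) (G w)"
      using psi k Om_avoids_cut[OF k(2) w(2)] unfolding conformal_R_def by blast
    then have "sph_holo_at (\<lambda>u. psi (Reg k (Some (G u)))) w"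
      by (rule sph_holo_at_compose[where S = "\<lambda>v. psi (Reg k (Some v))" and G = G, OF _ X])
        (use k w in \<open>auto intro: G_holomorphic_subset\<close>)
    then show ?thesis using X by (rule sph_holo_at_cong) (use k w g_regular in auto)
  qed
  have curve: "sph_holo_at (\<lambda>u. psi (g (Some u))) w" if w: "w\<^sup>2 \<noteq> 1" "Im w \<noteq> 0" for w
  proof -
    obtain r where r: "r > 0" "inj_on G (ball w r)" "\<And>u. u \<in> ball w r \<Longrightarrow> u\<^sup>2 \<noteq> 1"
      using G_locally_injective[OF w] by blast
    show ?thesis
    proof (rule sph_holo_at_across_arc[of "ball w r" w G])
      show "G holomorphic_on ball w r" using r(3) by (rule G_holomorphic_subset)
      fix u assume "u \<in> ball w r" "Im (G u) \<noteq> 0"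
      \<comment> \<open>G is real on the ovals, so a point with non-real value lies inside a region,
        where holomorphy is known.\<close>
      then show "sph_holo_at (\<lambda>u. psi (g (Some u))) u" using sheet curve_G(1) r(3) by blast
    qed (use r lim in auto)
  qed
  \<comment> \<open>The points where neither local argument applies: the two finite poles, and the
    real points of the ovals, where G is not locally injective.\<close>
  define E :: "complex set" where "E = {1, -1, of_real a, - of_real a, of_real b, - of_real b}"
  have E: "w \<in> E" if w: "w\<^sup>2 = 1 \<or> ff w = 0 \<and> Im w = 0" for w
  proof (cases "w\<^sup>2 = 1")
    case True
    then show ?thesis by (auto simp: E_def power2_eq_1_iff)
  next
    case False
    then have w: "ff w = 0" "Im w = 0" using w by auto
    then have n: "(norm w)\<^sup>2 = (Re w)\<^sup>2" by (simp add: cmod_power2)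
    have "(Re w)\<^sup>2 = a\<^sup>2 \<or> (Re w)\<^sup>2 = b\<^sup>2" using curve_Im_zero_iff[OF w(1)] w(2) unfolding n by blast
    then have "Re w = a \<or> Re w = - a \<or> Re w = b \<or> Re w = - b" by (auto simp: power2_eq_iff)
    moreover have "w = of_real (Re w)" using w(2) by (simp add: complex_eq_iff)
    ultimately show ?thesis unfolding E_def by (metis insertCI of_real_minus)
  qed
  show ?thesis
  proof (rule sph_holo_at_isolated[of "- (E - {z})"])
    show "open (- (E - {z}))" by (intro open_Compl finite_imp_closed finite_Diff) (simp add: E_def)
    fix u assume "u \<in> - (E - {z})" "u \<noteq> z"
    then have "u \<notin> E" by auto
    then show "sph_holo_at (\<lambda>u. psi (g (Some u))) u" using E[of u] sheet[of u] curve[of u] by blast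
  qed (use lim in auto)
qed

lemma psi_unique:
  assumes l: "l \<in> {1, 2}" and psi: "is_psi lam l psi" and p: "p \<in> R_set lam"
  shows "psi p = psi_formula l a (S p)"
proof -
  define F where "F z = psi (g z)" for z
  have conf: "conformal_R lam psi" using psi by (simp add: is_psi_def)
  have l2: "l \<le> 2" using l by auto
  have "homeomorphic_map sphere_top sphere_top (psi \<circ> g)"
    using conf homeomorphic_g homeomorphic_map_compose unfolding conformal_R_def by blast
  then have homF: "homeomorphic_map sphere_top sphere_top F" by (simp add: F_def[abs_def] o_def)
  then have contF: "continuous_map sphere_top sphere_top F" and injF: "inj F"
    by (auto simp: homeomorphic_imp_continuous_map homeomorphic_eq_everything_map)
  have contT: "continuous_map sphere_top sphere_top (psi_formula l a)"
    using homeomorphic_psi_formula[OF l] homeomorphic_imp_continuous_map by blast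
  have lim_sheet: "limitin sphere_top (\<lambda>w. psi (Reg k (Some w))) (F (pole k)) at_infinity" if "k \<le> 2" for k
  proof -
    have "continuous_map (R_top lam) sphere_top psi"
      using conf homeomorphic_imp_continuous_map unfolding conformal_R_def by blast
    from continuous_map_limit[OF this limitin_R_top_infinity[OF lam that]]
    show ?thesis using g_pole[OF that] by (simp add: F_def o_def)
  qed
  obtain B where B: "eventually (\<lambda>w. norm (the (psi (Reg l (Some w))) - w) \<le> B) at_infinity"
    using psi unfolding is_psi_def by (auto elim!: landau_o.bigE)
  \<comment> \<open>As psi - w stays bounded, psi tends to infinity along sheet l; limits on the
    sphere are unique.\<close>
  have F_pole: "F (pole l) = None"
  proof (rule limitin_Hausdorff_unique[OF lim_sheet[OF l2] _ _ Hausdorff_space_sphere_top])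
    have "eventually (\<lambda>w. psi (Reg l (Some w)) = None \<or> r < norm (the (psi (Reg l (Some w))))) at_infinity" for r
    proof -
      have "eventually (\<lambda>w::complex. r + B + 1 \<le> norm w) at_infinity" unfolding eventually_at_infinity by blast
      with B show ?thesis
      proof eventually_elim
        case (elim w)
        then show ?case using norm_triangle_ineq2[of w "the (psi (Reg l (Some w)))"]
          by (simp add: norm_minus_commute)
      qed
    qed
    then show "limitin sphere_top (\<lambda>w. psi (Reg l (Some w))) None at_infinity"
      by (simp add: limitin_sphere_None)
  qed (rule trivial_limit_at_infinity)
  have F_zero: "F (Some (-1)) = Some 0"
  proof -
    obtain C1 where "(\<lambda>w. the (psi (Reg 0 (Some w))) - C1 / w) \<in> O[at_infinity](\<lambda>w. 1 / w ^ 2)"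
      and fin: "eventually (\<lambda>w. psi (Reg 0 (Some w)) \<noteq> None) at_infinity"
      using psi unfolding is_psi_def by blast
    then obtain C where C: "eventually (\<lambda>w. norm (the (psi (Reg 0 (Some w))) - C1 / w) \<le> C * norm (1 / w ^ 2)) at_infinity"
      by (auto elim!: landau_o.bigE)
    have inv: "((\<lambda>w::complex. x / w) \<longlongrightarrow> 0) at_infinity" for x
      by (rule tendsto_divide_0[OF tendsto_const filterlim_ident])
    have "((\<lambda>w::complex. 1 / w * (1 / w)) \<longlongrightarrow> 0) at_infinity" by (intro tendsto_mult_zero inv)
    then have "((\<lambda>w::complex. C * norm (1 / w ^ 2)) \<longlongrightarrow> 0) at_infinity"
      by (intro tendsto_mult_right_zero tendsto_norm_zero) (simp add: power2_eq_square)
    from Lim_null_comparison[OF C this]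
    have "((\<lambda>w. the (psi (Reg 0 (Some w))) - C1 / w) \<longlongrightarrow> 0) at_infinity" .
    from tendsto_add[OF this inv[of C1]]
    have "((\<lambda>w. the (psi (Reg 0 (Some w)))) \<longlongrightarrow> 0) at_infinity" by simp
    then have "limitin sphere_top (\<lambda>w. psi (Reg 0 (Some w))) (Some 0) at_infinity"
      using fin by (simp add: limitin_sphere_Some)
    from limitin_Hausdorff_unique[OF lim_sheet[of 0] this trivial_limit_at_infinity Hausdorff_space_sphere_top]
    show ?thesis by (simp add: pole_def)
  qed
  \<comment> \<open>A homeomorphism takes the value infinity only once.\<close>
  have F_fin: "F z \<noteq> None" if "z \<noteq> pole l" for z
    using that F_pole injF by (metis injD)
  define D where "D z = the (F (Some z)) - T l z" for z
  have fin: "F (Some z) \<noteq> None" if "z \<noteq> 1" for z using F_fin[of "Some z"] that l by (auto simp: pole_def)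
  \<comment> \<open>The puncture at 1 serves both cases: it is the pole for l = 2 and a regular
    point for l = 1. Boundedness is shown at 1 and at infinity, one of which is the pole and the
    other a point where both functions have finite limits.\<close>
  have holF: "(\<lambda>z. the (F (Some z))) holomorphic_on - {1}"
    using fin sph_holo_at_psi_g[OF conf] by (intro holomorphic_on_the_sph) (auto simp: F_def)
  have "T l holomorphic_on - {1}"
    unfolding T_def[abs_def] by (cases "l = 1") (auto intro!: holomorphic_intros)
  then have holD: "D holomorphic_on - {1}" unfolding D_def[abs_def] using holF by (intro holomorphic_intros)
  have bd_pole: "\<exists>B. eventually (\<lambda>z. norm (D z) \<le> B) (at_pole l)"
  proof -
    have "eventually (\<lambda>z. norm (the (psi (Reg l (Some (G z)))) - G z) \<le> B) (at_pole l)"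
      by (rule eventually_compose_filterlim[OF B filterlim_G_at_pole])
    with eventually_at_pole_sheet[OF l2]
    have "eventually (\<lambda>z. norm (the (F (Some z)) - G z) \<le> B) (at_pole l)"
      by eventually_elim (auto simp: F_def g_regular)
    then have "\<exists>B. eventually (\<lambda>z. norm ((the (F (Some z)) - G z) - (T l z - G z)) \<le> B) (at_pole l)"
      by (intro eventually_bounded_diff[OF exI T_minus_G_bounded[OF l]])
    then show ?thesis by (simp add: D_def)
  qed
  have bd_limit: "\<exists>B. eventually (\<lambda>z. norm (D z) \<le> B) net"
    if lim: "limitin sphere_top (\<lambda>z. F (Some z)) (F q) net" "limitin sphere_top (\<lambda>z. psi_formula l a (Some z)) (psi_formula l a q) net"
      and q: "q \<noteq> pole l" and ev: "eventually (\<lambda>z. l = 1 \<or> z \<noteq> 1) net" for net q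
  proof -
    obtain x where x: "F q = Some x" using F_fin[OF q] by blast
    have "inj (psi_formula l a)" using homeomorphic_psi_formula[OF l] by (simp add: homeomorphic_eq_everything_map)
    then have "psi_formula l a q \<noteq> None" using psi_formula_pole[OF l] q by (metis injD)
    then obtain y where y: "psi_formula l a q = Some y" by blast
    have Fx: "((\<lambda>z. the (F (Some z))) \<longlongrightarrow> x) net" "((\<lambda>z. the (psi_formula l a (Some z))) \<longlongrightarrow> y) net"
      using lim x y by (auto simp: limitin_sphere_Some)
    have "eventually (\<lambda>z. the (psi_formula l a (Some z)) = T l z) net"
      using ev by eventually_elim (simp add: psi_formula_T[OF l])
    then have "(T l \<longlongrightarrow> y) net" by (rule Lim_transform_eventually[OF Fx(2)])
    then have "(D \<longlongrightarrow> x - y) net" unfolding D_def[abs_def] using Fx(1) by (intro tendsto_intros)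
    then show ?thesis by (rule tendsto_eventually_bounded)
  qed
  have bd: "\<exists>B. eventually (\<lambda>z. norm (D z) \<le> B) (at 1)" "\<exists>B. eventually (\<lambda>z. norm (D z) \<le> B) at_infinity"
  proof -
    from l consider "l = 1" | "l = 2" by auto
    then have "(\<exists>B. eventually (\<lambda>z. norm (D z) \<le> B) (at 1)) \<and> (\<exists>B. eventually (\<lambda>z. norm (D z) \<le> B) at_infinity)"
    proof cases
      case 1
      have "\<exists>B. eventually (\<lambda>z. norm (D z) \<le> B) (at 1)"
        by (rule bd_limit[OF continuous_map_sphere_at[OF contF] continuous_map_sphere_at[OF contT]])
          (use 1 in \<open>auto simp: pole_def\<close>)
      then show ?thesis using bd_pole 1 by (simp add: at_pole_def)
    next
      case 2
      have "eventually (\<lambda>z::complex. z \<noteq> 1) at_infinity"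
        unfolding eventually_at_infinity by (intro exI[of _ 2]) auto
      then have "\<exists>B. eventually (\<lambda>z. norm (D z) \<le> B) at_infinity"
        by (intro bd_limit[OF continuous_map_sphere_at_infinity[OF contF] continuous_map_sphere_at_infinity[OF contT]])
          (use 2 in \<open>auto simp: pole_def elim: eventually_mono\<close>)
      then show ?thesis using bd_pole 2 by (simp add: at_pole_def)
    qed
    then show "\<exists>B. eventually (\<lambda>z. norm (D z) \<le> B) (at 1)" "\<exists>B. eventually (\<lambda>z. norm (D z) \<le> B) at_infinity"
      by blast+
  qed
  obtain e where e: "\<And>z. z \<noteq> 1 \<Longrightarrow> D z = e" using bounded_punctured_plane_imp_constant[OF holD bd] by blast
  \<comment> \<open>Here the condition on sheet 0 enters: \<open>F_zero\<close> gives the value 0 at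
    -1, where \<open>T l\<close> vanishes as well.\<close>
  have "D (-1) = 0" using F_zero by (simp add: D_def T_def)
  then have D0: "D z = 0" if "z \<noteq> 1" for z using e[of "-1"] e[OF that] by simp
  have eq: "F (Some z) = psi_formula l a (Some z)" if "z \<noteq> 1" for z
    using D0[OF that] fin[OF that] psi_formula_T[OF l, of z] that by (auto simp: D_def)
  \<comment> \<open>The identity is so far known at finite z other than 1; continuity carries it to
    1 and to infinity.\<close>
  have eq_lim: "F q = psi_formula l a q"
    if "limitin sphere_top (\<lambda>z. F (Some z)) (F q) net" "limitin sphere_top (\<lambda>z. psi_formula l a (Some z)) (psi_formula l a q) net"
      "eventually (\<lambda>z. z \<noteq> 1) net" "net \<noteq> bot" for net q
  proof -
    have "eventually (\<lambda>z. F (Some z) = psi_formula l a (Some z)) net" using that(3) by eventually_elim (rule eq)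
    then have "limitin sphere_top (\<lambda>z. psi_formula l a (Some z)) (F q) net"
      using that(1) by (rule limitin_transform_eventually)
    from limitin_Hausdorff_unique[OF this that(2,4) Hausdorff_space_sphere_top] show ?thesis .
  qed
  have "F z = psi_formula l a z" for z
  proof (cases z)
    case None
    have "eventually (\<lambda>z::complex. z \<noteq> 1) at_infinity"
      unfolding eventually_at_infinity by (intro exI[of _ 2]) auto
    then have "F None = psi_formula l a None"
      by (rule eq_lim[OF continuous_map_sphere_at_infinity[OF contF] continuous_map_sphere_at_infinity[OF contT]])
        (rule trivial_limit_at_infinity)
    then show ?thesis using None by simp
  next
    case (Some u)
    show ?thesis
    proof (cases "u = 1")
      case True
      have "F (Some 1) = psi_formula l a (Some 1)"
        by (rule eq_lim[OF continuous_map_sphere_at[OF contF] continuous_map_sphere_at[OF contT]])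
          (simp_all add: eventually_at_filter)
      then show ?thesis using True Some by simp
    next
      case False
      then show ?thesis using eq Some by simp
    qed
  qed
  then show ?thesis using g_S[OF p] by (metis F_def)
qed

lemma is_psi_formula:
  assumes l: "l \<in> {1, 2}" and psi: "\<And>p. p \<in> R_set lam \<Longrightarrow> psi p = psi_formula l a (S p)"
  shows "is_psi lam l psi"
proof -
  have l2: "l \<le> 2" using l by auto
  have top: "topspace (R_top lam) = R_set lam" by (rule topspace_R_top[OF lam])
  have Reg: "Reg k (Some w) \<in> R_set lam" if "k \<le> 2" "w \<notin> cutset lam k" for k w
    using that by (auto simp: R_set_def)
  have Inf: "Reg k None \<in> R_set lam" if "k \<le> 2" for k using that by (auto simp: R_set_def)
  have "homeomorphic_map (R_top lam) sphere_top (psi_formula l a \<circ> S)"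
    by (rule homeomorphic_map_compose[OF homeomorphic_S homeomorphic_psi_formula[OF l]])
  then have hom: "homeomorphic_map (R_top lam) sphere_top psi"
    by (rule homeomorphic_map_eq) (use psi top in auto)
  have conf: "conformal_R lam psi"
    unfolding conformal_R_def
  proof (intro conjI allI impI hom)
    fix k w assume k: "k \<le> (2::nat)" and w: "w \<notin> cutset lam k"
    have "sph_holo_at (\<lambda>u. psi_formula l a (S (Reg k (Some u)))) w"
      by (intro sph_holo_at_psi_formula[OF l] sph_holo_at_S_finite k w)
    then show "sph_holo_at (\<lambda>u. psi (Reg k (Some u))) w"
      by (rule sph_holo_at_cong[of _ _ "- cutset lam k"]) (use closed_cutset w psi Reg k in auto)
  next
    fix k :: nat assume k: "k \<le> 2"
    have "sph_holo_at (\<lambda>u. psi_formula l a (S (Reg k (if u = 0 then None else Some (inverse u))))) 0"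
      using conformal_S k unfolding conformal_R_def by (intro sph_holo_at_psi_formula[OF l]) auto
    then show "sph_holo_at (\<lambda>u. psi (Reg k (if u = 0 then None else Some (inverse u)))) 0"
      \<comment> \<open>\<open>psi\<close> is prescribed on \<open>R_set lam\<close> only, so the
        disc must be small enough for 1/u to avoid the cuts.\<close>
      by (rule sph_holo_at_cong[of _ _ "ball 0 (1 / lam)"])
        (use lam psi Reg Inf k inverse_notin_cutset in auto)
  qed
  have inj: "inj_on psi (R_set lam)" using hom by (simp add: homeomorphic_eq_everything_map top)
  have at_inf: "psi (Reg l None) = None"
    using psi[OF Inf[OF l2]] S_infinity[OF l2] psi_formula_pole[OF l] by simp
  have finite: "eventually (\<lambda>w. psi (Reg k (Some w)) \<noteq> None) at_infinity" if "k \<le> 2" for k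
    using eventually_notin_cutset[OF lam, of k]
  proof eventually_elim
    case (elim w)
    show ?case
    proof
      assume "psi (Reg k (Some w)) = None"
      then have "Reg k (Some w) = Reg l None"
        using inj_onD[OF inj, of "Reg k (Some w)" "Reg l None"] at_inf Reg[OF that elim] Inf[OF l2] by simp
      then show False by simp
    qed
  qed
  \<comment> \<open>The substitution w = G z read backwards: \<open>S\<close> maps large w on sheet
    k to points z near the pole, where psi(w) = T l z.\<close>
  have transfer: "eventually (\<lambda>w. P (the (psi (Reg k (Some w)))) w) at_infinity"
    if k: "k \<le> 2" and P: "eventually (\<lambda>z. P (T l z) (G z)) (at_pole k)" for k P
  proof -
    have "eventually (\<lambda>w. P (T l (the (S (Reg k (Some w))))) (G (the (S (Reg k (Some w)))))) at_infinity"
      by (rule eventually_compose_filterlim[OF P filterlim_S[OF k]])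
    with eventually_notin_cutset[OF lam, of k] show ?thesis
    proof eventually_elim
      case (elim w)
      obtain u where u: "S (Reg k (Some w)) = Some u" "u \<in> Om k" "u\<^sup>2 \<noteq> 1" "G u = w"
        using S_regular[OF k elim(1)] .
      have "u \<noteq> 1" using u(3) by auto
      then have "psi (Reg k (Some w)) = Some (T l u)"
        using psi[OF Reg[OF k elim(1)]] u(1) psi_formula_T[OF l] by simp
      then show ?case using elim(2) u by simp
    qed
  qed
  obtain B where "eventually (\<lambda>z. norm (T l z - G z) \<le> B) (at_pole l)" using T_minus_G_bounded[OF l] by blast
  then have "eventually (\<lambda>w. norm (the (psi (Reg l (Some w))) - w) \<le> B) at_infinity"
    using transfer[OF l2, of "\<lambda>t w. norm (t - w) \<le> B"] by simp
  then have O1: "(\<lambda>w. the (psi (Reg l (Some w))) - w) \<in> O[at_infinity](\<lambda>_. 1)"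
    by (intro bigoI[of _ B]) simp
  obtain C B' where "eventually (\<lambda>z. norm (T l z - C / G z) \<le> B' * norm (1 / (G z)\<^sup>2)) (at_pole 0)"
    using T_asymptotics_sheet_0[OF l] by blast
  then have "eventually (\<lambda>w. norm (the (psi (Reg 0 (Some w))) - C / w) \<le> B' * norm (1 / w\<^sup>2)) at_infinity"
    using transfer[of 0 "\<lambda>t w. norm (t - C / w) \<le> B' * norm (1 / w\<^sup>2)"] by simp
  then have "(\<lambda>w. the (psi (Reg 0 (Some w))) - C / w) \<in> O[at_infinity](\<lambda>w. 1 / w ^ 2)"
    by (rule bigoI)
  then show ?thesis unfolding is_psi_def using conf finite[OF l2] finite[of 0] O1 by blast
qed

end

text \<open>The equivalence with \<open>is_psi\<close> contains both existence and uniqueness of the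
  two conformal maps. Equality is asserted on \<open>R_set lam\<close> because \<open>psi\<close> is
  a total function on the datatype of points.\<close>

theorem theorem3p3:
  fixes lam :: real
  assumes "1 < lam"
  shows "(\<exists>!a::real. 0 < a \<and> a < 1 \<and> a ^ 8 + (16 * lam\<^sup>2 - 8) * a ^ 6 + 18 * a ^ 4 - 27 = 0) \<and>
    (\<forall>a::real. 0 < a \<and> a < 1 \<and> a ^ 8 + (16 * lam\<^sup>2 - 8) * a ^ 6 + 18 * a ^ 4 - 27 = 0 \<longrightarrow>
       (\<exists>g. homeomorphic_map sphere_top (R_top lam) g \<and>
            (\<forall>z. proj (g z) = G_sph a z) \<and>
            conformal_R lam (inv_into UNIV g) \<and>
            (\<forall>l\<in>{1, 2}. \<forall>psi. is_psi lam l psi \<longleftrightarrow>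
               (\<forall>p\<in>R_set lam. psi p = psi_formula l a (inv_into UNIV g p)))))"
proof (intro conjI ex1_parameter[OF assms] allI impI)
  fix a :: real
  assume "0 < a \<and> a < 1 \<and> a ^ 8 + (16 * lam\<^sup>2 - 8) * a ^ 6 + 18 * a ^ 4 - 27 = 0"
  with assms interpret two_cut_surface lam a by unfold_locales auto
  have "is_psi lam l psi \<longleftrightarrow> (\<forall>p\<in>R_set lam. psi p = psi_formula l a (S p))" if "l \<in> {1, 2}" for l psi
    using psi_unique[OF that] is_psi_formula[OF that] by blast
  then show "\<exists>g. homeomorphic_map sphere_top (R_top lam) g \<and> (\<forall>z. proj (g z) = G_sph a z) \<and>
      conformal_R lam (inv_into UNIV g) \<and>
      (\<forall>l\<in>{1, 2}. \<forall>psi. is_psi lam l psi \<longleftrightarrow>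
         (\<forall>p\<in>R_set lam. psi p = psi_formula l a (inv_into UNIV g p)))"
    using homeomorphic_g proj_g conformal_S by blast
qed

end
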